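(* The operators $a_k,b_k$ ($1\le k\le n$) on $L(\mathbf w^{n-1})\oplus L(\mathbf w^n)$ provide the structure of a representation of the Clifford algebra $C$ (the generators $a_k,b_k$ of $C$ acting by the operators of the same name). Moreover, as representations of $C$, $$L(\mathbf w^{n-1})\oplus L(\mathbf w^n)\cong\textstyle\bigwedge W'.$$
   Context: Clifford algebra. $C$ is the associative unital complex algebra generated by the vector space with basis $a_1,\dots,a_n,b_1,\dots,b_n$ subject to $vw+wv=Q(v,w)\cdot1$, where $Q$ is the symmetric bilinear form with $Q(a_i,b_i)=Q(b_i,a_i)=1$ and all other pairings of basis vectors $0$. $W'=\mathrm{Span}\{b_1,\dots,b_n\}$; $C$ acts on $\bigwedge W'$ with $b_k$ acting by left multiplication $\xi\mapsto b_k\wedge\xi$ and $a_k$ acting by $w_1'\wedge\dots\wedge w_r'\mapsto\sum_{i=1}^r(-1)^{i-1}Q(a_k,w_i')\,w_1'\wedge\dots\widehat{w_i'}\dots\wedge w_r'$. Quiver varieties. Let $n\ge4$ and let $I=\{1,\dots,n\}$ be the vertex set of the Dynkin graph of type $D_n$, with edges $i - (i+1)$ for $1\le i\le n-2$ and $(n-2) - n$. $H$ is the set of edges with an orientation; $\mathrm{out}(h)$ is the source and $\mathrm{in}(h)$ the target of $h$; $\bar h$ is the reversed edge; $h_{i,j}$ goes from $i$ to $j$. $\Omega=\{h_{i,i+1}:1\le i\le n-2\}\cup\{h_{n-2,n}\}$; $\varepsilon=1$ on $\Omega$ and $-1$ on $H\setminus\Omega$. For a finite-dimensional $I$-graded complex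 vector space $\mathbf V$, $\mathbf E_{\mathbf V}=\bigoplus_{h\in H}\mathrm{Hom}(\mathbf V_{\mathrm{out}(h)},\mathbf V_{\mathrm{in}(h)})$, $G_{\mathbf V}=\prod_i\mathrm{Aut}(\mathbf V_i)$, and $\Lambda_{\mathbf V}$ is the set of $x\in\mathbf E_{\mathbf V}$ that are nilpotent (for some $N\ge1$ all compositions of $N$ maps $x_h$ along composable oriented edges vanish) and satisfy $\sum_{h:\mathrm{in}(h)=i}\varepsilon(h)x_hx_{\bar h}=0$ for all $i$. For $\mathbf v,\mathbf w\in\mathbb Z_{\ge0}^I$ and $I$-graded spaces $\mathbf V,\mathbf W$ of these graded dimensions, $\Lambda(\mathbf v,\mathbf w)=\Lambda_{\mathbf V}\times\bigoplus_i\mathrm{Hom}(\mathbf V_i,\mathbf W_i)\ni(x,j)$; $\Lambda(\mathbf v,\mathbf w)^{\mathrm{st}}$ is the set of $(x,j)$ for which the only $I$-graded $x$-stable subspace $\mathbf S\subset\mathbf V$ with $j(\mathbf S)=0$ is $0$. $G_{\mathbf V}$ acts by $(x,j)\mapsto((g_{\mathrm{in}(h)}x_hg_{\mathrm{out}(h)}^{-1}),(j_ig_i^{-1}))$, freely on $\Lambda(\mathbf v,\mathbf w)^{\mathrm{st}}$, and $\mathcal L(\mathbf v,\mathbf w)=\Lambda(\mathbf v,\mathbf w)^{\mathrm{st}}/G_{\mathbf V}$. Let $\mathbf w^i_j=\delta_{ij}$ and $\mathbf e^k_j=\delta_{kj}$. Constructible functions. $M(A)$ is the space of complex-valued constructible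 functions on $A$. For $\pi:A\to B$, $\pi^*f=f\circ\pi$, and $\pi_!$ is linear with $\pi_!(\mathbf 1_Z)(y)=\chi(\pi^{-1}(y)\cap Z)$ ($\chi$ = Euler characteristic). $\mathcal F(\mathbf v,\mathbf w;\mathbf v'')$ is the set of $G_{\mathbf V}$-orbits of triples $(x,j,\mathbf S)$ with $(x,j)\in\Lambda(\mathbf v,\mathbf w)^{\mathrm{st}}$ and $\mathbf S\subset\mathbf V$ an $I$-graded $x$-stable subspace of graded dimension $\mathbf v-\mathbf v''$; $\pi_1(x,j,\mathbf S)=(x|_{\mathbf S},j|_{\mathbf S})\in\mathcal L(\mathbf v-\mathbf v'',\mathbf w)$, $\pi_2(x,j,\mathbf S)=(x,j)\in\mathcal L(\mathbf v,\mathbf w)$. Taking $\mathbf v''=\mathbf e^k$, $F_kg=(\pi_2)_!\pi_1^*g$. $L(\mathbf w)\subset\bigoplus_{\mathbf v}M(\mathcal L(\mathbf v,\mathbf w))$ is the span of all functions obtained from the constant function $1$ on the point $\mathcal L(\mathbf 0,\mathbf w)$ by applying arbitrary compositions of the operators $F_1,\dots,F_n$. Young diagrams. $\mathcal Y$ is the set of strictly decreasing sequences $Y=(l_1>\dots>l_s)$ of positive integers, $s\ge0$, $l_1\le n-1$. Row $l_i$ has endpoint $n-l_i$. $l(Y)=s$ is the number of rows and $l_k(Y)$ the number of rows with endpoint strictly less than $k$. For $Y\in\mathcal Y$ let $\mathbf v_Y^{+}$ be the vector with $(\mathbf v_Y^+)_r=\#\{i:n-l_i\le r\}$ for $1\le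 r\le n-2$, $(\mathbf v_Y^+)_n=\lceil s/2\rceil$, $(\mathbf v_Y^+)_{n-1}=\lfloor s/2\rfloor$, and let $\mathbf v_Y^-$ be $\mathbf v_Y^+$ with entries $n-1$ and $n$ interchanged. It is known that $\mathcal L(\mathbf v,\mathbf w^n)$ (resp. $\mathcal L(\mathbf v,\mathbf w^{n-1})$) is a single point if $\mathbf v=\mathbf v_Y^+$ (resp. $\mathbf v=\mathbf v_Y^-$) for some $Y\in\mathcal Y$, necessarily unique and denoted $Y_{\mathbf v}$, and is empty otherwise. Clifford operators. For $\mathbf v\in\mathbb Z^n_{\ge 0}$, $\mathbf v^*$ is $\mathbf v$ with entries $n-1$ and $n$ interchanged (likewise $\mathbf w^*$). $\kappa:\mathcal L(\mathbf v,\mathbf w)\to\mathcal L(\mathbf v^*,\mathbf w^* )$ interchanges the roles of vertices $n-1$ and $n$ in $(x,j)$ (i.e. swaps $x_{h_{n-1,n-2}}$ with $x_{h_{n,n-2}}$, $x_{h_{n-2,n-1}}$ with $x_{h_{n-2,n}}$, and $j_{n-1}$ with $j_n$); $\kappa^*$ denotes the induced pullback $M(\mathcal L(\mathbf v,\mathbf w))\to M(\mathcal L(\mathbf v^*,\mathbf w^* ))$. For $1\le k\le n-1$ let $\mathbf y^k_i=1$ if $k\le i\le n-1$ and $0$ otherwise; $\mathbf z^k_i=1$ if $k\le i\le n-2$ or $i=n$ and $0$ otherwise. Consider $\bigsqcup_{\mathbf v}\mathcal L(\mathbf v,\mathbf w)\xleftarrow{\pi_1}\bigsqcup_{\mathbf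 v}\mathcal F(\mathbf v,\mathbf w;\mathbf y^k)\sqcup\bigsqcup_{\mathbf v}\mathcal F(\mathbf v,\mathbf w;\mathbf z^k)\xrightarrow{\pi_2}\bigsqcup_{\mathbf v}\mathcal L(\mathbf v,\mathbf w)$. For $\mathbf w\in\{\mathbf w^{n-1},\mathbf w^n\}$, $f\in M(\mathcal L(\mathbf v,\mathbf w))$ and $1\le k\le n-1$: $$a_k(f)=(-1)^{l_k(Y_{\mathbf v})}\kappa^*(\pi_1)_!\pi_2^*f,\qquad b_k(f)=(-1)^{l_k(Y_{\mathbf v})}\kappa^*(\pi_2)_!\pi_1^*f,$$ and $$a_n(f)=\begin{cases}(-1)^{l(Y_{\mathbf v})}\kappa^*f&\text{if }\mathbf w_n+l(Y_{\mathbf v})\text{ is even}\\0&\text{if odd}\end{cases},\qquad b_n(f)=\begin{cases}(-1)^{l(Y_{\mathbf v})}\kappa^*f&\text{if }\mathbf w_n+l(Y_{\mathbf v})\text{ is odd}\\0&\text{if even.}\end{cases}$$ These extend linearly to operators on $L(\mathbf w^{n-1})\oplus L(\mathbf w^n)$. *)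

theory Defs
  imports
    "HOL-Analysis.Analysis"
    "HOL-Homology.Homology"
    "HOL-Algebra.QuotRing"
    "HOL-Algebra.Algebraic_Closure_Type"
    "HOL-Library.Function_Algebras"
begin

no_notation Polynomials.var (\<open>X\<index>\<close>)

section \<open>Complex vector spaces and representations of algebras\<close>

definition cscale :: "complex \<Rightarrow> ('a \<Rightarrow> complex) \<Rightarrow> 'a \<Rightarrow> complex" where
  "cscale c f = (\<lambda>x. c * f x)"

interpretation cfun: vector_space cscale
  by unfold_locales (auto simp: cscale_def fun_eq_iff algebra_simps)

text \<open>Complex vector spaces with a carrier set are modules, in the sense of \<^theory>\<open>HOL-Algebra.Module\<close>,
  over the following ring; the multiplicative part of the record of such a module is irrelevant.\<close>

abbreviation complex_field :: "complex ring" where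
  "complex_field \<equiv> ring_of_type_algebra"

definition linear_maps :: "(complex, 'u) module \<Rightarrow> (complex, 'v) module \<Rightarrow> ('u \<Rightarrow> 'v) set" where
  "linear_maps V V' = {T \<in> carrier V \<rightarrow>\<^sub>E carrier V'.
     (\<forall>u\<in>carrier V. \<forall>u'\<in>carrier V. T (u \<oplus>\<^bsub>V\<^esub> u') = T u \<oplus>\<^bsub>V'\<^esub> T u') \<and>
     (\<forall>c. \<forall>u\<in>carrier V. T (c \<odot>\<^bsub>V\<^esub> u) = c \<odot>\<^bsub>V'\<^esub> T u)}"

definition End_ring :: "(complex, 'u) module \<Rightarrow> ('u \<Rightarrow> 'u) ring" where
  "End_ring V = \<lparr>carrier = linear_maps V V,
     mult = compose (carrier V),
     one = (\<lambda>u\<in>carrier V. u),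
     zero = (\<lambda>u\<in>carrier V. \<zero>\<^bsub>V\<^esub>),
     add = (\<lambda>S T. \<lambda>u\<in>carrier V. S u \<oplus>\<^bsub>V\<^esub> T u)\<rparr>"

text \<open>A complex algebra is given by a ring \<open>R\<close> and the structure map \<open>\<iota> : \<complex> \<rightarrow> R\<close>, \<open>c \<mapsto> c \<cdot> 1\<close>.\<close>

definition algebra_rep ::
  "'c ring \<Rightarrow> (complex \<Rightarrow> 'c) \<Rightarrow> (complex, 'u) module \<Rightarrow> ('c \<Rightarrow> 'u \<Rightarrow> 'u) \<Rightarrow> bool" where
  "algebra_rep R \<iota> V \<rho> \<longleftrightarrow> Module.module complex_field V \<and> \<rho> \<in> ring_hom R (End_ring V) \<and>
     (\<forall>c. \<rho> (\<iota> c) = (\<lambda>u\<in>carrier V. c \<odot>\<^bsub>V\<^esub> u))"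

definition rep_isomorphic ::
  "'c ring \<Rightarrow> (complex, 'u) module \<Rightarrow> ('c \<Rightarrow> 'u \<Rightarrow> 'u) \<Rightarrow>
    (complex, 'v) module \<Rightarrow> ('c \<Rightarrow> 'v \<Rightarrow> 'v) \<Rightarrow> bool" where
  "rep_isomorphic R V \<rho> V' \<sigma> \<longleftrightarrow>
     (\<exists>\<Phi>\<in>linear_maps V V'. bij_betw \<Phi> (carrier V) (carrier V') \<and>
        (\<forall>c\<in>carrier R. \<forall>u\<in>carrier V. \<Phi> (\<rho> c u) = \<sigma> c (\<Phi> u)))"


section \<open>The Clifford algebra and the exterior algebra\<close>

text \<open>The tensor algebra of the vector space with basis \<open>X\<close>, as the free algebra on the letters \<open>X\<close>:
  an element is the finitely supported function giving the coefficient of each word.\<close>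

definition word :: "'x list \<Rightarrow> 'x list \<Rightarrow> complex" where
  "word u = (\<lambda>u'. if u' = u then 1 else 0)"

definition tensor_mult :: "('x list \<Rightarrow> complex) \<Rightarrow> ('x list \<Rightarrow> complex) \<Rightarrow> 'x list \<Rightarrow> complex" where
  "tensor_mult p q = (\<lambda>u. \<Sum>i\<le>length u. p (take i u) * q (drop i u))"

definition tensor_algebra :: "'x set \<Rightarrow> ('x list \<Rightarrow> complex) ring" where
  "tensor_algebra X = \<lparr>carrier = {p. finite {u. p u \<noteq> 0} \<and> {u. p u \<noteq> 0} \<subseteq> lists X},
     mult = tensor_mult, one = word [], zero = 0, add = (+)\<rparr>"

definition degree_one :: "'x set \<Rightarrow> ('x list \<Rightarrow> complex) set" where
  "degree_one X = cfun.span ((\<lambda>t. word [t]) ` X)"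

datatype clifford_basis = gen_a nat | gen_b nat

definition basis_W :: "nat \<Rightarrow> clifford_basis set" where
  "basis_W n = gen_a ` {1..n} \<union> gen_b ` {1..n}"

definition basis_W' :: "nat \<Rightarrow> clifford_basis set" where
  "basis_W' n = gen_b ` {1..n}"

fun Q_basis :: "clifford_basis \<Rightarrow> clifford_basis \<Rightarrow> complex" where
  "Q_basis (gen_a i) (gen_b k) = (if i = k then 1 else 0)"
| "Q_basis (gen_b i) (gen_a k) = (if i = k then 1 else 0)"
| "Q_basis _ _ = 0"

definition Q_form ::
  "nat \<Rightarrow> (clifford_basis list \<Rightarrow> complex) \<Rightarrow> (clifford_basis list \<Rightarrow> complex) \<Rightarrow> complex" where
  "Q_form n v w = (\<Sum>s\<in>basis_W n. \<Sum>t\<in>basis_W n. v [s] * w [t] * Q_basis s t)"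

definition clifford_ideal :: "nat \<Rightarrow> (clifford_basis list \<Rightarrow> complex) set" where
  "clifford_ideal n = Idl\<^bsub>tensor_algebra (basis_W n)\<^esub>
     {tensor_mult v w + tensor_mult w v - cscale (Q_form n v w) (word []) | v w.
        v \<in> degree_one (basis_W n) \<and> w \<in> degree_one (basis_W n)}"

definition clifford :: "nat \<Rightarrow> (clifford_basis list \<Rightarrow> complex) set ring" where
  "clifford n = tensor_algebra (basis_W n) Quot clifford_ideal n"

definition clifford_scalar :: "nat \<Rightarrow> complex \<Rightarrow> (clifford_basis list \<Rightarrow> complex) set" where
  "clifford_scalar n c = clifford_ideal n +>\<^bsub>tensor_algebra (basis_W n)\<^esub> cscale c (word [])"

definition clifford_gen :: "nat \<Rightarrow> clifford_basis \<Rightarrow> (clifford_basis list \<Rightarrow> complex) set" where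
  "clifford_gen n t = clifford_ideal n +>\<^bsub>tensor_algebra (basis_W n)\<^esub> word [t]"

definition exterior_ideal :: "nat \<Rightarrow> (clifford_basis list \<Rightarrow> complex) set" where
  "exterior_ideal n = Idl\<^bsub>tensor_algebra (basis_W' n)\<^esub>
     {tensor_mult w w | w. w \<in> degree_one (basis_W' n)}"

definition exterior_ring :: "nat \<Rightarrow> (clifford_basis list \<Rightarrow> complex) set ring" where
  "exterior_ring n = tensor_algebra (basis_W' n) Quot exterior_ideal n"

definition exterior :: "nat \<Rightarrow> (complex, (clifford_basis list \<Rightarrow> complex) set) module" where
  "exterior n = \<lparr>carrier = carrier (exterior_ring n), mult = mult (exterior_ring n),
     one = one (exterior_ring n), zero = zero (exterior_ring n), add = add (exterior_ring n),
     smult = (\<lambda>c X. (exterior_ideal n +>\<^bsub>tensor_algebra (basis_W' n)\<^esub> cscale c (word []))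
                 \<otimes>\<^bsub>exterior_ring n\<^esub> X)\<rparr>"

definition exterior_B :: "nat \<Rightarrow> nat \<Rightarrow>
    (clifford_basis list \<Rightarrow> complex) set \<Rightarrow> (clifford_basis list \<Rightarrow> complex) set" where
  "exterior_B n k = (\<lambda>X\<in>carrier (exterior n).
     (exterior_ideal n +>\<^bsub>tensor_algebra (basis_W' n)\<^esub> word [gen_b k]) \<otimes>\<^bsub>exterior_ring n\<^esub> X)"

text \<open>\<open>contraction k\<close> is the map
  \<open>w\<^sub>1 \<otimes> \<dots> \<otimes> w\<^sub>r \<mapsto> \<Sum>\<^sub>i (-1)\<^bsup>i-1\<^esup> Q(a\<^sub>k, w\<^sub>i) w\<^sub>1 \<otimes> \<dots> (omit w\<^sub>i) \<dots> \<otimes> w\<^sub>r\<close> on the tensor algebra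
  (positions are numbered from 0 below); it is linear in each \<open>w\<^sub>i\<close>, hence determined by words in
  the basis of \<open>W'\<close>. \<open>exterior_A\<close> is the map which it induces on cosets.\<close>

definition contraction ::
  "nat \<Rightarrow> (clifford_basis list \<Rightarrow> complex) \<Rightarrow> clifford_basis list \<Rightarrow> complex" where
  "contraction k p = (\<Sum>u | p u \<noteq> 0. cscale (p u)
     (\<Sum>i<length u. cscale ((-1) ^ i * Q_basis (gen_a k) (u ! i)) (word (take i u @ drop (Suc i) u))))"

definition exterior_A :: "nat \<Rightarrow> nat \<Rightarrow>
    (clifford_basis list \<Rightarrow> complex) set \<Rightarrow> (clifford_basis list \<Rightarrow> complex) set" where
  "exterior_A n k = (\<lambda>X\<in>carrier (exterior n).
     \<Union>p\<in>X. exterior_ideal n +>\<^bsub>tensor_algebra (basis_W' n)\<^esub> contraction k p)"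


section \<open>Euler characteristic and constructible functions\<close>

definition integrally_independent :: "('g, 'm) monoid_scheme \<Rightarrow> 'g set \<Rightarrow> bool" where
  "integrally_independent G S \<longleftrightarrow> (\<forall>c::'g \<Rightarrow> int.
     finprod G (\<lambda>b. b [^]\<^bsub>G\<^esub> c b) S = \<one>\<^bsub>G\<^esub> \<longrightarrow> (\<forall>b\<in>S. c b = 0))"

definition abelian_rank :: "('g, 'm) monoid_scheme \<Rightarrow> nat" where
  "abelian_rank G = (GREATEST r. \<exists>S. finite S \<and> S \<subseteq> carrier G \<and> card S = r \<and>
     integrally_independent G S)"

definition betti :: "nat \<Rightarrow> 'a topology \<Rightarrow> nat" where
  "betti p X = abelian_rank (homology_group (int p) X)"

definition euler_char :: "'a topology \<Rightarrow> int" where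
  "euler_char X = (\<Sum>p | betti p X \<noteq> 0. (-1) ^ p * int (betti p X))"

definition quotient_topology :: "'p topology \<Rightarrow> ('p \<Rightarrow> 'a) \<Rightarrow> 'a topology" where
  "quotient_topology X q =
     topology (\<lambda>U. U \<subseteq> q ` topspace X \<and> openin X {p \<in> topspace X. q p \<in> U})"

lemma openin_quotient_topology:
  "openin (quotient_topology X q) U \<longleftrightarrow> U \<subseteq> q ` topspace X \<and> openin X {p \<in> topspace X. q p \<in> U}"
proof -
  have "istopology (\<lambda>U. U \<subseteq> q ` topspace X \<and> openin X {p \<in> topspace X. q p \<in> U})"
    unfolding istopology_def
  proof (intro conjI allI impI)
    fix S T
    assume S: "S \<subseteq> q ` topspace X \<and> openin X {p \<in> topspace X. q p \<in> S}"
      and T: "T \<subseteq> q ` topspace X \<and> openin X {p \<in> topspace X. q p \<in> T}"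
    have "openin X ({p \<in> topspace X. q p \<in> S} \<inter> {p \<in> topspace X. q p \<in> T})"
      using S T by (intro openin_Int) blast+
    also have "{p \<in> topspace X. q p \<in> S} \<inter> {p \<in> topspace X. q p \<in> T} =
        {p \<in> topspace X. q p \<in> S \<inter> T}"
      by blast
    finally show "openin X {p \<in> topspace X. q p \<in> S \<inter> T}" .
    show "S \<inter> T \<subseteq> q ` topspace X"
      using S by auto
  next
    fix K
    assume K: "\<forall>S\<in>K. S \<subseteq> q ` topspace X \<and> openin X {p \<in> topspace X. q p \<in> S}"
    have "openin X (\<Union>S\<in>K. {p \<in> topspace X. q p \<in> S})"
      using K by (intro openin_Union) blast
    also have "(\<Union>S\<in>K. {p \<in> topspace X. q p \<in> S}) = {p \<in> topspace X. q p \<in> \<Union>K}"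
      by blast
    finally show "openin X {p \<in> topspace X. q p \<in> \<Union>K}" .
    show "\<Union>K \<subseteq> q ` topspace X"
      using K by auto
  qed
  then show ?thesis
    by (simp add: quotient_topology_def topology_inverse')
qed

text \<open>Below, a variety is given as the image of a map \<open>q\<close> on a set \<open>P\<close> of points of an affine space,
  whose coordinate functions form the set \<open>K\<close>. Its topology is the quotient of the classical one of
  \<open>P\<close>, and by Chevalley's theorem its constructible subsets are those with constructible
  preimage in \<open>P\<close>.\<close>

inductive_set polynomials :: "('p \<Rightarrow> complex) set \<Rightarrow> ('p \<Rightarrow> complex) set"
  for K :: "('p \<Rightarrow> complex) set" where
  "f \<in> K \<Longrightarrow> f \<in> polynomials K"
| "(\<lambda>_. c) \<in> polynomials K"
| "f \<in> polynomials K \<Longrightarrow> g \<in> polynomials K \<Longrightarrow> (\<lambda>p. f p + g p) \<in> polynomials K"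
| "f \<in> polynomials K \<Longrightarrow> g \<in> polynomials K \<Longrightarrow> (\<lambda>p. f p * g p) \<in> polynomials K"

inductive_set constructible_sets :: "('p \<Rightarrow> complex) set \<Rightarrow> 'p set \<Rightarrow> 'p set set"
  for K :: "('p \<Rightarrow> complex) set" and P :: "'p set" where
  "f \<in> polynomials K \<Longrightarrow> {p \<in> P. f p = 0} \<in> constructible_sets K P"
| "Z \<in> constructible_sets K P \<Longrightarrow> P - Z \<in> constructible_sets K P"
| "Z \<in> constructible_sets K P \<Longrightarrow> Z' \<in> constructible_sets K P \<Longrightarrow> Z \<union> Z' \<in> constructible_sets K P"

definition constructible_fun ::
  "('p \<Rightarrow> complex) set \<Rightarrow> 'p set \<Rightarrow> ('p \<Rightarrow> 'a) \<Rightarrow> ('a \<Rightarrow> complex) \<Rightarrow> bool" where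
  "constructible_fun K P q f \<longleftrightarrow> finite (f ` q ` P) \<and>
     (\<forall>c. {p \<in> P. f (q p) = c} \<in> constructible_sets K P)"

text \<open>The value at \<open>y\<close> of \<open>\<pi>\<^sub>! f\<close>, for the constructible function
  \<open>f = \<Sum>\<^sub>c c \<cdot> 1\<^bsub>{f = c}\<^esub>\<close>, is the Euler integral of \<open>f\<close> over the fibre \<open>\<pi>\<^bsup>-1\<^esup>(y)\<close>.\<close>

definition euler_integral :: "'a topology \<Rightarrow> ('a \<Rightarrow> complex) \<Rightarrow> complex" where
  "euler_integral X f = (\<Sum>c \<in> f ` topspace X.
     c * of_int (euler_char (subtopology X {p \<in> topspace X. f p = c})))"


section \<open>Quiver varieties of type D\<close>

text \<open>The vector space \<open>\<complex>\<^sup>d\<close> consists of the functions on \<open>nat\<close> vanishing off \<open>{..<d}\<close>; linear maps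
  \<open>\<complex>\<^sup>d \<rightarrow> \<complex>\<^sup>r\<close> are matrices (first index: row) with entries 0 outside the \<open>r \<times> d\<close> block. Thus the
  topology of \<^theory>\<open>HOL-Analysis.Function_Topology\<close> induces the usual one on sets of matrices.\<close>

type_synonym cvec = "nat \<Rightarrow> complex"
type_synonym cmat = "nat \<Rightarrow> nat \<Rightarrow> complex"

definition cspace :: "nat \<Rightarrow> cvec set" where
  "cspace d = {u. \<forall>i\<ge>d. u i = 0}"

definition mat_space :: "nat \<Rightarrow> nat \<Rightarrow> cmat set" where
  "mat_space d r = {M. \<forall>i k. i \<ge> r \<or> k \<ge> d \<longrightarrow> M i k = 0}"

definition mat_apply :: "nat \<Rightarrow> cmat \<Rightarrow> cvec \<Rightarrow> cvec" where
  "mat_apply d M u = (\<lambda>i. \<Sum>l<d. M i l * u l)"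

definition mat_mult :: "nat \<Rightarrow> cmat \<Rightarrow> cmat \<Rightarrow> cmat" where
  "mat_mult d M N = (\<lambda>i k. \<Sum>l<d. M i l * N l k)"

definition mat_id :: "nat \<Rightarrow> cmat" where
  "mat_id d = (\<lambda>i k. if i = k \<and> i < d then 1 else 0)"

definition is_inverse :: "nat \<Rightarrow> cmat \<Rightarrow> cmat \<Rightarrow> bool" where
  "is_inverse d M N \<longleftrightarrow> N \<in> mat_space d d \<and> mat_mult d M N = mat_id d \<and> mat_mult d N M = mat_id d"

definition mat_inv :: "nat \<Rightarrow> cmat \<Rightarrow> cmat" where
  "mat_inv d M = (THE N. is_inverse d M N)"

definition GL :: "nat \<Rightarrow> cmat set" where
  "GL d = {M \<in> mat_space d d. \<exists>N. is_inverse d M N}"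

text \<open>The oriented edge \<open>h\<^bsub>i,j\<^esub>\<close> is the pair \<open>(i, j)\<close>, so that \<open>out = fst\<close> and \<open>in = snd\<close>.\<close>

type_synonym arrow = "nat \<times> nat"

definition orientation :: "nat \<Rightarrow> arrow set" where
  "orientation n = {(i, i + 1) | i. 1 \<le> i \<and> i \<le> n - 2} \<union> {(n - 2, n)}"

definition arrows :: "nat \<Rightarrow> arrow set" where
  "arrows n = orientation n \<union> (orientation n)\<inverse>"

definition eps :: "nat \<Rightarrow> arrow \<Rightarrow> complex" where
  "eps n h = (if h \<in> orientation n then 1 else -1)"

type_synonym dimv = "nat \<Rightarrow> nat"

definition dim_vectors :: "nat \<Rightarrow> dimv set" where
  "dim_vectors n = {v. \<forall>i. i \<notin> {1..n} \<longrightarrow> v i = 0}"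

text \<open>The graded spaces are \<open>V\<^sub>i = \<complex>\<^bsup>v i\<^esup>\<close>, \<open>W\<^sub>i = \<complex>\<^bsup>w i\<^esup>\<close>. Dimension vectors are always taken from
  \<^const>\<open>dim_vectors\<close>, so components at indices outside the vertex set \<open>{1..n}\<close> are trivial.\<close>

type_synonym edge_maps = "arrow \<Rightarrow> cmat"
type_synonym vertex_maps = "nat \<Rightarrow> cmat"
type_synonym graded_space = "nat \<Rightarrow> cvec set"

definition E_space :: "nat \<Rightarrow> dimv \<Rightarrow> edge_maps set" where
  "E_space n v = {x. (\<forall>h\<in>arrows n. x h \<in> mat_space (v (fst h)) (v (snd h))) \<and>
     (\<forall>h. h \<notin> arrows n \<longrightarrow> x h = (\<lambda>i k. 0))}"

fun path_apply :: "dimv \<Rightarrow> edge_maps \<Rightarrow> arrow list \<Rightarrow> cvec \<Rightarrow> cvec" where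
  "path_apply v x [] u = u"
| "path_apply v x (h # hs) u = path_apply v x hs (mat_apply (v (fst h)) (x h) u)"

definition nilpotent_rep :: "nat \<Rightarrow> dimv \<Rightarrow> edge_maps \<Rightarrow> bool" where
  "nilpotent_rep n v x \<longleftrightarrow> (\<exists>N\<ge>1. \<forall>hs. length hs = N \<and> set hs \<subseteq> arrows n \<and>
     successively (\<lambda>h h'. snd h = fst h') hs \<longrightarrow>
     (\<forall>u\<in>cspace (v (fst (hd hs))). path_apply v x hs u = (\<lambda>_. 0)))"

definition Lambda_V :: "nat \<Rightarrow> dimv \<Rightarrow> edge_maps set" where
  "Lambda_V n v = {x \<in> E_space n v. nilpotent_rep n v x \<and>
     (\<forall>i\<in>{1..n}. \<forall>r c.
        (\<Sum>h | h \<in> arrows n \<and> snd h = i. eps n h * mat_mult (v (fst h)) (x h) (x (prod.swap h)) r c) = 0)}"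

definition J_space :: "dimv \<Rightarrow> dimv \<Rightarrow> vertex_maps set" where
  "J_space v w = {j. \<forall>i. j i \<in> mat_space (v i) (w i)}"

definition Lambda :: "nat \<Rightarrow> dimv \<Rightarrow> dimv \<Rightarrow> (edge_maps \<times> vertex_maps) set" where
  "Lambda n v w = Lambda_V n v \<times> J_space v w"

definition graded_subspace :: "dimv \<Rightarrow> graded_space \<Rightarrow> bool" where
  "graded_subspace v S \<longleftrightarrow> (\<forall>i. cfun.subspace (S i) \<and> S i \<subseteq> cspace (v i))"

definition stable_under :: "nat \<Rightarrow> dimv \<Rightarrow> edge_maps \<Rightarrow> graded_space \<Rightarrow> bool" where
  "stable_under n v x S \<longleftrightarrow>
     (\<forall>h\<in>arrows n. mat_apply (v (fst h)) (x h) ` S (fst h) \<subseteq> S (snd h))"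

definition Lambda_st :: "nat \<Rightarrow> dimv \<Rightarrow> dimv \<Rightarrow> (edge_maps \<times> vertex_maps) set" where
  "Lambda_st n v w = {(x, j) \<in> Lambda n v w. \<forall>S. graded_subspace v S \<and> stable_under n v x S \<and>
     (\<forall>i. \<forall>u\<in>S i. mat_apply (v i) (j i) u = (\<lambda>_. 0)) \<longrightarrow> (\<forall>i. S i = {\<lambda>_. 0})}"

definition G_V :: "dimv \<Rightarrow> vertex_maps set" where
  "G_V v = {g. \<forall>i. g i \<in> GL (v i)}"

definition act_x :: "dimv \<Rightarrow> vertex_maps \<Rightarrow> edge_maps \<Rightarrow> edge_maps" where
  "act_x v g x = (\<lambda>h. mat_mult (v (snd h)) (g (snd h))
     (mat_mult (v (fst h)) (x h) (mat_inv (v (fst h)) (g (fst h)))))"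

definition act_j :: "dimv \<Rightarrow> vertex_maps \<Rightarrow> vertex_maps \<Rightarrow> vertex_maps" where
  "act_j v g j = (\<lambda>i. mat_mult (v i) (j i) (mat_inv (v i) (g i)))"

definition act_S :: "dimv \<Rightarrow> vertex_maps \<Rightarrow> graded_space \<Rightarrow> graded_space" where
  "act_S v g S = (\<lambda>i. mat_apply (v i) (g i) ` S i)"

type_synonym point = "(edge_maps \<times> vertex_maps) set"

definition G_orbit :: "dimv \<Rightarrow> edge_maps \<times> vertex_maps \<Rightarrow> point" where
  "G_orbit v = (\<lambda>(x, j). {(act_x v g x, act_j v g j) | g. g \<in> G_V v})"

definition L_var :: "nat \<Rightarrow> dimv \<Rightarrow> dimv \<Rightarrow> point set" where
  "L_var n v w = G_orbit v ` Lambda_st n v w"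

type_synonym flag_point = "(edge_maps \<times> vertex_maps \<times> graded_space) set"

definition flag_triples ::
  "nat \<Rightarrow> dimv \<Rightarrow> dimv \<Rightarrow> dimv \<Rightarrow> (edge_maps \<times> vertex_maps \<times> graded_space) set" where
  "flag_triples n v w v'' = {(x, j, S). (x, j) \<in> Lambda_st n v w \<and>
     graded_subspace v S \<and> stable_under n v x S \<and> (\<forall>i. cfun.dim (S i) + v'' i = v i)}"

definition flag_orbit ::
  "dimv \<Rightarrow> edge_maps \<times> vertex_maps \<times> graded_space \<Rightarrow> flag_point" where
  "flag_orbit v = (\<lambda>(x, j, S). {(act_x v g x, act_j v g j, act_S v g S) | g. g \<in> G_V v})"

definition F_var :: "nat \<Rightarrow> dimv \<Rightarrow> dimv \<Rightarrow> dimv \<Rightarrow> flag_point set" where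
  "F_var n v w v'' = flag_orbit v ` flag_triples n v w v''"

text \<open>\<open>\<pi>\<^sub>1\<close> of the class of \<open>(x, j, S)\<close>: all pairs obtained from \<open>(x|\<^sub>S, j|\<^sub>S)\<close> by choosing a
  graded isomorphism \<open>s : \<complex>\<^sup>d \<cong> S\<close>, where \<open>d\<close> is the graded dimension of \<open>S\<close>.\<close>

definition pi1 :: "nat \<Rightarrow> dimv \<Rightarrow> dimv \<Rightarrow> flag_point \<Rightarrow> point" where
  "pi1 n v w T = {(x', j'). \<exists>x j S d s. (x, j, S) \<in> T \<and> (\<forall>i. d i = cfun.dim (S i)) \<and>
     x' \<in> E_space n d \<and> j' \<in> J_space d w \<and>
     (\<forall>i. s i \<in> mat_space (d i) (v i) \<and> bij_betw (mat_apply (d i) (s i)) (cspace (d i)) (S i)) \<and>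
     (\<forall>h\<in>arrows n. mat_mult (d (snd h)) (s (snd h)) (x' h) = mat_mult (v (fst h)) (x h) (s (fst h))) \<and>
     (\<forall>i. j' i = mat_mult (v i) (j i) (s i))}"

definition pi2 :: "flag_point \<Rightarrow> point" where
  "pi2 T = (\<lambda>(x, j, S). (x, j)) ` T"

text \<open>The classical topology and the constructible sets of \<^const>\<open>F_var\<close> are obtained from the set of
  triples \<open>(x, j, s)\<close> in which the graded subspace is presented as the image of an injective
  graded linear map \<open>s\<close>, i.e. the Grassmannians are presented as quotients of spaces of frames.
  (Injectivity is forced by the dimension condition in \<^const>\<open>flag_triples\<close>.)\<close>

definition frame_image :: "dimv \<Rightarrow> vertex_maps \<Rightarrow> graded_space" where
  "frame_image d s = (\<lambda>i. mat_apply (d i) (s i) ` cspace (d i))"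

definition framed_triples ::
  "nat \<Rightarrow> dimv \<Rightarrow> dimv \<Rightarrow> dimv \<Rightarrow> (edge_maps \<times> vertex_maps \<times> vertex_maps) set" where
  "framed_triples n v w v'' = {(x, j, s).
     (\<forall>i. s i \<in> mat_space (v i - v'' i) (v i)) \<and>
     (x, j, frame_image (\<lambda>i. v i - v'' i) s) \<in> flag_triples n v w v''}"

definition frame_orbit ::
  "dimv \<Rightarrow> dimv \<Rightarrow> edge_maps \<times> vertex_maps \<times> vertex_maps \<Rightarrow> flag_point" where
  "frame_orbit v v'' = (\<lambda>(x, j, s). flag_orbit v (x, j, frame_image (\<lambda>i. v i - v'' i) s))"

definition frame_coordinates :: "(edge_maps \<times> vertex_maps \<times> vertex_maps \<Rightarrow> complex) set" where
  "frame_coordinates = {\<lambda>(x, j, s). x h r c | h r c. True} \<union>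
     {\<lambda>(x, j, s). j i r c | i r c. True} \<union> {\<lambda>(x, j, s). s i r c | i r c. True}"

definition F_topology :: "nat \<Rightarrow> dimv \<Rightarrow> dimv \<Rightarrow> dimv \<Rightarrow> flag_point topology" where
  "F_topology n v w v'' =
     quotient_topology (top_of_set (framed_triples n v w v'')) (frame_orbit v v'')"

definition F_constructible ::
  "nat \<Rightarrow> dimv \<Rightarrow> dimv \<Rightarrow> dimv \<Rightarrow> (flag_point \<Rightarrow> complex) \<Rightarrow> bool" where
  "F_constructible n v w v'' =
     constructible_fun frame_coordinates (framed_triples n v w v'') (frame_orbit v v'')"

text \<open>\<open>\<pi>\<^sub>!\<close> for a map \<open>\<pi>\<close> on \<^const>\<open>F_var\<close>; it is only meaningful on constructible functions.\<close>

definition pushforward :: "nat \<Rightarrow> dimv \<Rightarrow> dimv \<Rightarrow> dimv \<Rightarrow>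
    (flag_point \<Rightarrow> point) \<Rightarrow> (flag_point \<Rightarrow> complex) \<Rightarrow> point \<Rightarrow> complex" where
  "pushforward n v w v'' \<pi> f y = (if F_constructible n v w v'' f
     then euler_integral (subtopology (F_topology n v w v'') {T \<in> F_var n v w v''. \<pi> T = y}) f
     else 0)"


section \<open>The operators\<close>

text \<open>An element of \<open>\<Oplus>\<^sub>w \<Oplus>\<^sub>v M(L(v,w))\<close> is the function sending \<open>(w, v, y)\<close> to the value at
  \<open>y \<in> L(v,w)\<close> of its component in \<open>M(L(v,w))\<close>, and to 0 if \<open>y \<notin> L(v,w)\<close>.\<close>

type_synonym qfun = "dimv \<times> dimv \<times> point \<Rightarrow> complex"

text \<open>\<open>corr_up n v''\<close> is \<open>(\<pi>\<^sub>2)\<^sub>! \<pi>\<^sub>1\<^sup>*\<close> and \<open>corr_down n v''\<close> is \<open>(\<pi>\<^sub>1)\<^sub>! \<pi>\<^sub>2\<^sup>*\<close>, for the varieties \<open>F(v,w;v'')\<close> with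
  all \<open>v\<close> and \<open>w\<close>. (If \<open>v'' \<le> v\<close> fails, then \<open>F(v,w;v'')\<close> is empty.)\<close>

definition corr_up :: "nat \<Rightarrow> dimv \<Rightarrow> qfun \<Rightarrow> qfun" where
  "corr_up n v'' f = (\<lambda>(w, v, y). if v \<in> dim_vectors n \<and> y \<in> L_var n v w
     then pushforward n v w v'' pi2 (\<lambda>T. f (w, (\<lambda>i. v i - v'' i), pi1 n v w T)) y else 0)"

definition corr_down :: "nat \<Rightarrow> dimv \<Rightarrow> qfun \<Rightarrow> qfun" where
  "corr_down n v'' f = (\<lambda>(w, u, y). if u \<in> dim_vectors n \<and> y \<in> L_var n u w
     then (let v = (\<lambda>i. u i + v'' i) in
       pushforward n v w v'' (pi1 n v w) (\<lambda>T. f (w, v, pi2 T)) y) else 0)"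

text \<open>Both \<open>w\<^sup>k\<close> and \<open>e\<^sup>k\<close>.\<close>

definition unit_dim :: "nat \<Rightarrow> dimv" where
  "unit_dim k = (\<lambda>i. if i = k then 1 else 0)"

definition F_op :: "nat \<Rightarrow> nat \<Rightarrow> qfun \<Rightarrow> qfun" where
  "F_op n k = corr_up n (unit_dim k)"

definition vacuum :: "nat \<Rightarrow> dimv \<Rightarrow> qfun" where
  "vacuum n w = (\<lambda>(w', v, y). if w' = w \<and> v = (\<lambda>_. 0) \<and> y \<in> L_var n v w then 1 else 0)"

inductive_set F_monomials :: "nat \<Rightarrow> dimv \<Rightarrow> qfun set" for n :: nat and w :: dimv where
  "vacuum n w \<in> F_monomials n w"
| "f \<in> F_monomials n w \<Longrightarrow> k \<in> {1..n} \<Longrightarrow> F_op n k f \<in> F_monomials n w"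

definition L_module :: "nat \<Rightarrow> dimv \<Rightarrow> qfun set" where
  "L_module n w = cfun.span (F_monomials n w)"

text \<open>\<open>L(w\<^bsup>n-1\<^esup>) \<oplus> L(w\<^sup>n)\<close>. The sum below is direct, as the two subspaces consist of functions supported on
  \<open>w = w\<^bsup>n-1\<^esup>\<close> and on \<open>w = w\<^sup>n\<close>, respectively.\<close>

definition spin_module :: "nat \<Rightarrow> (complex, qfun) module" where
  "spin_module n = \<lparr>carrier = {f + g | f g.
       f \<in> L_module n (unit_dim (n - 1)) \<and> g \<in> L_module n (unit_dim n)},
     mult = undefined, one = undefined, zero = 0, add = (+), smult = cscale\<rparr>"

definition young :: "nat \<Rightarrow> nat list set" where
  "young n = {Y. sorted_wrt (>) Y \<and> set Y \<subseteq> {1..n - 1}}"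

definition rows_before :: "nat \<Rightarrow> nat \<Rightarrow> nat list \<Rightarrow> nat" where
  "rows_before n k Y = length (filter (\<lambda>l. n - l < k) Y)"

definition star :: "nat \<Rightarrow> dimv \<Rightarrow> dimv" where
  "star n v = v(n - 1 := v n, n := v (n - 1))"

definition v_plus :: "nat \<Rightarrow> nat list \<Rightarrow> dimv" where
  "v_plus n Y = (\<lambda>r. if 1 \<le> r \<and> r \<le> n - 2 then length (filter (\<lambda>l. n - l \<le> r) Y)
     else if r = n then (length Y + 1) div 2
     else if r = n - 1 then length Y div 2 else 0)"

definition v_minus :: "nat \<Rightarrow> nat list \<Rightarrow> dimv" where
  "v_minus n Y = star n (v_plus n Y)"

definition Y_of :: "nat \<Rightarrow> dimv \<Rightarrow> dimv \<Rightarrow> nat list" where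
  "Y_of n w v = (THE Y. Y \<in> young n \<and>
     v = (if w = unit_dim n then v_plus n Y else v_minus n Y))"

definition swap_vertex :: "nat \<Rightarrow> nat \<Rightarrow> nat" where
  "swap_vertex n = id(n - 1 := n, n := n - 1)"

definition kappa :: "nat \<Rightarrow> point \<Rightarrow> point" where
  "kappa n y = (\<lambda>(x, j). (x \<circ> map_prod (swap_vertex n) (swap_vertex n), j \<circ> swap_vertex n)) ` y"

text \<open>Since \<open>\<kappa>\<close> is an involution, the value at \<open>y \<in> L(v\<^sup>*,w\<^sup>*)\<close> of \<open>\<kappa>\<^sup>* f\<close>, where \<open>f \<in> M(L(v,w))\<close>, is
  \<open>f (\<kappa> y)\<close>.\<close>

definition kappa_pullback :: "nat \<Rightarrow> qfun \<Rightarrow> qfun" where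
  "kappa_pullback n f = (\<lambda>(w, v, y). f (star n w, star n v, kappa n y))"

definition y_dim :: "nat \<Rightarrow> nat \<Rightarrow> dimv" where
  "y_dim n k = (\<lambda>i. if k \<le> i \<and> i \<le> n - 1 then 1 else 0)"

definition z_dim :: "nat \<Rightarrow> nat \<Rightarrow> dimv" where
  "z_dim n k = (\<lambda>i. if (k \<le> i \<and> i \<le> n - 2) \<or> i = n then 1 else 0)"

text \<open>\<open>a_hom n k w v\<close> and \<open>b_hom n k w v\<close> are \<open>a\<^sub>k\<close> and \<open>b\<^sub>k\<close> on \<open>M(L(v,w))\<close>.\<close>

definition a_hom :: "nat \<Rightarrow> nat \<Rightarrow> dimv \<Rightarrow> dimv \<Rightarrow> qfun \<Rightarrow> qfun" where
  "a_hom n k w v f = (let Y = Y_of n w v in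
     if k = n then
       (if even (w n + length Y) then cscale ((-1) ^ length Y) (kappa_pullback n f) else 0)
     else cscale ((-1) ^ rows_before n k Y)
       (kappa_pullback n (corr_down n (y_dim n k) f + corr_down n (z_dim n k) f)))"

definition b_hom :: "nat \<Rightarrow> nat \<Rightarrow> dimv \<Rightarrow> dimv \<Rightarrow> qfun \<Rightarrow> qfun" where
  "b_hom n k w v f = (let Y = Y_of n w v in
     if k = n then
       (if odd (w n + length Y) then cscale ((-1) ^ length Y) (kappa_pullback n f) else 0)
     else cscale ((-1) ^ rows_before n k Y)
       (kappa_pullback n (corr_up n (y_dim n k) f + corr_up n (z_dim n k) f)))"

definition component :: "dimv \<Rightarrow> dimv \<Rightarrow> qfun \<Rightarrow> qfun" where
  "component w v f = (\<lambda>(w', v', y). if w' = w \<and> v' = v then f (w', v', y) else 0)"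

definition degrees :: "qfun \<Rightarrow> (dimv \<times> dimv) set" where
  "degrees f = {(w, v). \<exists>y. f (w, v, y) \<noteq> 0}"

definition extend_linearly :: "(dimv \<Rightarrow> dimv \<Rightarrow> qfun \<Rightarrow> qfun) \<Rightarrow> qfun \<Rightarrow> qfun" where
  "extend_linearly T f = (\<Sum>(w, v)\<in>degrees f. T w v (component w v f))"

definition a_op :: "nat \<Rightarrow> nat \<Rightarrow> qfun \<Rightarrow> qfun" where
  "a_op n k = (\<lambda>f\<in>carrier (spin_module n). extend_linearly (a_hom n k) f)"

definition b_op :: "nat \<Rightarrow> nat \<Rightarrow> qfun \<Rightarrow> qfun" where
  "b_op n k = (\<lambda>f\<in>carrier (spin_module n). extend_linearly (b_hom n k) f)"

end

theory Submission
  imports Defs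
begin

text \<open>
  Both representations are copies of the Fock space: the functions on the subsets \<open>F\<close> of \<open>{1..n}\<close>,
  on which \<open>b\<^sub>k\<close> inserts \<open>k\<close> into \<open>F\<close> and \<open>a\<^sub>k\<close> removes it, with the sign \<open>(-1)\<^bsup>#{i \<in> F. i < k}\<^esup>\<close>
  (\<open>fock_act\<close>). These operators satisfy the Clifford relations for all \<open>k\<close>
  (\<open>fock_anticommutation\<close>), so the Clifford algebra acts on the Fock space. It remains to match the
  given operators on either side with them; the two representations are then obtained by transport,
  and they are isomorphic because both are isomorphic to the Fock space.

  On the side of the exterior algebra, \<open>F\<close> corresponds to the wedge product of the \<open>b\<^sub>k\<close>, \<open>k \<in> F\<close>, in
  increasing order. These products span because every word can be straightened
  (\<open>wedge_tensor_fock_eval\<close>), and they are independent because the exterior ideal acts by zero on the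
  Fock space while the product belonging to \<open>F\<close> maps the vacuum to the basis vector at \<open>F\<close>. Contraction
  and \<open>a\<^sub>k\<close> agree since both kill the vacuum and commute with the \<open>b\<^sub>l\<close> in the same way.

  On the geometric side, let \<open>\<tau> \<in> {n - 1, n}\<close> be the vertex carrying the one-dimensional framing. The
  functionals \<open>j \<circ> path\<close>, for paths ending at \<open>\<tau>\<close>, map a stable point into an explicit module of
  coordinate sequences, which contains the injective hull of the simple module at \<open>\<tau>\<close>; stability says
  that this map is injective. In that module the round trips along the quiver act as Jordan blocks, so a
  submodule has a member of the standard flag as its component at each vertex: it is determined by
  its dimension vector. Hence \<open>\<L>(v, w)\<close> and the varieties \<open>\<F>(v, w; v'')\<close> are empty or points
  (\<open>L_var_standard\<close>, \<open>F_var_standard\<close>), the projections between them are the evident ones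
  (\<open>pi1_std_flag\<close>, \<open>pi2_std_flag\<close>), and since a point has Euler characteristic 1 every correspondence
  sends an indicator function to an indicator function or to zero.

  The rest is combinatorics. The dimension vectors of submodules are those of the Young diagrams,
  given by the set \<open>E \<subseteq> {1..n - 1}\<close> of the endpoints of their rows (\<open>admissible_iff\<close>). Adding \<open>y\<^sup>k\<close> or
  \<open>z\<^sup>k\<close> inserts \<open>k\<close> into \<open>E\<close>; which of the two applies depends on the parity of the number of rows
  (\<open>ends_dim_delete\<close>, \<open>ends_dim_eq_imp\<close>). The set \<open>F\<close> consists of \<open>E\<close>, together with \<open>n\<close> if this is
  needed to make \<open>card F\<close> even for \<open>\<tau> = n\<close> and odd for \<open>\<tau> = n - 1\<close>. All generators change the parity of
  \<open>F\<close>, which is why \<open>\<kappa>\<close> enters the operators; and \<open>a\<^sub>n\<close>, \<open>b\<^sub>n\<close> change only whether \<open>n \<in> F\<close>, that is,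
  they leave the diagram alone. The sign \<open>(-1)\<^bsup>l\<^sub>k(Y)\<^esup>\<close> counts the endpoints less than \<open>k\<close>, as on the
  Fock space.\<close>

section \<open>The tensor algebra and its action on the Fock space\<close>

\<comment> \<open>Sums of functions stay unexpanded, so that linearity rules apply to them as elements of a vector
  space; pointwise rules are added where needed.\<close>
declare plus_fun_apply [simp del] zero_fun_apply [simp del] cfun.scale_cancel_left [simp del]

lemmas fun_simps = fun_eq_iff plus_fun_apply zero_fun_apply cscale_def

lemma sum_fun_apply: "(\<Sum>i\<in>A. f i) x = (\<Sum>i\<in>A. f i x)"
  by (induction A rule: infinite_finite_induct) (simp_all add: plus_fun_apply zero_fun_apply)

abbreviation tensors :: "'x set \<Rightarrow> ('x list \<Rightarrow> complex) set" where
  "tensors X \<equiv> carrier (tensor_algebra X)"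

lemma tensors_iff: "p \<in> tensors X \<longleftrightarrow> finite {u. p u \<noteq> 0} \<and> {u. p u \<noteq> 0} \<subseteq> lists X"
  by (simp add: tensor_algebra_def)

lemma tensor_algebra_simps [simp]:
  "mult (tensor_algebra X) = tensor_mult" "one (tensor_algebra X) = word []"
  "zero (tensor_algebra X) = 0" "add (tensor_algebra X) = (+)"
  by (simp_all add: tensor_algebra_def)

lemma word_in_tensors: "u \<in> lists X \<Longrightarrow> word u \<in> tensors X"
  by (simp add: tensors_iff word_def)

lemma zero_in_tensors: "0 \<in> tensors X"
  by (simp add: tensors_iff zero_fun_apply)

lemma add_in_tensors:
  assumes "p \<in> tensors X" "q \<in> tensors X"
  shows "p + q \<in> tensors X"
proof -
  have "{u. (p + q) u \<noteq> 0} \<subseteq> {u. p u \<noteq> 0} \<union> {u. q u \<noteq> 0}"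
    by (auto simp: plus_fun_apply)
  then show ?thesis
    using assms unfolding tensors_iff by (meson finite_Un finite_subset le_sup_iff order_trans)
qed

lemma cscale_in_tensors:
  assumes "p \<in> tensors X"
  shows "cscale c p \<in> tensors X"
proof -
  have "{u. cscale c p u \<noteq> 0} \<subseteq> {u. p u \<noteq> 0}"
    by (auto simp: cscale_def)
  then show ?thesis
    using assms unfolding tensors_iff by (meson finite_subset order_trans)
qed

lemma sum_in_tensors: "(\<And>i. i \<in> A \<Longrightarrow> p i \<in> tensors X) \<Longrightarrow> sum p A \<in> tensors X"
  by (induction A rule: infinite_finite_induct) (auto simp: zero_in_tensors add_in_tensors)

lemma sum_words_eq:
  assumes "finite S" "{u. p u \<noteq> 0} \<subseteq> S"
  shows "(\<Sum>u\<in>S. cscale (p u) (word u)) = p"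
proof
  fix w
  have "(\<Sum>u\<in>S. cscale (p u) (word u)) w = (\<Sum>u\<in>S. if u = w then p u else 0)"
    unfolding sum_fun_apply by (rule sum.cong) (auto simp: cscale_def word_def)
  also have "\<dots> = p w"
    using assms by (auto simp: sum.delta)
  finally show "(\<Sum>u\<in>S. cscale (p u) (word u)) w = p w" .
qed

text \<open>Every tensor is a combination of words; this is the induction principle by which multilinear
  identities are reduced to words.\<close>

lemma tensor_induct [consumes 1, case_names zero word add]:
  assumes "p \<in> tensors X"
    and zero: "P 0"
    and word: "\<And>c u. u \<in> lists X \<Longrightarrow> P (cscale c (word u))"
    and add: "\<And>p q. p \<in> tensors X \<Longrightarrow> q \<in> tensors X \<Longrightarrow> P p \<Longrightarrow> P q \<Longrightarrow> P (p + q)"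
  shows "P p"
proof -
  let ?S = "{u. p u \<noteq> 0}"
  have S: "finite ?S" "?S \<subseteq> lists X"
    using assms(1) by (simp_all add: tensors_iff)
  have "P (\<Sum>u\<in>U. cscale (p u) (word u))" if "U \<subseteq> ?S" for U
    using finite_subset[OF that S(1)] that
  proof (induction U rule: finite_induct)
    case empty
    show ?case using zero by simp
  next
    case (insert a U)
    then have "a \<in> lists X" "U \<subseteq> lists X" using S(2) by blast+
    then show ?case
      using insert by (auto intro!: add word cscale_in_tensors word_in_tensors sum_in_tensors)
  qed
  from this[OF order_refl] show ?thesis
    unfolding sum_words_eq[OF S(1) order_refl] .
qed

lemma tensor_mult_word_word: "tensor_mult (word u) (word v) = word (u @ v)"
proof
  fix w
  have "tensor_mult (word u) (word v) w = (\<Sum>i\<le>length w. if i = length u \<and> w = u @ v then 1 else 0)"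
    unfolding tensor_mult_def word_def
  proof (rule sum.cong[OF refl])
    fix i assume i: "i \<in> {..length w}"
    have "take i w = u \<and> drop i w = v \<longleftrightarrow> i = length u \<and> w = u @ v"
      using i by auto
    then show "(if take i w = u then 1 else 0) * (if drop i w = v then 1 else (0::complex)) =
        (if i = length u \<and> w = u @ v then 1 else 0)"
      by auto
  qed
  also have "\<dots> = word (u @ v) w"
    by (cases "w = u @ v") (auto simp: word_def)
  finally show "tensor_mult (word u) (word v) w = word (u @ v) w" .
qed

lemma tensor_mult_add_left: "tensor_mult (p + q) r = tensor_mult p r + tensor_mult q r"
  by (rule ext) (simp add: tensor_mult_def plus_fun_apply algebra_simps sum.distrib)

lemma tensor_mult_add_right: "tensor_mult r (p + q) = tensor_mult r p + tensor_mult r q"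
  by (rule ext) (simp add: tensor_mult_def plus_fun_apply algebra_simps sum.distrib)

lemma tensor_mult_cscale_left: "tensor_mult (cscale c p) q = cscale c (tensor_mult p q)"
  by (rule ext) (simp add: tensor_mult_def cscale_def algebra_simps sum_distrib_left)

lemma tensor_mult_cscale_right: "tensor_mult p (cscale c q) = cscale c (tensor_mult p q)"
  by (rule ext) (simp add: tensor_mult_def cscale_def algebra_simps sum_distrib_left)

lemma tensor_mult_zero [simp]: "tensor_mult 0 p = 0" "tensor_mult p 0 = 0"
  by (simp_all add: tensor_mult_def zero_fun_apply fun_eq_iff)

lemmas tensor_mult_linear = tensor_mult_add_left tensor_mult_add_right
  tensor_mult_cscale_left tensor_mult_cscale_right

lemma tensor_mult_in_tensors:
  assumes "p \<in> tensors X" "q \<in> tensors X"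
  shows "tensor_mult p q \<in> tensors X"
  using assms(1)
proof (induction rule: tensor_induct)
  case (word c u)
  have "tensor_mult (word u) q \<in> tensors X"
    using assms(2)
  proof (induction rule: tensor_induct)
    case (word d v)
    then show ?case
      using \<open>u \<in> lists X\<close> by (simp add: tensor_mult_linear tensor_mult_word_word cscale_in_tensors word_in_tensors)
  qed (simp_all add: tensor_mult_linear zero_in_tensors add_in_tensors)
  then show ?case
    by (simp add: tensor_mult_linear cscale_in_tensors)
qed (simp_all add: tensor_mult_linear zero_in_tensors add_in_tensors)

lemma tensor_mult_assoc:
  assumes "p \<in> tensors X" "q \<in> tensors X" "r \<in> tensors X"
  shows "tensor_mult (tensor_mult p q) r = tensor_mult p (tensor_mult q r)"
  using assms(1)
proof (induction rule: tensor_induct)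
  case (word c u)
  have "tensor_mult (tensor_mult (word u) q) r = tensor_mult (word u) (tensor_mult q r)"
    using assms(2)
  proof (induction rule: tensor_induct)
    case (word d v)
    have "tensor_mult (word (u @ v)) r = tensor_mult (word u) (tensor_mult (word v) r)"
      using assms(3)
      by (induction rule: tensor_induct) (simp_all add: tensor_mult_linear tensor_mult_word_word)
    then show ?case
      by (simp add: tensor_mult_linear tensor_mult_word_word)
  qed (simp_all add: tensor_mult_linear)
  then show ?case
    by (simp add: tensor_mult_linear)
qed (simp_all add: tensor_mult_linear)

lemma tensor_mult_one:
  assumes "p \<in> tensors X"
  shows "tensor_mult (word []) p = p" "tensor_mult p (word []) = p"
  using assms by (induction rule: tensor_induct) (simp_all add: tensor_mult_linear tensor_mult_word_word)

lemma cscale_minus_one: "cscale (-1) p = - p"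
  by (simp add: cscale_def fun_eq_iff)

lemma uminus_in_tensors: "p \<in> tensors X \<Longrightarrow> - p \<in> tensors X"
  using cscale_in_tensors[of p X "-1"] by (simp add: cscale_minus_one)

lemma ring_tensor_algebra: "ring (tensor_algebra X)"
proof (rule ringI)
  show "abelian_group (tensor_algebra X)"
  proof (rule abelian_groupI)
    show "\<exists>q\<in>tensors X. q \<oplus>\<^bsub>tensor_algebra X\<^esub> p = \<zero>\<^bsub>tensor_algebra X\<^esub>" if "p \<in> tensors X" for p
      using that by (intro bexI[of _ "- p"]) (simp_all add: uminus_in_tensors)
  qed (simp_all add: zero_in_tensors add_in_tensors add_ac)
  show "Group.monoid (tensor_algebra X)"
    by (rule monoidI) (simp_all add: tensor_mult_in_tensors word_in_tensors tensor_mult_one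
        tensor_mult_assoc[where X = X])
qed (simp_all add: tensor_mult_linear)

lemma a_minus_tensors:
  assumes "p \<in> tensors X" "q \<in> tensors X"
  shows "p \<ominus>\<^bsub>tensor_algebra X\<^esub> q = p - q"
proof -
  interpret ring "tensor_algebra X" by (rule ring_tensor_algebra)
  have "\<ominus>\<^bsub>tensor_algebra X\<^esub> q = - q"
    using assms uminus_in_tensors[OF assms(2)] by (intro minus_equality) simp_all
  then show ?thesis
    by (simp add: a_minus_def)
qed

text \<open>\<open>f G\<close> is the coefficient of the wedge product of the \<open>b\<^sub>i\<close>, \<open>i \<in> G\<close>, in increasing order, and \<open>fsign\<close>
  is the sign of moving \<open>b\<^sub>k\<close> to its place in such a product. The operators are defined on functions
  of arbitrary sets of natural numbers, where the relations need no bounds on the indices.\<close>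

type_synonym fock = "nat set \<Rightarrow> complex"

definition fsign :: "nat \<Rightarrow> nat set \<Rightarrow> complex" where
  "fsign k G = (-1) ^ card (G \<inter> {..<k})"

fun fock_act :: "clifford_basis \<Rightarrow> fock \<Rightarrow> fock" where
  "fock_act (gen_a k) f = (\<lambda>G. if k \<in> G then 0 else fsign k G * f (insert k G))"
| "fock_act (gen_b k) f = (\<lambda>G. if k \<in> G then fsign k G * f (G - {k}) else 0)"

lemma fock_act_linear:
  "fock_act t (f + g) = fock_act t f + fock_act t g"
  "fock_act t (cscale c f) = cscale c (fock_act t f)"
  "fock_act t 0 = 0"
  by (cases t; simp add: fun_eq_iff plus_fun_apply zero_fun_apply cscale_def distrib_left)+

lemma fsign_insert:
  assumes "l \<notin> G"
  shows "fsign k (insert l G) = (if l < k then - fsign k G else fsign k G)"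
proof (cases "l < k")
  case True
  have "insert l G \<inter> {..<k} = insert l (G \<inter> {..<k})"
    using True by auto
  then show ?thesis
    using assms True by (simp add: fsign_def)
next
  case False
  then have "insert l G \<inter> {..<k} = G \<inter> {..<k}"
    by auto
  then show ?thesis
    using False by (simp add: fsign_def)
qed

lemma fsign_delete:
  assumes "l \<in> G"
  shows "fsign k (G - {l}) = (if l < k then - fsign k G else fsign k G)"
proof -
  have "insert l (G - {l}) = G"
    using assms by blast
  then show ?thesis
    using fsign_insert[of l "G - {l}" k] by (cases "l < k") simp_all
qed

lemma fsign_square [simp]: "fsign k G * fsign k G = 1" "fsign k G * (fsign k G * c) = c"
proof -
  show *: "fsign k G * fsign k G = 1"
    unfolding fsign_def by (metis minus_one_mult_self)
  show "fsign k G * (fsign k G * c) = c"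
    using * by (metis mult.assoc mult_1)
qed

text \<open>For \<open>k \<noteq> l\<close> the two orders of changing \<open>G\<close> at \<open>k\<close> and \<open>l\<close> give opposite signs, because the
  larger of the two indices sees the change at the smaller one. For \<open>k = l\<close> the squares vanish and
  exactly one of \<open>a\<^sub>k b\<^sub>k\<close>, \<open>b\<^sub>k a\<^sub>k\<close> is nonzero at \<open>G\<close>, and there it is the identity.\<close>

lemma fock_anticommutation:
  "fock_act s (fock_act t f) + fock_act t (fock_act s f) = cscale (Q_basis s t) f"
proof
  fix G :: "nat set"
  show "(fock_act s (fock_act t f) + fock_act t (fock_act s f)) G = cscale (Q_basis s t) f G"
  proof (cases s; cases t)
    fix k l assume "s = gen_a k" "t = gen_a l"
    then show ?thesis
      by (cases k l rule: linorder_cases) (simp_all add: fun_simps fsign_insert insert_commute)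
  next
    fix k l assume "s = gen_b k" "t = gen_b l"
    moreover have "G - {k} - {l} = G - {l} - {k}"
      by auto
    ultimately show ?thesis
      by (cases k l rule: linorder_cases) (simp_all add: fun_simps fsign_delete)
  next
    fix k l assume "s = gen_a k" "t = gen_b l"
    then show ?thesis
      by (cases k l rule: linorder_cases)
        (simp_all add: fun_simps fsign_delete fsign_insert insert_absorb insert_Diff_if)
  next
    fix k l assume "s = gen_b k" "t = gen_a l"
    then show ?thesis
      by (cases k l rule: linorder_cases)
        (simp_all add: fun_simps fsign_delete fsign_insert insert_absorb insert_Diff_if)
  qed
qed

text \<open>The homomorphism from the tensor algebra that extends \<open>fock_act\<close>.\<close>

definition fock_eval :: "(clifford_basis list \<Rightarrow> complex) \<Rightarrow> fock \<Rightarrow> fock" where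
  "fock_eval p f = (\<Sum>u | p u \<noteq> 0. cscale (p u) (foldr fock_act u f))"

lemma fock_eval_eq_sum:
  assumes "finite S" "{u. p u \<noteq> 0} \<subseteq> S"
  shows "fock_eval p f = (\<Sum>u\<in>S. cscale (p u) (foldr fock_act u f))"
  unfolding fock_eval_def by (rule sum.mono_neutral_left) (use assms in auto)

lemma fock_eval_cscale_word: "fock_eval (cscale c (word u)) f = cscale c (foldr fock_act u f)"
  by (subst fock_eval_eq_sum[where S = "{u}"]) (auto simp: cscale_def word_def)

lemma fock_eval_word: "fock_eval (word u) f = foldr fock_act u f"
  using fock_eval_cscale_word[of 1 u f] by simp

lemma fock_eval_zero [simp]: "fock_eval 0 f = 0"
  by (simp add: fock_eval_def zero_fun_apply)

lemma fock_eval_add: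
  assumes "p \<in> tensors X" "q \<in> tensors X"
  shows "fock_eval (p + q) f = fock_eval p f + fock_eval q f"
proof -
  let ?S = "{u. p u \<noteq> 0} \<union> {u. q u \<noteq> 0}"
  have S: "finite ?S" using assms by (simp add: tensors_iff)
  have "fock_eval r f = (\<Sum>u\<in>?S. cscale (r u) (foldr fock_act u f))" if "{u. r u \<noteq> 0} \<subseteq> ?S" for r
    by (rule fock_eval_eq_sum) (use S that in auto)
  moreover have "{u. (p + q) u \<noteq> 0} \<subseteq> ?S"
    by (auto simp: plus_fun_apply)
  ultimately show ?thesis
    by (simp add: plus_fun_apply cfun.scale_left_distrib sum.distrib)
qed

lemma fock_eval_cscale: "fock_eval (cscale c p) f = cscale c (fock_eval p f)"
proof (cases "c = 0")
  case False
  have supp: "cscale c p u \<noteq> 0 \<longleftrightarrow> p u \<noteq> 0" for u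
    using False by (simp add: cscale_def)
  have "cscale (cscale c p u) g = cscale c (cscale (p u) g)" for u and g :: fock
    by (simp add: cscale_def mult.assoc)
  then show ?thesis
    unfolding fock_eval_def supp by (simp only: cfun.scale_sum_right)
qed simp

lemma fock_eval_diff:
  assumes "p \<in> tensors X" "q \<in> tensors X"
  shows "fock_eval (p - q) f = fock_eval p f - fock_eval q f"
  using fock_eval_add[OF assms(1) uminus_in_tensors[OF assms(2)], of f]
    fock_eval_cscale[of "-1" q f] by (simp add: cscale_minus_one)

lemma foldr_fock_act_linear:
  "foldr fock_act u (f + g) = foldr fock_act u f + foldr fock_act u g"
  "foldr fock_act u (cscale c f) = cscale c (foldr fock_act u f)"
  "foldr fock_act u 0 = 0"
  by (induction u) (simp_all add: fock_act_linear)

lemma fock_eval_linear: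
  "fock_eval p (f + g) = fock_eval p f + fock_eval p g"
  "fock_eval p (cscale c f) = cscale c (fock_eval p f)"
  "fock_eval p 0 = 0"
proof -
  show "fock_eval p (f + g) = fock_eval p f + fock_eval p g" "fock_eval p 0 = 0"
    by (simp_all add: fock_eval_def foldr_fock_act_linear cfun.scale_right_distrib sum.distrib)
  show "fock_eval p (cscale c f) = cscale c (fock_eval p f)"
    unfolding fock_eval_def foldr_fock_act_linear cfun.scale_sum_right
    by (rule sum.cong[OF refl]) (rule cfun.scale_left_commute)
qed

lemma fock_eval_mult:
  assumes "p \<in> tensors X" "q \<in> tensors X"
  shows "fock_eval (tensor_mult p q) f = fock_eval p (fock_eval q f)"
  using assms(1)
proof (induction rule: tensor_induct)
  case (word c u)
  have "fock_eval (tensor_mult (word u) q) f = fock_eval (word u) (fock_eval q f)"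
    using assms(2)
  proof (induction rule: tensor_induct)
    case (word d v)
    show ?case
      by (simp add: tensor_mult_linear tensor_mult_word_word fock_eval_cscale fock_eval_word
          foldr_fock_act_linear)
  next
    case (add p q)
    have "tensor_mult (word u) p \<in> tensors X" "tensor_mult (word u) q \<in> tensors X"
      using add word by (simp_all add: tensor_mult_in_tensors word_in_tensors)
    then show ?case
      using add by (simp add: tensor_mult_linear fock_eval_add[where X=X] fock_eval_linear)
  qed (simp add: fock_eval_linear)
  then show ?case
    by (simp add: tensor_mult_linear fock_eval_cscale)
next
  case (add p q)
  then show ?case
    using assms(2) by (simp add: tensor_mult_linear fock_eval_add[where X=X] tensor_mult_in_tensors)
qed simp

definition fock_module :: "nat \<Rightarrow> (complex, fock) module" where
  "fock_module n = \<lparr>carrier = {f. \<forall>G. f G \<noteq> 0 \<longrightarrow> G \<subseteq> {1..n}},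
     mult = undefined, one = undefined, zero = 0, add = (+), smult = cscale\<rparr>"

lemma fock_module_simps [simp]:
  "zero (fock_module n) = 0" "add (fock_module n) = (+)" "smult (fock_module n) = cscale"
  by (simp_all add: fock_module_def)

lemma fock_carrier_iff: "f \<in> carrier (fock_module n) \<longleftrightarrow> (\<forall>G. f G \<noteq> 0 \<longrightarrow> G \<subseteq> {1..n})"
  by (simp add: fock_module_def)

lemma complex_field_simps [simp]:
  "carrier complex_field = UNIV" "add complex_field = (+)" "mult complex_field = (*)"
  "one complex_field = 1" "zero complex_field = 0"
  by (simp_all add: ring_of_type_algebra_def)

lemma fock_carrier_closed:
  "0 \<in> carrier (fock_module n)"
  "f \<in> carrier (fock_module n) \<Longrightarrow> g \<in> carrier (fock_module n) \<Longrightarrow> f + g \<in> carrier (fock_module n)"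
  "f \<in> carrier (fock_module n) \<Longrightarrow> cscale c f \<in> carrier (fock_module n)"
proof -
  show "f + g \<in> carrier (fock_module n)" if "f \<in> carrier (fock_module n)" "g \<in> carrier (fock_module n)"
    unfolding fock_carrier_iff
  proof (intro allI impI)
    fix G assume "(f + g) G \<noteq> 0"
    then have "f G \<noteq> 0 \<or> g G \<noteq> 0" by (auto simp: plus_fun_apply)
    then show "G \<subseteq> {1..n}" using that unfolding fock_carrier_iff by blast
  qed
qed (auto simp: fock_carrier_iff zero_fun_apply cscale_def)

lemma module_fock: "Module.module complex_field (fock_module n)"
proof (rule moduleI)
  show "cring complex_field" by (rule cring_from_type_algebra)
  show "abelian_group (fock_module n)"
  proof (rule abelian_groupI)
    fix f assume "f \<in> carrier (fock_module n)"
    then show "\<exists>g\<in>carrier (fock_module n). g \<oplus>\<^bsub>fock_module n\<^esub> f = \<zero>\<^bsub>fock_module n\<^esub>"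
      using fock_carrier_closed(3)[of f n "-1"] by (intro bexI[of _ "- f"]) (simp_all add: cscale_minus_one)
  qed (simp_all add: fock_carrier_closed add_ac)
qed (simp_all add: fock_carrier_closed cfun.scale_left_distrib cfun.scale_right_distrib)

lemma fock_act_carrier:
  assumes "t \<in> basis_W n" "f \<in> carrier (fock_module n)"
  shows "fock_act t f \<in> carrier (fock_module n)"
proof (cases t)
  case (gen_a k)
  show ?thesis
    using assms(2) unfolding fock_carrier_iff gen_a by auto
next
  case (gen_b k)
  then have k: "k \<in> {1..n}" using assms(1) by (auto simp: basis_W_def)
  show ?thesis
    unfolding fock_carrier_iff gen_b
  proof (intro allI impI)
    fix G assume "fock_act (gen_b k) f G \<noteq> 0"
    then have "k \<in> G" "f (G - {k}) \<noteq> 0" by (auto split: if_splits)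
    then have "G - {k} \<subseteq> {1..n}" using assms(2) by (simp add: fock_carrier_iff)
    then show "G \<subseteq> {1..n}" using k by blast
  qed
qed

lemma foldr_fock_act_carrier:
  assumes "u \<in> lists (basis_W n)" "f \<in> carrier (fock_module n)"
  shows "foldr fock_act u f \<in> carrier (fock_module n)"
  using assms by (induction u) (simp_all add: fock_act_carrier)

lemma fock_eval_carrier:
  assumes "p \<in> tensors (basis_W n)" "f \<in> carrier (fock_module n)"
  shows "fock_eval p f \<in> carrier (fock_module n)"
  using assms(1)
proof (induction rule: tensor_induct)
  case (word c u)
  then show ?case
    using assms(2) by (simp add: fock_eval_cscale_word fock_carrier_closed foldr_fock_act_carrier)
qed (simp_all add: fock_carrier_closed fock_eval_add)

lemma degree_one_eq:
  assumes "finite X" "v \<in> degree_one X"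
  shows "v = (\<Sum>t\<in>X. cscale (v [t]) (word [t]))"
proof -
  let ?D = "{v. v = (\<Sum>t\<in>X. cscale (v [t]) (word [t]))}"
  have "cfun.subspace ?D"
    unfolding cfun.subspace_def
  proof (intro conjI ballI allI)
    show "0 \<in> ?D"
      by (simp add: zero_fun_apply)
  next
    fix v w assume v: "v \<in> ?D" and w: "w \<in> ?D"
    have "v + w = (\<Sum>t\<in>X. cscale (v [t]) (word [t])) + (\<Sum>t\<in>X. cscale (w [t]) (word [t]))"
      by (rule arg_cong2[OF CollectD[OF v] CollectD[OF w]])
    also have "\<dots> = (\<Sum>t\<in>X. cscale ((v + w) [t]) (word [t]))"
      by (simp add: plus_fun_apply cfun.scale_left_distrib sum.distrib)
    finally show "v + w \<in> ?D" by blast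
  next
    fix c v assume v: "v \<in> ?D"
    have "cscale c v = cscale c (\<Sum>t\<in>X. cscale (v [t]) (word [t]))"
      by (rule arg_cong[OF CollectD[OF v]])
    also have "\<dots> = (\<Sum>t\<in>X. cscale (cscale c v [t]) (word [t]))"
      by (simp add: cfun.scale_sum_right) (simp add: cscale_def)
    finally show "cscale c v \<in> ?D" by blast
  qed
  moreover have "(\<lambda>t. word [t]) ` X \<subseteq> ?D"
  proof
    fix v assume "v \<in> (\<lambda>t. word [t]) ` X"
    then obtain s where s: "s \<in> X" "v = word [s]" by blast
    have "(\<Sum>t\<in>X. cscale (word [s] [t]) (word [t])) = (\<Sum>t\<in>X. if t = s then word [s] else 0)"
      by (rule sum.cong) (auto simp: word_def[of "[s]"])
    then show "v \<in> ?D"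
      using s assms(1) by simp
  qed
  ultimately have "degree_one X \<subseteq> ?D"
    unfolding degree_one_def by (rule cfun.span_minimal[rotated])
  then show ?thesis using assms(2) by blast
qed

lemma degree_one_in_tensors:
  assumes "finite X" "v \<in> degree_one X"
  shows "v \<in> tensors X"
  by (subst degree_one_eq[OF assms]) (auto intro!: sum_in_tensors cscale_in_tensors word_in_tensors)

lemma fock_eval_sum:
  assumes "\<And>i. i \<in> A \<Longrightarrow> p i \<in> tensors X"
  shows "fock_eval (sum p A) f = (\<Sum>i\<in>A. fock_eval (p i) f)"
  using assms
  by (induction A rule: infinite_finite_induct) (simp_all add: fock_eval_add[where X = X] sum_in_tensors)

lemma fock_eval_degree_one:
  assumes "finite X" "v \<in> degree_one X"
  shows "fock_eval v f = (\<Sum>t\<in>X. cscale (v [t]) (fock_act t f))"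
proof -
  have "fock_eval v f = fock_eval (\<Sum>t\<in>X. cscale (v [t]) (word [t])) f"
    using degree_one_eq[OF assms] by simp
  also have "\<dots> = (\<Sum>t\<in>X. fock_eval (cscale (v [t]) (word [t])) f)"
    by (rule fock_eval_sum[where X = X]) (simp add: cscale_in_tensors word_in_tensors)
  finally show ?thesis
    by (simp add: fock_eval_cscale_word)
qed

lemma fock_act_sum: "fock_act t (sum g A) = (\<Sum>i\<in>A. fock_act t (g i))"
  by (induction A rule: infinite_finite_induct) (simp_all add: fock_act_linear)

text \<open>The Clifford ideal is generated by relations between arbitrary vectors of degree one; they
  follow from those between basis vectors because both sides are bilinear.\<close>

lemma fock_eval_anticommutator:
  assumes "finite X" "v \<in> degree_one X" "w \<in> degree_one X"
  shows "fock_eval v (fock_eval w f) + fock_eval w (fock_eval v f) =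
    cscale (\<Sum>s\<in>X. \<Sum>t\<in>X. v [s] * w [t] * Q_basis s t) f"
proof -
  have vw: "fock_eval v (fock_eval w f) =
      (\<Sum>s\<in>X. \<Sum>t\<in>X. cscale (v [s] * w [t]) (fock_act s (fock_act t f)))"
    by (simp add: fock_eval_degree_one[OF assms(1,2)] fock_eval_degree_one[OF assms(1,3)]
      fock_act_sum fock_act_linear cfun.scale_sum_right)
  have "fock_eval w (fock_eval v f) =
      (\<Sum>t\<in>X. \<Sum>s\<in>X. cscale (v [s] * w [t]) (fock_act t (fock_act s f)))"
    by (simp add: fock_eval_degree_one[OF assms(1,2)] fock_eval_degree_one[OF assms(1,3)]
      fock_act_sum fock_act_linear cfun.scale_sum_right mult.commute)
  also have "\<dots> = (\<Sum>s\<in>X. \<Sum>t\<in>X. cscale (v [s] * w [t]) (fock_act t (fock_act s f)))"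
    by (rule sum.swap)
  finally have "fock_eval v (fock_eval w f) + fock_eval w (fock_eval v f) =
      (\<Sum>s\<in>X. \<Sum>t\<in>X. cscale (v [s] * w [t]) (fock_act s (fock_act t f) + fock_act t (fock_act s f)))"
    by (simp add: vw sum.distrib cfun.scale_right_distrib)
  also have "\<dots> = (\<Sum>s\<in>X. \<Sum>t\<in>X. cscale (v [s] * w [t] * Q_basis s t) f)"
    by (simp add: fock_anticommutation)
  also have "\<dots> = cscale (\<Sum>s\<in>X. \<Sum>t\<in>X. v [s] * w [t] * Q_basis s t) f"
    by (simp add: cfun.scale_sum_left)
  finally show ?thesis .
qed

section \<open>The representation of the Clifford algebra on the Fock space\<close>

text \<open>The tensors acting by zero form an ideal, so it is enough to test generators.\<close>

lemma fock_eval_genideal: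
  assumes "S \<subseteq> tensors X" "\<And>p f. p \<in> S \<Longrightarrow> fock_eval p f = 0"
    and "p \<in> Idl\<^bsub>tensor_algebra X\<^esub> S"
  shows "fock_eval p f = 0"
proof -
  interpret ring "tensor_algebra X" by (rule ring_tensor_algebra)
  let ?K = "{p \<in> tensors X. \<forall>f. fock_eval p f = 0}"
  have "ideal ?K (tensor_algebra X)"
  proof (rule idealI)
    show "ring (tensor_algebra X)" by (rule ring_tensor_algebra)
    show "subgroup ?K (add_monoid (tensor_algebra X))"
    proof (rule add.subgroupI)
      show "?K \<noteq> {}" using zero_in_tensors by fastforce
    next
      fix p assume p: "p \<in> ?K"
      have "\<ominus>\<^bsub>tensor_algebra X\<^esub> p = - p"
        by (rule minus_equality) (use p uminus_in_tensors in auto)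
      moreover have "fock_eval (- p) f = 0" for f
        using p fock_eval_cscale[of "-1" p f] by (simp add: cscale_minus_one)
      ultimately show "\<ominus>\<^bsub>tensor_algebra X\<^esub> p \<in> ?K"
        using p by (simp add: uminus_in_tensors)
    next
      fix p q assume "p \<in> ?K" "q \<in> ?K"
      then show "p \<oplus>\<^bsub>tensor_algebra X\<^esub> q \<in> ?K"
        by (simp add: add_in_tensors fock_eval_add[of p X])
    qed blast
  next
    fix p q assume pq: "p \<in> ?K" "q \<in> tensors X"
    then show "q \<otimes>\<^bsub>tensor_algebra X\<^esub> p \<in> ?K"
      by (simp add: tensor_mult_in_tensors fock_eval_mult[of q X] fock_eval_linear)
    show "p \<otimes>\<^bsub>tensor_algebra X\<^esub> q \<in> ?K"
      using pq by (simp add: tensor_mult_in_tensors fock_eval_mult[of p X])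
  qed
  then have "Idl\<^bsub>tensor_algebra X\<^esub> S \<subseteq> ?K"
    by (rule genideal_minimal) (use assms in auto)
  then show ?thesis using assms(3) by blast
qed

lemma tensor_coset_elem:
  "q \<in> I +>\<^bsub>tensor_algebra X\<^esub> p \<longleftrightarrow> (\<exists>i\<in>I. q = i + p)"
  by (auto simp: a_r_coset_def')

lemma finite_basis: "finite (basis_W n)" "finite (basis_W' n)"
  by (simp_all add: basis_W_def basis_W'_def)

lemma clifford_relations_in_tensors:
  "{tensor_mult v w + tensor_mult w v - cscale (Q_form n v w) (word []) | v w.
      v \<in> degree_one (basis_W n) \<and> w \<in> degree_one (basis_W n)} \<subseteq> tensors (basis_W n)"
proof -
  have "tensor_mult v w + tensor_mult w v - cscale c (word []) \<in> tensors (basis_W n)"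
    if "v \<in> degree_one (basis_W n)" "w \<in> degree_one (basis_W n)" for v w c
  proof -
    have "tensor_mult v w + tensor_mult w v + cscale (- c) (word []) \<in> tensors (basis_W n)"
      using that[THEN degree_one_in_tensors[OF finite_basis(1)]]
      by (intro add_in_tensors tensor_mult_in_tensors cscale_in_tensors word_in_tensors) simp_all
    then show ?thesis by simp
  qed
  then show ?thesis by blast
qed

lemma ideal_clifford: "ideal (clifford_ideal n) (tensor_algebra (basis_W n))"
  unfolding clifford_ideal_def
  by (rule ring.genideal_ideal[OF ring_tensor_algebra clifford_relations_in_tensors])

lemma fock_eval_clifford_ideal:
  assumes "p \<in> clifford_ideal n"
  shows "fock_eval p f = 0"
  using clifford_relations_in_tensors _ assms[unfolded clifford_ideal_def]
proof (rule fock_eval_genideal)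
  fix p f
  assume "p \<in> {tensor_mult v w + tensor_mult w v - cscale (Q_form n v w) (word []) | v w.
      v \<in> degree_one (basis_W n) \<and> w \<in> degree_one (basis_W n)}"
  then obtain v w where p: "p = tensor_mult v w + tensor_mult w v - cscale (Q_form n v w) (word [])"
    and vw: "v \<in> degree_one (basis_W n)" "w \<in> degree_one (basis_W n)"
    by blast
  note t = vw[THEN degree_one_in_tensors[OF finite_basis(1)]]
  have "fock_eval p f = fock_eval v (fock_eval w f) + fock_eval w (fock_eval v f) - cscale (Q_form n v w) f"
    unfolding p using t
    by (simp add: fock_eval_diff[where X = "basis_W n"] fock_eval_add[where X = "basis_W n"]
        fock_eval_mult[where X = "basis_W n"] tensor_mult_in_tensors add_in_tensors cscale_in_tensors
        word_in_tensors fock_eval_cscale fock_eval_word)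
  also have "\<dots> = 0"
    by (simp add: fock_eval_anticommutator[OF finite_basis(1) vw] Q_form_def)
  finally show "fock_eval p f = 0" .
qed

text \<open>A coset acts through any of its representatives, as the ideal acts by zero.\<close>

definition clifford_fock :: "nat \<Rightarrow> (clifford_basis list \<Rightarrow> complex) set \<Rightarrow> fock \<Rightarrow> fock" where
  "clifford_fock n c = (\<lambda>f\<in>carrier (fock_module n). fock_eval (SOME p. p \<in> c) f)"

lemma clifford_fock_coset:
  assumes "p \<in> tensors (basis_W n)"
  shows "clifford_fock n (clifford_ideal n +>\<^bsub>tensor_algebra (basis_W n)\<^esub> p) =
    (\<lambda>f\<in>carrier (fock_module n). fock_eval p f)"
proof -
  interpret I: ideal "clifford_ideal n" "tensor_algebra (basis_W n)" by (rule ideal_clifford)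
  let ?c = "clifford_ideal n +>\<^bsub>tensor_algebra (basis_W n)\<^esub> p"
  have "p \<in> ?c"
    using assms by (rule I.a_rcos_self)
  then have "(SOME p. p \<in> ?c) \<in> ?c"
    by (rule someI[of "\<lambda>q. q \<in> ?c"])
  then obtain i where i: "i \<in> clifford_ideal n" "(SOME p. p \<in> ?c) = i + p"
    unfolding tensor_coset_elem by blast
  have "fock_eval (SOME p. p \<in> ?c) f = fock_eval p f" for f
    unfolding i(2) using fock_eval_add[OF I.a_Hcarr[OF i(1)] assms] fock_eval_clifford_ideal[OF i(1)]
    by simp
  then show ?thesis
    by (simp add: clifford_fock_def)
qed

lemma carrier_clifford:
  "c \<in> carrier (clifford n) \<longleftrightarrow>
    (\<exists>p\<in>tensors (basis_W n). c = clifford_ideal n +>\<^bsub>tensor_algebra (basis_W n)\<^esub> p)"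
  by (auto simp: clifford_def FactRing_def A_RCOSETS_def')

lemma algebra_rep_clifford_fock:
  "algebra_rep (clifford n) (clifford_scalar n) (fock_module n) (clifford_fock n)"
proof -
  let ?T = "tensor_algebra (basis_W n)" and ?V = "fock_module n"
  interpret I: ideal "clifford_ideal n" ?T by (rule ideal_clifford)
  have "clifford_fock n \<in> ring_hom (clifford n) (End_ring ?V)"
  proof (rule ring_hom_memI)
    fix c assume "c \<in> carrier (clifford n)"
    then obtain p where p: "p \<in> tensors (basis_W n)" "c = clifford_ideal n +>\<^bsub>?T\<^esub> p"
      unfolding carrier_clifford by blast
    then show "clifford_fock n c \<in> carrier (End_ring ?V)"
      by (auto simp: End_ring_def linear_maps_def clifford_fock_coset fock_eval_linear
        fock_eval_carrier fock_carrier_closed)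
  next
    fix c d assume "c \<in> carrier (clifford n)" "d \<in> carrier (clifford n)"
    then obtain p q where p: "p \<in> tensors (basis_W n)" "c = clifford_ideal n +>\<^bsub>?T\<^esub> p"
      and q: "q \<in> tensors (basis_W n)" "d = clifford_ideal n +>\<^bsub>?T\<^esub> q"
      unfolding carrier_clifford by blast
    have "c \<otimes>\<^bsub>clifford n\<^esub> d = clifford_ideal n +>\<^bsub>?T\<^esub> tensor_mult p q"
      using p q by (simp add: clifford_def FactRing_def I.rcoset_mult_add)
    then show "clifford_fock n (c \<otimes>\<^bsub>clifford n\<^esub> d) =
        clifford_fock n c \<otimes>\<^bsub>End_ring ?V\<^esub> clifford_fock n d"
      using p q by (auto simp: clifford_fock_coset tensor_mult_in_tensors End_ring_def compose_def
        fock_eval_mult[where X = "basis_W n"] fock_eval_carrier restrict_def fun_eq_iff)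
    have "c \<oplus>\<^bsub>clifford n\<^esub> d = clifford_ideal n +>\<^bsub>?T\<^esub> (p + q)"
      using p q I.a_rcos_sum[of p q] by (simp add: clifford_def FactRing_def)
    then show "clifford_fock n (c \<oplus>\<^bsub>clifford n\<^esub> d) =
        clifford_fock n c \<oplus>\<^bsub>End_ring ?V\<^esub> clifford_fock n d"
      using p q by (auto simp: clifford_fock_coset add_in_tensors End_ring_def
        fock_eval_add[where X = "basis_W n"] restrict_def fun_eq_iff)
  next
    show "clifford_fock n \<one>\<^bsub>clifford n\<^esub> = \<one>\<^bsub>End_ring ?V\<^esub>"
      by (simp add: clifford_def FactRing_def End_ring_def clifford_fock_coset word_in_tensors
        fock_eval_word)
  qed
  moreover have "clifford_fock n (clifford_scalar n c) = (\<lambda>f\<in>carrier ?V. c \<odot>\<^bsub>?V\<^esub> f)" for c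
    unfolding clifford_scalar_def
    by (simp add: clifford_fock_coset word_in_tensors cscale_in_tensors fock_eval_cscale_word)
  ultimately show ?thesis
    by (simp add: algebra_rep_def module_fock)
qed

lemma clifford_fock_gen:
  assumes "t \<in> basis_W n"
  shows "clifford_fock n (clifford_gen n t) = (\<lambda>f\<in>carrier (fock_module n). fock_act t f)"
  unfolding clifford_gen_def using assms
  by (simp add: clifford_fock_coset word_in_tensors fock_eval_word)

section \<open>Transport of representations\<close>

text \<open>Preservation of zero is part of the definition because \<open>V'\<close> is not assumed to be a module;
  that it is one is a consequence.\<close>

definition linear_iso :: "(complex, 'u) module \<Rightarrow> (complex, 'v) module \<Rightarrow> ('u \<Rightarrow> 'v) \<Rightarrow> bool" where
  "linear_iso V V' \<Phi> \<longleftrightarrow> bij_betw \<Phi> (carrier V) (carrier V') \<and> \<Phi> \<zero>\<^bsub>V\<^esub> = \<zero>\<^bsub>V'\<^esub> \<and>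
     (\<forall>u\<in>carrier V. \<forall>u'\<in>carrier V. \<Phi> (u \<oplus>\<^bsub>V\<^esub> u') = \<Phi> u \<oplus>\<^bsub>V'\<^esub> \<Phi> u') \<and>
     (\<forall>c. \<forall>u\<in>carrier V. \<Phi> (c \<odot>\<^bsub>V\<^esub> u) = c \<odot>\<^bsub>V'\<^esub> \<Phi> u)"

definition transport :: "(complex, 'u) module \<Rightarrow> (complex, 'v) module \<Rightarrow> ('u \<Rightarrow> 'v) \<Rightarrow>
    ('c \<Rightarrow> 'u \<Rightarrow> 'u) \<Rightarrow> 'c \<Rightarrow> 'v \<Rightarrow> 'v" where
  "transport V V' \<Phi> \<rho> c = (\<lambda>v\<in>carrier V'. \<Phi> (\<rho> c (inv_into (carrier V) \<Phi> v)))"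

lemma linear_iso_simps:
  assumes "linear_iso V V' \<Phi>" "u \<in> carrier V"
  shows "\<Phi> u \<in> carrier V'" "inv_into (carrier V) \<Phi> (\<Phi> u) = u"
  using assms by (auto simp: linear_iso_def bij_betw_def)

lemma linear_iso_surj:
  assumes "linear_iso V V' \<Phi>" "v \<in> carrier V'"
  obtains u where "u \<in> carrier V" "v = \<Phi> u"
proof -
  have "v \<in> \<Phi> ` carrier V"
    using assms by (simp add: linear_iso_def bij_betw_def)
  then show ?thesis using that by blast
qed

lemma linear_iso_hom:
  assumes "linear_iso V V' \<Phi>"
  shows "\<zero>\<^bsub>V'\<^esub> = \<Phi> \<zero>\<^bsub>V\<^esub>"
    "u \<in> carrier V \<Longrightarrow> u' \<in> carrier V \<Longrightarrow> \<Phi> u \<oplus>\<^bsub>V'\<^esub> \<Phi> u' = \<Phi> (u \<oplus>\<^bsub>V\<^esub> u')"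
    "u \<in> carrier V \<Longrightarrow> c \<odot>\<^bsub>V'\<^esub> \<Phi> u = \<Phi> (c \<odot>\<^bsub>V\<^esub> u)"
  using assms by (simp_all add: linear_iso_def)

lemma module_transport:
  assumes "Module.module complex_field V" "linear_iso V V' \<Phi>"
  shows "Module.module complex_field V'"
proof -
  interpret V: Module.module complex_field V by fact
  note hom = linear_iso_hom[OF assms(2)] and surj = linear_iso_surj[OF assms(2)]
    and simps = linear_iso_simps[OF assms(2)]
  show ?thesis
  proof (rule moduleI)
    show "cring complex_field" by (rule cring_from_type_algebra)
    show "abelian_group V'"
    proof (rule abelian_groupI)
      fix x y z assume "x \<in> carrier V'" "y \<in> carrier V'" "z \<in> carrier V'"
      then show "(x \<oplus>\<^bsub>V'\<^esub> y) \<oplus>\<^bsub>V'\<^esub> z = x \<oplus>\<^bsub>V'\<^esub> (y \<oplus>\<^bsub>V'\<^esub> z)"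
        by (elim surj) (simp add: hom V.a_assoc)
    next
      fix x y assume "x \<in> carrier V'" "y \<in> carrier V'"
      then show "x \<oplus>\<^bsub>V'\<^esub> y \<in> carrier V'"
        by (elim surj) (simp add: hom simps)
    next
      fix x y assume "x \<in> carrier V'" "y \<in> carrier V'"
      then show "x \<oplus>\<^bsub>V'\<^esub> y = y \<oplus>\<^bsub>V'\<^esub> x"
        by (elim surj) (simp add: hom V.a_comm)
    next
      show "\<zero>\<^bsub>V'\<^esub> \<in> carrier V'" by (simp add: hom simps)
    next
      fix x assume "x \<in> carrier V'"
      then show "\<zero>\<^bsub>V'\<^esub> \<oplus>\<^bsub>V'\<^esub> x = x"
        by (elim surj) (simp add: hom)
    next
      fix x assume "x \<in> carrier V'"
      then obtain u where u: "u \<in> carrier V" "x = \<Phi> u" by (rule surj)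
      then show "\<exists>y\<in>carrier V'. y \<oplus>\<^bsub>V'\<^esub> x = \<zero>\<^bsub>V'\<^esub>"
        by (intro bexI[of _ "\<Phi> (\<ominus>\<^bsub>V\<^esub> u)"]) (simp_all add: hom simps V.l_neg)
    qed
  next
    fix a x assume "x \<in> carrier V'"
    then show "a \<odot>\<^bsub>V'\<^esub> x \<in> carrier V'"
      by (elim surj) (simp add: hom simps)
  next
    fix a b x assume "x \<in> carrier V'"
    then show "(a \<oplus>\<^bsub>complex_field\<^esub> b) \<odot>\<^bsub>V'\<^esub> x = a \<odot>\<^bsub>V'\<^esub> x \<oplus>\<^bsub>V'\<^esub> b \<odot>\<^bsub>V'\<^esub> x"
      using V.smult_l_distr by (elim surj) (simp add: hom)
  next
    fix a x y assume "x \<in> carrier V'" "y \<in> carrier V'"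
    then show "a \<odot>\<^bsub>V'\<^esub> (x \<oplus>\<^bsub>V'\<^esub> y) = a \<odot>\<^bsub>V'\<^esub> x \<oplus>\<^bsub>V'\<^esub> a \<odot>\<^bsub>V'\<^esub> y"
      using V.smult_r_distr by (elim surj) (simp add: hom)
  next
    fix a b x assume "x \<in> carrier V'"
    then show "(a \<otimes>\<^bsub>complex_field\<^esub> b) \<odot>\<^bsub>V'\<^esub> x = a \<odot>\<^bsub>V'\<^esub> (b \<odot>\<^bsub>V'\<^esub> x)"
      using V.smult_assoc1 by (elim surj) (simp add: hom)
  next
    fix x assume "x \<in> carrier V'"
    then show "\<one>\<^bsub>complex_field\<^esub> \<odot>\<^bsub>V'\<^esub> x = x"
      using V.smult_one by (elim surj) (simp add: hom)
  qed
qed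

lemma transport_apply:
  assumes "linear_iso V V' \<Phi>" "u \<in> carrier V"
  shows "transport V V' \<Phi> \<rho> c (\<Phi> u) = \<Phi> (\<rho> c u)"
  using assms by (simp add: transport_def linear_iso_simps)

lemma transport_eqI:
  assumes "linear_iso V V' \<Phi>" "g \<in> extensional (carrier V')"
    and "\<And>u. u \<in> carrier V \<Longrightarrow> g (\<Phi> u) = \<Phi> (\<rho> c u)"
  shows "transport V V' \<Phi> \<rho> c = g"
proof (rule extensionalityI)
  show "transport V V' \<Phi> \<rho> c \<in> extensional (carrier V')" by (simp add: transport_def)
  fix v assume "v \<in> carrier V'"
  then show "transport V V' \<Phi> \<rho> c v = g v"
    using assms by (elim linear_iso_surj[OF assms(1)]) (simp add: transport_apply)
qed fact

lemma algebra_rep_transport: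
  assumes rep: "algebra_rep R \<iota> V \<rho>" and iso: "linear_iso V V' \<Phi>"
  shows "algebra_rep R \<iota> V' (transport V V' \<Phi> \<rho>)"
proof -
  let ?\<rho>' = "transport V V' \<Phi> \<rho>"
  have mod: "Module.module complex_field V" and hom: "\<rho> \<in> ring_hom R (End_ring V)"
    and scal: "\<And>c. \<rho> (\<iota> c) = (\<lambda>u\<in>carrier V. c \<odot>\<^bsub>V\<^esub> u)"
    using rep by (auto simp: algebra_rep_def)
  interpret V: Module.module complex_field V by fact
  note tr = linear_iso_hom[OF iso] linear_iso_simps[OF iso] transport_apply[OF iso]
  have lin: "\<rho> c \<in> linear_maps V V" if "c \<in> carrier R" for c
    using ring_hom_closed[OF hom that] by (simp add: End_ring_def)
  have cl: "\<rho> c u \<in> carrier V" if "c \<in> carrier R" "u \<in> carrier V" for c u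
    using lin[OF that(1)] that(2) by (auto simp: linear_maps_def)
  have "?\<rho>' \<in> ring_hom R (End_ring V')"
  proof (rule ring_hom_memI)
    fix c assume c: "c \<in> carrier R"
    have "?\<rho>' c \<in> carrier V' \<rightarrow>\<^sub>E carrier V'"
      using cl[OF c] by (auto simp: transport_def tr elim!: linear_iso_surj[OF iso])
    moreover have "?\<rho>' c (x \<oplus>\<^bsub>V'\<^esub> y) = ?\<rho>' c x \<oplus>\<^bsub>V'\<^esub> ?\<rho>' c y"
      if "x \<in> carrier V'" "y \<in> carrier V'" for x y
      using that lin[OF c] cl[OF c]
      by (elim linear_iso_surj[OF iso]) (simp add: tr linear_maps_def)
    moreover have "?\<rho>' c (a \<odot>\<^bsub>V'\<^esub> x) = a \<odot>\<^bsub>V'\<^esub> ?\<rho>' c x" if "x \<in> carrier V'" for a x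
      using that lin[OF c] cl[OF c] V.smult_closed
      by (elim linear_iso_surj[OF iso]) (simp add: tr linear_maps_def)
    ultimately show "?\<rho>' c \<in> carrier (End_ring V')"
      by (simp add: End_ring_def linear_maps_def)
  next
    fix c d assume c: "c \<in> carrier R" and d: "d \<in> carrier R"
    have "\<rho> (c \<otimes>\<^bsub>R\<^esub> d) = compose (carrier V) (\<rho> c) (\<rho> d)"
      using ring_hom_mult[OF hom c d] by (simp add: End_ring_def)
    then show "?\<rho>' (c \<otimes>\<^bsub>R\<^esub> d) = ?\<rho>' c \<otimes>\<^bsub>End_ring V'\<^esub> ?\<rho>' d"
      by (intro transport_eqI[OF iso]) (simp_all add: End_ring_def compose_def tr cl d)
    have "\<rho> (c \<oplus>\<^bsub>R\<^esub> d) = (\<lambda>u\<in>carrier V. \<rho> c u \<oplus>\<^bsub>V\<^esub> \<rho> d u)"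
      using ring_hom_add[OF hom c d] by (simp add: End_ring_def)
    then show "?\<rho>' (c \<oplus>\<^bsub>R\<^esub> d) = ?\<rho>' c \<oplus>\<^bsub>End_ring V'\<^esub> ?\<rho>' d"
      by (intro transport_eqI[OF iso]) (simp_all add: End_ring_def tr cl c d)
  next
    have "\<rho> \<one>\<^bsub>R\<^esub> = (\<lambda>u\<in>carrier V. u)"
      using ring_hom_one[OF hom] by (simp add: End_ring_def)
    then show "?\<rho>' \<one>\<^bsub>R\<^esub> = \<one>\<^bsub>End_ring V'\<^esub>"
      by (intro transport_eqI[OF iso]) (simp_all add: End_ring_def tr)
  qed
  moreover have "?\<rho>' (\<iota> c) = (\<lambda>v\<in>carrier V'. c \<odot>\<^bsub>V'\<^esub> v)" for c
    by (intro transport_eqI[OF iso]) (simp_all add: scal tr)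
  ultimately show ?thesis
    using module_transport[OF mod iso] by (simp add: algebra_rep_def)
qed

lemma rep_isomorphic_transport:
  assumes rep: "algebra_rep R \<iota> V \<rho>" and iso: "linear_iso V V' \<Phi>" "linear_iso V V'' \<Psi>"
  shows "rep_isomorphic R V' (transport V V' \<Phi> \<rho>) V'' (transport V V'' \<Psi> \<rho>)"
proof -
  interpret V: Module.module complex_field V
    using rep by (simp add: algebra_rep_def)
  have hom: "\<rho> \<in> ring_hom R (End_ring V)"
    using rep by (auto simp: algebra_rep_def)
  have cl: "\<rho> c u \<in> carrier V" if "c \<in> carrier R" "u \<in> carrier V" for c u
    using ring_hom_closed[OF hom that(1)] that(2) by (auto simp: linear_maps_def End_ring_def)
  note tr = linear_iso_hom[OF iso(1)] linear_iso_simps[OF iso(1)] transport_apply[OF iso(1)]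
    linear_iso_hom[OF iso(2)] linear_iso_simps[OF iso(2)] transport_apply[OF iso(2)]
  define \<Theta> where "\<Theta> = (\<lambda>v\<in>carrier V'. \<Psi> (inv_into (carrier V) \<Phi> v))"
  have \<Theta>: "\<Theta> (\<Phi> u) = \<Psi> u" if "u \<in> carrier V" for u
    using that by (simp add: \<Theta>_def tr)
  have "bij_betw (\<Psi> \<circ> inv_into (carrier V) \<Phi>) (carrier V') (carrier V'')"
    using iso by (intro bij_betw_trans[where B = "carrier V"] bij_betw_inv_into)
      (simp_all add: linear_iso_def)
  then have "bij_betw \<Theta> (carrier V') (carrier V'')"
    by (rule bij_betw_cong[THEN iffD1, rotated]) (simp add: \<Theta>_def)
  moreover have "\<Theta> \<in> linear_maps V' V''"
    unfolding linear_maps_def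
  proof (intro CollectI conjI ballI allI)
    show "\<Theta> \<in> carrier V' \<rightarrow>\<^sub>E carrier V''"
      by (auto simp: \<Theta>_def tr elim!: linear_iso_surj[OF iso(1)])
  next
    fix x y assume "x \<in> carrier V'" "y \<in> carrier V'"
    then show "\<Theta> (x \<oplus>\<^bsub>V'\<^esub> y) = \<Theta> x \<oplus>\<^bsub>V''\<^esub> \<Theta> y"
      by (elim linear_iso_surj[OF iso(1)]) (simp add: tr \<Theta>)
  next
    fix c x assume "x \<in> carrier V'"
    then show "\<Theta> (c \<odot>\<^bsub>V'\<^esub> x) = c \<odot>\<^bsub>V''\<^esub> \<Theta> x"
      using V.smult_closed by (elim linear_iso_surj[OF iso(1)]) (simp add: tr \<Theta>)
  qed
  moreover have "\<Theta> (transport V V' \<Phi> \<rho> c x) = transport V V'' \<Psi> \<rho> c (\<Theta> x)"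
    if "c \<in> carrier R" "x \<in> carrier V'" for c x
    using that by (elim linear_iso_surj[OF iso(1)]) (simp add: tr \<Theta> cl)
  ultimately show ?thesis
    unfolding rep_isomorphic_def by blast
qed

section \<open>The exterior algebra as a Fock space\<close>

declare fock_act.simps [simp del] minus_apply [simp del] uminus_apply [simp del]

lemma basis_W'_subset: "basis_W' n \<subseteq> basis_W n"
  by (auto simp: basis_W_def basis_W'_def)

lemma tensors_mono:
  assumes "X \<subseteq> X'" "p \<in> tensors X"
  shows "p \<in> tensors X'"
  using assms unfolding tensors_iff by (meson lists_mono order_trans)

lemma exterior_squares_in_tensors:
  "{tensor_mult w w | w. w \<in> degree_one (basis_W' n)} \<subseteq> tensors (basis_W' n)"
  using degree_one_in_tensors[OF finite_basis(2)] tensor_mult_in_tensors by blast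

lemma ideal_exterior: "ideal (exterior_ideal n) (tensor_algebra (basis_W' n))"
  unfolding exterior_ideal_def
  by (rule ring.genideal_ideal[OF ring_tensor_algebra exterior_squares_in_tensors])

lemma exterior_ideal_closed:
  shows "p \<in> exterior_ideal n \<Longrightarrow> p \<in> tensors (basis_W' n)"
    and "0 \<in> exterior_ideal n"
    and "p \<in> exterior_ideal n \<Longrightarrow> q \<in> exterior_ideal n \<Longrightarrow> p + q \<in> exterior_ideal n"
    and "p \<in> exterior_ideal n \<Longrightarrow> r \<in> tensors (basis_W' n) \<Longrightarrow> tensor_mult r p \<in> exterior_ideal n"
    and "p \<in> exterior_ideal n \<Longrightarrow> r \<in> tensors (basis_W' n) \<Longrightarrow> tensor_mult p r \<in> exterior_ideal n"
proof -
  interpret I: ideal "exterior_ideal n" "tensor_algebra (basis_W' n)" by (rule ideal_exterior)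
  show "p \<in> exterior_ideal n \<Longrightarrow> p \<in> tensors (basis_W' n)" by (rule I.a_Hcarr)
  show "0 \<in> exterior_ideal n" using additive_subgroup.zero_closed[OF I.additive_subgroup_axioms] by simp
  show "p \<in> exterior_ideal n \<Longrightarrow> q \<in> exterior_ideal n \<Longrightarrow> p + q \<in> exterior_ideal n"
    using additive_subgroup.a_closed[OF I.additive_subgroup_axioms, of p q] by simp
  show "p \<in> exterior_ideal n \<Longrightarrow> r \<in> tensors (basis_W' n) \<Longrightarrow> tensor_mult r p \<in> exterior_ideal n"
    using I.I_l_closed[of p r] by simp
  show "p \<in> exterior_ideal n \<Longrightarrow> r \<in> tensors (basis_W' n) \<Longrightarrow> tensor_mult p r \<in> exterior_ideal n"
    using I.I_r_closed[of p r] by simp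
qed

lemma exterior_ideal_cscale:
  assumes "p \<in> exterior_ideal n"
  shows "cscale c p \<in> exterior_ideal n"
proof -
  have "tensor_mult (cscale c (word [])) p = cscale c p"
    using exterior_ideal_closed(1)[OF assms]
    by (simp add: tensor_mult_cscale_left tensor_mult_one[where X = "basis_W' n"])
  then show ?thesis
    using exterior_ideal_closed(4)[OF assms cscale_in_tensors[OF word_in_tensors], of "[]" c] by simp
qed

lemma exterior_ideal_diff:
  assumes "p \<in> exterior_ideal n" "q \<in> exterior_ideal n"
  shows "p - q \<in> exterior_ideal n"
  using exterior_ideal_closed(3)[OF assms(1) exterior_ideal_cscale[OF assms(2), of "-1"]]
  by (simp add: cscale_minus_one)

lemma exterior_ideal_sum:
  "(\<And>i. i \<in> A \<Longrightarrow> p i \<in> exterior_ideal n) \<Longrightarrow> sum p A \<in> exterior_ideal n"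
  by (induction A rule: infinite_finite_induct) (simp_all add: exterior_ideal_closed)

lemma exterior_square:
  "w \<in> degree_one (basis_W' n) \<Longrightarrow> tensor_mult w w \<in> exterior_ideal n"
  unfolding exterior_ideal_def
  using ring.genideal_self[OF ring_tensor_algebra exterior_squares_in_tensors] by blast

lemma word_degree_one: "t \<in> X \<Longrightarrow> word [t] \<in> degree_one X"
  unfolding degree_one_def by (intro cfun.span_base imageI)

lemma exterior_anticommute:
  assumes "s \<in> basis_W' n" "t \<in> basis_W' n"
  shows "word [s, t] + word [t, s] \<in> exterior_ideal n"
proof -
  have deg: "word [s] \<in> degree_one (basis_W' n)" "word [t] \<in> degree_one (basis_W' n)"
    using assms by (simp_all add: word_degree_one)
  have sum: "word [s] + word [t] \<in> degree_one (basis_W' n)"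
    using deg unfolding degree_one_def by (rule cfun.span_add)
  have "tensor_mult (word [s] + word [t]) (word [s] + word [t]) -
      tensor_mult (word [s]) (word [s]) - tensor_mult (word [t]) (word [t]) = word [s, t] + word [t, s]"
    by (simp add: tensor_mult_linear tensor_mult_word_word)
  then show ?thesis
    using exterior_ideal_diff[OF exterior_ideal_diff[OF exterior_square[OF sum] exterior_square[OF deg(1)]]
      exterior_square[OF deg(2)]] by simp
qed

lemma fock_eval_exterior_ideal:
  assumes "p \<in> exterior_ideal n"
  shows "fock_eval p f = 0"
  using exterior_squares_in_tensors _ assms[unfolded exterior_ideal_def]
proof (rule fock_eval_genideal)
  fix p f
  assume "p \<in> {tensor_mult w w | w. w \<in> degree_one (basis_W' n)}"
  then obtain w where p: "p = tensor_mult w w" and w: "w \<in> degree_one (basis_W' n)"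
    by blast
  \<comment> \<open>The anticommutation relation of \<open>w\<close> with itself determines only twice its square.\<close>
  have "fock_eval p f + fock_eval p f = fock_eval w (fock_eval w f) + fock_eval w (fock_eval w f)"
    unfolding p using degree_one_in_tensors[OF finite_basis(2) w]
    by (simp add: fock_eval_mult[where X = "basis_W' n"])
  also have "\<dots> = cscale (\<Sum>s\<in>basis_W' n. \<Sum>t\<in>basis_W' n. w [s] * w [t] * Q_basis s t) f"
    by (rule fock_eval_anticommutator[OF finite_basis(2) w w])
  also have "(\<Sum>s\<in>basis_W' n. \<Sum>t\<in>basis_W' n. w [s] * w [t] * Q_basis s t) = 0"
    by (intro sum.neutral ballI) (auto simp: basis_W'_def)
  finally have E: "fock_eval p f + fock_eval p f = cscale 0 f" .
  have "fock_eval p f G = 0" for G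
    using fun_cong[OF E, of G] by (simp add: plus_fun_apply cscale_def)
  then show "fock_eval p f = 0"
    by (simp add: fun_eq_iff zero_fun_apply)
qed

definition fock_basis :: "nat set \<Rightarrow> fock" where
  "fock_basis F = (\<lambda>G. if G = F then 1 else 0)"

definition wedge_word :: "nat set \<Rightarrow> clifford_basis list \<Rightarrow> complex" where
  "wedge_word F = word (map gen_b (sorted_list_of_set F))"

text \<open>A linear section of the map \<open>p \<mapsto> p \<cdot> 1\<close> from tensors to the Fock space, where \<open>1\<close> is the
  vacuum \<open>fock_basis {}\<close>.\<close>

definition wedge_tensor :: "nat \<Rightarrow> fock \<Rightarrow> clifford_basis list \<Rightarrow> complex" where
  "wedge_tensor n f = (\<Sum>F\<in>Pow {1..n}. cscale (f F) (wedge_word F))"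

lemma fock_expansion:
  assumes "f \<in> carrier (fock_module n)"
  shows "f = (\<Sum>F\<in>Pow {1..n}. cscale (f F) (fock_basis F))"
proof
  fix G
  have "(\<Sum>F\<in>Pow {1..n}. cscale (f F) (fock_basis F)) G =
      (\<Sum>F\<in>Pow {1..n}. if F = G then f F else 0)"
    unfolding sum_fun_apply by (rule sum.cong) (auto simp: cscale_def fock_basis_def)
  also have "\<dots> = f G"
    using assms unfolding fock_carrier_iff by (auto simp: sum.delta)
  finally show "f G = (\<Sum>F\<in>Pow {1..n}. cscale (f F) (fock_basis F)) G" by simp
qed

lemma fock_act_b_basis:
  "fock_act (gen_b k) (fock_basis F) = (if k \<in> F then 0 else cscale (fsign k F) (fock_basis (insert k F)))"
proof
  fix G
  have "fsign k (insert k F) = fsign k F"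
    by (cases "k \<in> F") (simp_all add: fsign_insert insert_absorb)
  moreover have "k \<in> G \<and> G - {k} = F \<longleftrightarrow> G = insert k F \<and> k \<notin> F"
    by blast
  ultimately show "fock_act (gen_b k) (fock_basis F) G =
      (if k \<in> F then 0 else cscale (fsign k F) (fock_basis (insert k F))) G"
    by (auto simp: fock_act.simps fock_basis_def cscale_def zero_fun_apply)
qed

lemma wedge_word_in_tensors:
  assumes "F \<subseteq> {1..n}"
  shows "wedge_word F \<in> tensors (basis_W' n)"
proof -
  have "finite F" using assms finite_subset by blast
  then have "map gen_b (sorted_list_of_set F) \<in> lists (basis_W' n)"
    using assms by (simp add: basis_W'_def lists_eq_set image_mono)
  then show ?thesis unfolding wedge_word_def by (rule word_in_tensors)
qed

lemma wedge_tensor_in_tensors: "wedge_tensor n f \<in> tensors (basis_W' n)"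
  unfolding wedge_tensor_def by (intro sum_in_tensors cscale_in_tensors wedge_word_in_tensors) auto

lemma wedge_tensor_linear:
  "wedge_tensor n (f + g) = wedge_tensor n f + wedge_tensor n g"
  "wedge_tensor n (cscale c f) = cscale c (wedge_tensor n f)"
  "wedge_tensor n 0 = 0"
proof -
  show "wedge_tensor n (f + g) = wedge_tensor n f + wedge_tensor n g" "wedge_tensor n 0 = 0"
    by (simp_all add: wedge_tensor_def plus_fun_apply zero_fun_apply cfun.scale_left_distrib sum.distrib)
  have "cscale (cscale c f F) p = cscale c (cscale (f F) p)" for F and p :: "clifford_basis list \<Rightarrow> complex"
    by (simp add: cscale_def mult.assoc)
  then show "wedge_tensor n (cscale c f) = cscale c (wedge_tensor n f)"
    unfolding wedge_tensor_def by (simp only: cfun.scale_sum_right)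
qed

lemma wedge_tensor_basis:
  assumes "F \<subseteq> {1..n}"
  shows "wedge_tensor n (fock_basis F) = wedge_word F"
proof -
  have "wedge_tensor n (fock_basis F) = (\<Sum>G\<in>Pow {1..n}. if G = F then wedge_word F else 0)"
    unfolding wedge_tensor_def by (rule sum.cong) (auto simp: fock_basis_def)
  then show ?thesis using assms by (simp add: sum.delta)
qed

text \<open>Read from the right, each letter of an increasing word is smaller than all indices already
  present, so no signs arise.\<close>

lemma fock_eval_wedge_word:
  assumes "finite F"
  shows "fock_eval (wedge_word F) (fock_basis {}) = fock_basis F"
proof -
  have "foldr fock_act (map gen_b xs) (fock_basis {}) = fock_basis (set xs)"
    if "sorted_wrt (<) xs" for xs
    using that
  proof (induction xs)
    case (Cons x xs)
    have "set xs \<inter> {..<x} = {}" "x \<notin> set xs"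
      using Cons.prems by auto
    then show ?case
      using Cons by (simp add: fock_act_b_basis fsign_def)
  qed simp
  from this[of "sorted_list_of_set F"] show ?thesis
    using assms by (simp add: wedge_word_def fock_eval_word)
qed

lemma fock_eval_wedge_tensor:
  assumes "f \<in> carrier (fock_module n)"
  shows "fock_eval (wedge_tensor n f) (fock_basis {}) = f"
proof -
  have "fock_eval (wedge_tensor n f) (fock_basis {}) =
      (\<Sum>F\<in>Pow {1..n}. fock_eval (cscale (f F) (wedge_word F)) (fock_basis {}))"
    unfolding wedge_tensor_def
    by (rule fock_eval_sum[where X = "basis_W' n"]) (simp add: cscale_in_tensors wedge_word_in_tensors)
  also have "\<dots> = (\<Sum>F\<in>Pow {1..n}. cscale (f F) (fock_basis F))"
  proof (rule sum.cong[OF refl])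
    fix F assume "F \<in> Pow {1..n}"
    then have "finite F" using finite_subset by blast
    then show "fock_eval (cscale (f F) (wedge_word F)) (fock_basis {}) = cscale (f F) (fock_basis F)"
      by (simp add: fock_eval_cscale fock_eval_wedge_word)
  qed
  finally show ?thesis
    using fock_expansion[OF assms] by simp
qed

text \<open>Modulo the exterior ideal, a letter is moved to its place in an increasing word by
  transpositions of neighbours, each of which changes the sign; a letter that is already present
  meets its copy, and a square vanishes.\<close>

lemma wedge_insert:
  assumes "sorted_wrt (<) xs" "set xs \<subseteq> {1..n}" "k \<in> {1..n}"
  shows "k \<in> set xs \<Longrightarrow> word (map gen_b (k # xs)) \<in> exterior_ideal n"
    and "k \<notin> set xs \<Longrightarrow> word (map gen_b (k # xs)) -
      cscale (fsign k (set xs)) (word (map gen_b (insort k xs))) \<in> exterior_ideal n"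
proof -
  have "if k \<in> set xs then word (map gen_b (k # xs)) \<in> exterior_ideal n
    else word (map gen_b (k # xs)) - cscale (fsign k (set xs)) (word (map gen_b (insort k xs))) \<in> exterior_ideal n"
    using assms(1,2)
  proof (induction xs)
    case Nil
    then show ?case by (simp add: fsign_def exterior_ideal_closed)
  next
    case (Cons x xs)
    let ?r = "map gen_b xs"
    have letters: "gen_b k \<in> basis_W' n" "gen_b x \<in> basis_W' n" "set ?r \<subseteq> basis_W' n"
      using Cons.prems assms(3) by (auto simp: basis_W'_def)
    have r: "word ?r \<in> tensors (basis_W' n)"
      using letters(3) by (intro word_in_tensors) auto
    have x: "word [gen_b x] \<in> tensors (basis_W' n)"
      using letters(2) by (intro word_in_tensors) simp
    have less: "\<forall>y\<in>set xs. x < y" and sorted: "sorted_wrt (<) xs"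
      using Cons.prems by simp_all
    consider "k < x" | "k = x" | "x < k" by linarith
    then show ?case
    proof cases
      case 1
      then have "k \<notin> set (x # xs)" "set (x # xs) \<inter> {..<k} = {}" using less by auto
      then show ?thesis
        using 1 by (simp add: fsign_def exterior_ideal_closed)
    next
      case 2
      have "tensor_mult (tensor_mult (word [gen_b x]) (word [gen_b x])) (word ?r) \<in> exterior_ideal n"
        by (rule exterior_ideal_closed(5)[OF exterior_square[OF word_degree_one[OF letters(2)]] r])
      then show ?thesis
        using 2 by (simp add: tensor_mult_word_word)
    next
      case 3
      have swap: "word (gen_b k # gen_b x # ?r) + word (gen_b x # gen_b k # ?r) \<in> exterior_ideal n"
        using exterior_ideal_closed(5)[OF exterior_anticommute[OF letters(1,2)] r]
        by (simp add: tensor_mult_linear tensor_mult_word_word)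
      have IH: "if k \<in> set xs then word (gen_b k # ?r) \<in> exterior_ideal n
        else word (gen_b k # ?r) - cscale (fsign k (set xs)) (word (map gen_b (insort k xs))) \<in> exterior_ideal n"
        using Cons.IH[OF sorted] Cons.prems(2) unfolding list.map by fastforce
      show ?thesis
      proof (cases "k \<in> set xs")
        case True
        then have "word (gen_b x # gen_b k # ?r) \<in> exterior_ideal n"
          using IH exterior_ideal_closed(4)[OF _ x, of "word (gen_b k # ?r)"]
          by (simp add: tensor_mult_word_word)
        from exterior_ideal_diff[OF swap this] show ?thesis
          using 3 True by simp
      next
        case False
        let ?c = "fsign k (set xs)" and ?w = "map gen_b (insort k xs)"
        have neq: "\<And>p q. tensor_mult p (- q) = - tensor_mult p q"
          using tensor_mult_cscale_right[of _ "-1"] by (simp add: cscale_minus_one)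
        \<comment> \<open>After the transposition with \<open>x\<close>, the letter \<open>k\<close> is inserted into the tail.\<close>
        have "tensor_mult (word [gen_b x]) (word (gen_b k # ?r) - cscale ?c (word ?w)) \<in> exterior_ideal n"
          using exterior_ideal_closed(4)[OF _ x] IH False by simp
        moreover have "tensor_mult (word [gen_b x]) (word (gen_b k # ?r) - cscale ?c (word ?w)) =
            word (gen_b x # gen_b k # ?r) - cscale ?c (word (gen_b x # ?w))"
          using tensor_mult_add_right[of "word [gen_b x]" "word (gen_b k # ?r)" "- cscale ?c (word ?w)"]
          by (simp add: neq tensor_mult_cscale_right tensor_mult_word_word)
        ultimately have "word (gen_b x # gen_b k # ?r) - cscale ?c (word (gen_b x # ?w)) \<in> exterior_ideal n"
          by simp
        from exterior_ideal_diff[OF swap this]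
        have "word (gen_b k # gen_b x # ?r) + cscale ?c (word (gen_b x # ?w)) \<in> exterior_ideal n"
          by simp
        moreover have "fsign k (insert x (set xs)) = - ?c"
          using less 3 by (subst fsign_insert) auto
        ultimately show ?thesis
          using False 3 by simp
      qed
    qed
  qed
  then show "k \<in> set xs \<Longrightarrow> word (map gen_b (k # xs)) \<in> exterior_ideal n"
    and "k \<notin> set xs \<Longrightarrow> word (map gen_b (k # xs)) -
      cscale (fsign k (set xs)) (word (map gen_b (insort k xs))) \<in> exterior_ideal n"
    by simp_all
qed

lemma tensor_mult_sum_right: "tensor_mult p (sum q A) = (\<Sum>i\<in>A. tensor_mult p (q i))"
  by (induction A rule: infinite_finite_induct) (simp_all add: tensor_mult_linear)

lemma wedge_tensor_sum: "wedge_tensor n (sum g A) = (\<Sum>i\<in>A. wedge_tensor n (g i))"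
  by (induction A rule: infinite_finite_induct) (simp_all add: wedge_tensor_linear)

lemma wedge_tensor_act:
  assumes "k \<in> {1..n}" "f \<in> carrier (fock_module n)"
  shows "tensor_mult (word [gen_b k]) (wedge_tensor n f) - wedge_tensor n (fock_act (gen_b k) f)
    \<in> exterior_ideal n"
proof -
  have basis: "tensor_mult (word [gen_b k]) (wedge_word F) - wedge_tensor n (fock_act (gen_b k) (fock_basis F))
      \<in> exterior_ideal n" if "F \<subseteq> {1..n}" for F
  proof -
    have fin: "finite F" using that finite_subset by blast
    let ?xs = "sorted_list_of_set F"
    have "tensor_mult (word [gen_b k]) (wedge_word F) = word (map gen_b (k # ?xs))"
      by (simp add: wedge_word_def tensor_mult_word_word)
    moreover have "wedge_tensor n (fock_act (gen_b k) (fock_basis F)) =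
        (if k \<in> F then 0 else cscale (fsign k F) (word (map gen_b (insort k ?xs))))"
      using that assms(1) fin wedge_tensor_basis[of "insert k F" n]
      by (simp add: fock_act_b_basis wedge_tensor_linear wedge_word_def sorted_list_of_set_insert)
    ultimately show ?thesis
      using wedge_insert[of ?xs n k] that assms(1) fin by simp
  qed
  let ?e = "\<lambda>F. tensor_mult (word [gen_b k]) (wedge_word F) - wedge_tensor n (fock_act (gen_b k) (fock_basis F))"
  have "fock_act (gen_b k) f = (\<Sum>F\<in>Pow {1..n}. cscale (f F) (fock_act (gen_b k) (fock_basis F)))"
    by (subst fock_expansion[OF assms(2)]) (simp only: fock_act_sum fock_act_linear)
  then have "wedge_tensor n (fock_act (gen_b k) f) =
      (\<Sum>F\<in>Pow {1..n}. cscale (f F) (wedge_tensor n (fock_act (gen_b k) (fock_basis F))))"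
    by (simp only: wedge_tensor_sum wedge_tensor_linear)
  moreover have "tensor_mult (word [gen_b k]) (wedge_tensor n f) =
      (\<Sum>F\<in>Pow {1..n}. cscale (f F) (tensor_mult (word [gen_b k]) (wedge_word F)))"
    unfolding wedge_tensor_def by (simp only: tensor_mult_sum_right tensor_mult_linear)
  ultimately have "tensor_mult (word [gen_b k]) (wedge_tensor n f) - wedge_tensor n (fock_act (gen_b k) f) =
      (\<Sum>F\<in>Pow {1..n}. cscale (f F) (?e F))"
    by (simp add: sum_subtractf cfun.scale_right_diff_distrib)
  also have "\<dots> \<in> exterior_ideal n"
    by (intro exterior_ideal_sum exterior_ideal_cscale basis) auto
  finally show ?thesis .
qed

lemma fock_basis_empty_carrier: "fock_basis {} \<in> carrier (fock_module n)"
  by (auto simp: fock_carrier_iff fock_basis_def)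

lemma fock_eval_vacuum_carrier:
  assumes "p \<in> tensors (basis_W' n)"
  shows "fock_eval p (fock_basis {}) \<in> carrier (fock_module n)"
  using fock_eval_carrier[OF tensors_mono[OF basis_W'_subset assms] fock_basis_empty_carrier] .

text \<open>Straightening: left multiplication by a letter and insertion agree modulo the ideal, so by
  induction on words a tensor is congruent to the combination of increasing words that is read off
  from its action on the vacuum. Thus the exterior algebra is not larger than the Fock space.\<close>

lemma wedge_tensor_fock_eval:
  assumes "p \<in> tensors (basis_W' n)"
  shows "p - wedge_tensor n (fock_eval p (fock_basis {})) \<in> exterior_ideal n"
  using assms
proof (induction rule: tensor_induct)
  case (word c u)
  then have "word u - wedge_tensor n (fock_eval (word u) (fock_basis {})) \<in> exterior_ideal n"
  proof (induction u)
    case Nil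
    then show ?case
      using wedge_tensor_basis[of "{}" n]
      by (simp add: fock_eval_word exterior_ideal_closed wedge_word_def)
  next
    case (Cons t u)
    then have u: "u \<in> lists (basis_W' n)" and "t \<in> basis_W' n" by simp_all
    then obtain k where k: "t = gen_b k" "k \<in> {1..n}" by (auto simp: basis_W'_def)
    let ?f = "fock_eval (word u) (fock_basis {})"
    have t: "word [t] \<in> tensors (basis_W' n)" using \<open>t \<in> basis_W' n\<close> by (simp add: word_in_tensors)
    have f: "?f \<in> carrier (fock_module n)"
      using u by (intro fock_eval_vacuum_carrier word_in_tensors)
    have "tensor_mult (word [t]) (word u - wedge_tensor n ?f) \<in> exterior_ideal n"
      using Cons.IH t by (rule exterior_ideal_closed(4))
    moreover have "tensor_mult (word [t]) (wedge_tensor n ?f) - wedge_tensor n (fock_act t ?f) \<in> exterior_ideal n"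
      unfolding k(1) by (rule wedge_tensor_act[OF k(2) f])
    ultimately have "tensor_mult (word [t]) (word u - wedge_tensor n ?f) +
        (tensor_mult (word [t]) (wedge_tensor n ?f) - wedge_tensor n (fock_act t ?f)) \<in> exterior_ideal n"
      by (rule exterior_ideal_closed(3))
    also have "tensor_mult (word [t]) (word u - wedge_tensor n ?f) +
        (tensor_mult (word [t]) (wedge_tensor n ?f) - wedge_tensor n (fock_act t ?f)) =
        tensor_mult (word [t]) ((word u - wedge_tensor n ?f) + wedge_tensor n ?f) - wedge_tensor n (fock_act t ?f)"
      by (simp only: tensor_mult_add_right) simp
    also have "\<dots> = word (t # u) - wedge_tensor n (fock_eval (word (t # u)) (fock_basis {}))"
      by (simp add: tensor_mult_word_word fock_eval_word)
    finally show ?case .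
  qed
  from exterior_ideal_cscale[OF this, of c] show ?case
    by (simp add: cfun.scale_right_diff_distrib fock_eval_cscale wedge_tensor_linear)
next
  case (add p q)
  from exterior_ideal_closed(3)[OF add(3,4)] show ?case
    by (simp add: fock_eval_add[OF add(1,2)] wedge_tensor_linear algebra_simps)
qed (simp_all add: exterior_ideal_closed wedge_tensor_linear)

definition fock_to_exterior :: "nat \<Rightarrow> fock \<Rightarrow> (clifford_basis list \<Rightarrow> complex) set" where
  "fock_to_exterior n f = exterior_ideal n +>\<^bsub>tensor_algebra (basis_W' n)\<^esub> wedge_tensor n f"

lemma exterior_coset_eq_iff:
  assumes "p \<in> tensors (basis_W' n)" "q \<in> tensors (basis_W' n)"
  shows "exterior_ideal n +>\<^bsub>tensor_algebra (basis_W' n)\<^esub> p =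
    exterior_ideal n +>\<^bsub>tensor_algebra (basis_W' n)\<^esub> q \<longleftrightarrow> p - q \<in> exterior_ideal n"
  using ring.quotient_eq_iff_same_a_r_cos[OF ring_tensor_algebra ideal_exterior assms]
  by (simp add: a_minus_tensors[OF assms])

lemma exterior_coset_fock_eval:
  assumes "p \<in> tensors (basis_W' n)"
  shows "exterior_ideal n +>\<^bsub>tensor_algebra (basis_W' n)\<^esub> p = fock_to_exterior n (fock_eval p (fock_basis {}))"
  unfolding fock_to_exterior_def exterior_coset_eq_iff[OF assms wedge_tensor_in_tensors]
  by (rule wedge_tensor_fock_eval[OF assms])

lemma carrier_exterior:
  "X \<in> carrier (exterior n) \<longleftrightarrow>
    (\<exists>p\<in>tensors (basis_W' n). X = exterior_ideal n +>\<^bsub>tensor_algebra (basis_W' n)\<^esub> p)"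
  by (auto simp: exterior_def exterior_ring_def FactRing_def A_RCOSETS_def')

lemma exterior_ring_mult:
  assumes "p \<in> tensors (basis_W' n)" "q \<in> tensors (basis_W' n)"
  shows "(exterior_ideal n +>\<^bsub>tensor_algebra (basis_W' n)\<^esub> p) \<otimes>\<^bsub>exterior_ring n\<^esub>
    (exterior_ideal n +>\<^bsub>tensor_algebra (basis_W' n)\<^esub> q) =
    exterior_ideal n +>\<^bsub>tensor_algebra (basis_W' n)\<^esub> tensor_mult p q"
  using ideal.rcoset_mult_add[OF ideal_exterior assms] by (simp add: exterior_ring_def FactRing_def)

text \<open>Surjectivity is straightening. For injectivity, the action on the vacuum is well defined on
  cosets and recovers \<open>f\<close>.\<close>

lemma linear_iso_fock_exterior: "linear_iso (fock_module n) (exterior n) (fock_to_exterior n)"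
  unfolding linear_iso_def
proof (intro conjI ballI allI)
  let ?T = "tensor_algebra (basis_W' n)"
  interpret I: ideal "exterior_ideal n" ?T by (rule ideal_exterior)
  show "bij_betw (fock_to_exterior n) (carrier (fock_module n)) (carrier (exterior n))"
    unfolding bij_betw_def
  proof
    show "inj_on (fock_to_exterior n) (carrier (fock_module n))"
    proof (rule inj_onI)
      fix f g assume f: "f \<in> carrier (fock_module n)" and g: "g \<in> carrier (fock_module n)"
        and eq: "fock_to_exterior n f = fock_to_exterior n g"
      have "wedge_tensor n f - wedge_tensor n g \<in> exterior_ideal n"
        using eq exterior_coset_eq_iff[OF wedge_tensor_in_tensors wedge_tensor_in_tensors]
        unfolding fock_to_exterior_def by blast
      from fock_eval_exterior_ideal[OF this, of "fock_basis {}"] show "f = g"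
        by (simp add: fock_eval_diff[OF wedge_tensor_in_tensors wedge_tensor_in_tensors]
            fock_eval_wedge_tensor f g)
    qed
    show "fock_to_exterior n ` carrier (fock_module n) = carrier (exterior n)"
    proof (intro equalityI subsetI)
      fix X assume "X \<in> fock_to_exterior n ` carrier (fock_module n)"
      then show "X \<in> carrier (exterior n)"
        unfolding carrier_exterior fock_to_exterior_def using wedge_tensor_in_tensors by blast
    next
      fix X assume "X \<in> carrier (exterior n)"
      then show "X \<in> fock_to_exterior n ` carrier (fock_module n)"
        unfolding carrier_exterior using exterior_coset_fock_eval fock_eval_vacuum_carrier by blast
    qed
  qed
  show "fock_to_exterior n \<zero>\<^bsub>fock_module n\<^esub> = \<zero>\<^bsub>exterior n\<^esub>"
    using I.a_coset_add_zero[OF I.a_subset]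
    by (simp add: fock_to_exterior_def wedge_tensor_linear exterior_def exterior_ring_def FactRing_def)
  show "fock_to_exterior n (f \<oplus>\<^bsub>fock_module n\<^esub> g) =
      fock_to_exterior n f \<oplus>\<^bsub>exterior n\<^esub> fock_to_exterior n g" for f g
    using I.a_rcos_sum[OF wedge_tensor_in_tensors wedge_tensor_in_tensors, of f g]
    by (simp add: fock_to_exterior_def wedge_tensor_linear exterior_def exterior_ring_def FactRing_def)
  show "fock_to_exterior n (c \<odot>\<^bsub>fock_module n\<^esub> f) = c \<odot>\<^bsub>exterior n\<^esub> fock_to_exterior n f" for c f
    using exterior_ring_mult[OF cscale_in_tensors[OF word_in_tensors] wedge_tensor_in_tensors, of "[]" n c f]
    by (simp add: fock_to_exterior_def wedge_tensor_linear exterior_def tensor_mult_cscale_left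
        tensor_mult_one[OF wedge_tensor_in_tensors])
qed

lemma exterior_B_fock:
  assumes "k \<in> {1..n}" "f \<in> carrier (fock_module n)"
  shows "exterior_B n k (fock_to_exterior n f) = fock_to_exterior n (fock_act (gen_b k) f)"
proof -
  have b: "word [gen_b k] \<in> tensors (basis_W' n)"
    using assms(1) by (intro word_in_tensors) (simp add: basis_W'_def)
  have "fock_to_exterior n f \<in> carrier (exterior n)"
    using linear_iso_simps(1)[OF linear_iso_fock_exterior assms(2)] .
  then have "exterior_B n k (fock_to_exterior n f) =
      exterior_ideal n +>\<^bsub>tensor_algebra (basis_W' n)\<^esub> tensor_mult (word [gen_b k]) (wedge_tensor n f)"
    using exterior_ring_mult[OF b wedge_tensor_in_tensors] by (simp add: exterior_B_def fock_to_exterior_def)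
  also have "\<dots> = fock_to_exterior n (fock_act (gen_b k) f)"
    unfolding fock_to_exterior_def
    using exterior_coset_eq_iff[OF tensor_mult_in_tensors[OF b wedge_tensor_in_tensors] wedge_tensor_in_tensors]
      wedge_tensor_act[OF assms] by blast
  finally show ?thesis .
qed

definition contract_word :: "nat \<Rightarrow> clifford_basis list \<Rightarrow> clifford_basis list \<Rightarrow> complex" where
  "contract_word k u = (\<Sum>i<length u. cscale ((-1) ^ i * Q_basis (gen_a k) (u ! i)) (word (take i u @ drop (Suc i) u)))"

lemma contract_word_Cons:
  "contract_word k (t # u) = cscale (Q_basis (gen_a k) t) (word u) - tensor_mult (word [t]) (contract_word k u)"
proof -
  have "contract_word k (t # u) = cscale (Q_basis (gen_a k) t) (word u) +
      (\<Sum>i<length u. cscale ((-1) ^ Suc i * Q_basis (gen_a k) (u ! i)) (word (t # take i u @ drop (Suc i) u)))"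
    by (simp add: contract_word_def sum.lessThan_Suc_shift del: sum.lessThan_Suc)
  also have "(\<Sum>i<length u. cscale ((-1) ^ Suc i * Q_basis (gen_a k) (u ! i)) (word (t # take i u @ drop (Suc i) u))) =
      - tensor_mult (word [t]) (contract_word k u)"
    unfolding contract_word_def tensor_mult_sum_right sum_negf[symmetric]
    by (rule sum.cong) (simp_all add: tensor_mult_linear tensor_mult_word_word)
  finally show ?thesis by simp
qed

lemma contract_word_in_tensors: "u \<in> lists X \<Longrightarrow> contract_word k u \<in> tensors X"
  unfolding contract_word_def
  by (intro sum_in_tensors cscale_in_tensors word_in_tensors)
    (auto simp: in_lists_conv_set dest: in_set_takeD in_set_dropD)

lemma contraction_eq_sum:
  assumes "finite S" "{u. p u \<noteq> 0} \<subseteq> S"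
  shows "contraction k p = (\<Sum>u\<in>S. cscale (p u) (contract_word k u))"
  unfolding contraction_def contract_word_def by (rule sum.mono_neutral_left) (use assms in auto)

lemma contraction_add:
  assumes "p \<in> tensors X" "q \<in> tensors X"
  shows "contraction k (p + q) = contraction k p + contraction k q"
proof -
  let ?S = "{u. p u \<noteq> 0} \<union> {u. q u \<noteq> 0}"
  have S: "finite ?S" using assms by (simp add: tensors_iff)
  have "contraction k r = (\<Sum>u\<in>?S. cscale (r u) (contract_word k u))" if "{u. r u \<noteq> 0} \<subseteq> ?S" for r
    by (rule contraction_eq_sum) (use S that in auto)
  moreover have "{u. (p + q) u \<noteq> 0} \<subseteq> ?S"
    by (auto simp: plus_fun_apply)
  ultimately show ?thesis
    by (simp add: plus_fun_apply cfun.scale_left_distrib sum.distrib)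
qed

lemma contraction_cscale_word: "contraction k (cscale c (word u)) = cscale c (contract_word k u)"
  by (subst contraction_eq_sum[where S = "{u}"]) (auto simp: cscale_def word_def)

lemma fock_act_a_vacuum: "fock_act (gen_a k) (fock_basis {}) = 0"
  by (simp add: fock_act.simps fock_basis_def fun_eq_iff zero_fun_apply)

text \<open>The contraction satisfies \<open>a (t \<otimes> u) = Q(a, t) u - t \<otimes> a u\<close>. By the anticommutation
  relations, the operator \<open>a\<close> on the Fock space has the same property, and both kill the vacuum;
  so they agree by induction on words.\<close>

lemma fock_eval_contraction:
  assumes "p \<in> tensors X"
  shows "contraction k p \<in> tensors X \<and>
    fock_eval (contraction k p) (fock_basis {}) = fock_act (gen_a k) (fock_eval p (fock_basis {}))"
  using assms
proof (induction rule: tensor_induct)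
  case zero
  have "contraction k 0 = 0" by (simp add: contraction_def zero_fun_apply)
  then show ?case by (simp add: zero_in_tensors fock_act_linear)
next
  case (word c u)
  then have "fock_eval (contract_word k u) (fock_basis {}) = fock_act (gen_a k) (foldr fock_act u (fock_basis {}))"
  proof (induction u)
    case Nil
    show ?case by (simp add: contract_word_def fock_act_a_vacuum)
  next
    case (Cons t u)
    then have u: "u \<in> lists X" and t: "t \<in> X" by simp_all
    let ?f = "foldr fock_act u (fock_basis {})"
    have mem: "cscale (Q_basis (gen_a k) t) (word u) \<in> tensors X" "word [t] \<in> tensors X"
      using u t by (simp_all add: cscale_in_tensors word_in_tensors)
    have "fock_eval (contract_word k (t # u)) (fock_basis {}) =
        cscale (Q_basis (gen_a k) t) ?f - fock_act t (fock_act (gen_a k) ?f)"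
      unfolding contract_word_Cons
        fock_eval_diff[OF mem(1) tensor_mult_in_tensors[OF mem(2) contract_word_in_tensors[OF u]]]
        fock_eval_mult[OF mem(2) contract_word_in_tensors[OF u]]
      using Cons.IH by (simp add: fock_eval_cscale fock_eval_word)
    also have "\<dots> = fock_act (gen_a k) (fock_act t ?f)"
      using fock_anticommutation[of "gen_a k" t ?f] by (simp add: algebra_simps)
    finally show ?case by simp
  qed
  then show ?case
    using word by (simp add: contraction_cscale_word fock_eval_cscale fock_eval_word fock_act_linear
        cscale_in_tensors contract_word_in_tensors)
next
  case (add p q)
  then show ?case
    by (simp add: contraction_add[OF add(1,2)] fock_eval_add[where X = X] add_in_tensors fock_act_linear)
qed

text \<open>The contraction is applied to all representatives of a class. They have the same action on
  the vacuum, hence so do their contractions, which therefore lie in a single class.\<close>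

lemma exterior_A_fock:
  assumes "f \<in> carrier (fock_module n)"
  shows "exterior_A n k (fock_to_exterior n f) = fock_to_exterior n (fock_act (gen_a k) f)"
proof -
  let ?T = "tensor_algebra (basis_W' n)"
  interpret I: ideal "exterior_ideal n" ?T by (rule ideal_exterior)
  have X: "fock_to_exterior n f \<in> carrier (exterior n)"
    using linear_iso_simps(1)[OF linear_iso_fock_exterior assms] .
  have "exterior_ideal n +>\<^bsub>?T\<^esub> contraction k p = fock_to_exterior n (fock_act (gen_a k) f)"
    if "p \<in> fock_to_exterior n f" for p
  proof -
    obtain i where i: "i \<in> exterior_ideal n" "p = i + wedge_tensor n f"
      using \<open>p \<in> fock_to_exterior n f\<close> unfolding fock_to_exterior_def tensor_coset_elem by blast
    have p: "p \<in> tensors (basis_W' n)"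
      unfolding i(2) by (intro add_in_tensors exterior_ideal_closed(1) i(1) wedge_tensor_in_tensors)
    have "fock_eval p (fock_basis {}) = f"
      unfolding i(2) fock_eval_add[OF exterior_ideal_closed(1)[OF i(1)] wedge_tensor_in_tensors]
      by (simp add: fock_eval_exterior_ideal[OF i(1)] fock_eval_wedge_tensor assms)
    then show ?thesis
      using exterior_coset_fock_eval fock_eval_contraction[OF p] by simp
  qed
  moreover have "fock_to_exterior n f \<noteq> {}"
    using I.a_rcos_self[OF wedge_tensor_in_tensors, of f] unfolding fock_to_exterior_def by blast
  ultimately show ?thesis
    using X by (simp add: exterior_A_def)
qed

lemma exterior_rep:
  "algebra_rep (clifford n) (clifford_scalar n) (exterior n)
    (transport (fock_module n) (exterior n) (fock_to_exterior n) (clifford_fock n))"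
  and exterior_rep_gen: "k \<in> {1..n} \<Longrightarrow>
    transport (fock_module n) (exterior n) (fock_to_exterior n) (clifford_fock n) (clifford_gen n (gen_a k)) = exterior_A n k"
    "k \<in> {1..n} \<Longrightarrow>
    transport (fock_module n) (exterior n) (fock_to_exterior n) (clifford_fock n) (clifford_gen n (gen_b k)) = exterior_B n k"
proof -
  show "algebra_rep (clifford n) (clifford_scalar n) (exterior n)
    (transport (fock_module n) (exterior n) (fock_to_exterior n) (clifford_fock n))"
    by (rule algebra_rep_transport[OF algebra_rep_clifford_fock linear_iso_fock_exterior])
next
  assume k: "k \<in> {1..n}"
  then have "gen_a k \<in> basis_W n" "gen_b k \<in> basis_W n" by (simp_all add: basis_W_def)
  then show "transport (fock_module n) (exterior n) (fock_to_exterior n) (clifford_fock n) (clifford_gen n (gen_a k)) = exterior_A n k"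
    "transport (fock_module n) (exterior n) (fock_to_exterior n) (clifford_fock n) (clifford_gen n (gen_b k)) = exterior_B n k"
    using k by (intro transport_eqI[OF linear_iso_fock_exterior];
      simp add: clifford_fock_gen exterior_A_fock exterior_B_fock; simp add: exterior_A_def exterior_B_def)+
qed

section \<open>Coordinate spaces and matrices\<close>

definition unit_vec :: "nat \<Rightarrow> cvec" where
  "unit_vec k = (\<lambda>i. if i = k then 1 else 0)"

lemma zero_eq_lambda: "(\<lambda>_. 0) = (0 :: 'a \<Rightarrow> complex)"
  by (simp add: fun_simps)

lemma subspace_cspace: "cfun.subspace (cspace d)"
  by (simp add: cfun.subspace_def cspace_def plus_fun_apply zero_fun_apply cscale_def)

lemma cspace_mono: "d \<le> d' \<Longrightarrow> cspace d \<subseteq> cspace d'"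
  by (auto simp: cspace_def)

lemma cspace_0 [simp]: "cspace 0 = {0}"
  by (auto simp: cspace_def fun_simps)

lemma unit_vec_cspace [simp]: "unit_vec k \<in> cspace d \<longleftrightarrow> k < d"
  by (auto simp: unit_vec_def cspace_def not_le)

lemma cspace_le_iff: "cspace d \<subseteq> cspace d' \<longleftrightarrow> d \<le> d'"
proof
  assume *: "cspace d \<subseteq> cspace d'"
  show "d \<le> d'"
  proof (rule ccontr)
    assume "\<not> d \<le> d'"
    then have "unit_vec d' \<in> cspace d" by simp
    with * show False by (meson less_irrefl subsetD unit_vec_cspace)
  qed
qed (rule cspace_mono)

lemma cspace_eq_iff [simp]: "cspace d = cspace d' \<longleftrightarrow> d = d'"
  by (metis cspace_le_iff eq_iff)

lemma cspace_expansion: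
  assumes "u \<in> cspace d"
  shows "u = (\<Sum>k<d. cscale (u k) (unit_vec k))"
proof
  fix i
  have "(\<Sum>k<d. cscale (u k) (unit_vec k)) i = (\<Sum>k<d. if k = i then u k else 0)"
    unfolding sum_fun_apply by (rule sum.cong) (auto simp: cscale_def unit_vec_def)
  also have "\<dots> = u i"
    using assms by (auto simp: cspace_def not_less)
  finally show "u i = (\<Sum>k<d. cscale (u k) (unit_vec k)) i" by simp
qed

lemma inj_unit_vec: "inj unit_vec"
  by (auto simp: inj_def unit_vec_def fun_eq_iff split: if_splits)

lemma span_unit_vec: "cfun.span (unit_vec ` {..<d}) = cspace d"
proof
  show "cfun.span (unit_vec ` {..<d}) \<subseteq> cspace d"
    by (rule cfun.span_minimal[OF _ subspace_cspace]) auto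
  show "cspace d \<subseteq> cfun.span (unit_vec ` {..<d})"
  proof
    fix u assume "u \<in> cspace d"
    then have "u = (\<Sum>k<d. cscale (u k) (unit_vec k))" by (rule cspace_expansion)
    also have "\<dots> \<in> cfun.span (unit_vec ` {..<d})"
      by (intro cfun.span_sum cfun.span_scale cfun.span_base) auto
    finally show "u \<in> cfun.span (unit_vec ` {..<d})" .
  qed
qed

lemma independent_unit_vec: "cfun.independent (unit_vec ` {..<d})"
proof (rule cfun.independent_if_scalars_zero)
  fix f u assume sum: "(\<Sum>x\<in>unit_vec ` {..<d}. cscale (f x) x) = 0" and "u \<in> unit_vec ` {..<d}"
  then obtain k where k: "k < d" "u = unit_vec k" by blast
  have "0 = (\<Sum>x\<in>unit_vec ` {..<d}. cscale (f x) x) k"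
    using sum by (simp add: zero_fun_apply)
  also have "\<dots> = (\<Sum>i<d. cscale (f (unit_vec i)) (unit_vec i)) k"
    by (subst sum.reindex) (auto intro: inj_on_subset[OF inj_unit_vec])
  also have "\<dots> = (\<Sum>i<d. if i = k then f (unit_vec i) else 0)"
    unfolding sum_fun_apply by (rule sum.cong) (auto simp: cscale_def unit_vec_def)
  also have "\<dots> = f u" using k by simp
  finally show "f u = 0" by simp
qed simp

lemma dim_cspace [simp]: "cfun.dim (cspace d) = d"
proof -
  have "cfun.dim (cspace d) = card (unit_vec ` {..<d})"
    by (rule cfun.dim_eq_card[OF _ independent_unit_vec])
      (simp add: span_unit_vec cfun.span_eq_iff[THEN iffD2, OF subspace_cspace])
  then show ?thesis
    by (simp add: card_image inj_on_subset[OF inj_unit_vec])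
qed

interpretation cmap: vector_space_pair "cscale :: complex \<Rightarrow> ('a \<Rightarrow> complex) \<Rightarrow> _"
    "cscale :: complex \<Rightarrow> ('b \<Rightarrow> complex) \<Rightarrow> _"
  by unfold_locales

abbreviation clinear :: "(('a \<Rightarrow> complex) \<Rightarrow> ('b \<Rightarrow> complex)) \<Rightarrow> bool" where
  "clinear \<equiv> Vector_Spaces.linear cscale cscale"

lemma clinearI:
  assumes "\<And>u v. f (u + v) = f u + f v" "\<And>c u. f (cscale c u) = cscale c (f u)"
  shows "clinear f"
  using assms by unfold_locales auto

lemma dim_image_subspace:
  assumes lin: "clinear f" and inj: "inj_on f (cspace d)" and S: "cfun.subspace S" "S \<subseteq> cspace d"
  shows "cfun.dim (f ` S) = cfun.dim S"
proof -
  obtain B where B: "B \<subseteq> S" "cfun.independent B" "S \<subseteq> cfun.span B" "card B = cfun.dim S"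
    by (rule cfun.basis_exists)
  have span: "cfun.span B = S"
    using B cfun.span_minimal[OF B(1) S(1)] by blast
  have inj': "inj_on f (cfun.span B)"
    unfolding span by (rule inj_on_subset[OF inj S(2)])
  have "cfun.independent (f ` B)"
    by (rule cmap.linear_independent_injective_image[OF lin B(2) inj'])
  moreover have "cfun.span (f ` B) = f ` S"
    by (simp add: cmap.linear_span_image[OF lin] span)
  ultimately have "cfun.dim (f ` S) = card (f ` B)"
    by (metis cfun.dim_eq_card cfun.span_span)
  also have "\<dots> = card B"
    by (rule card_image) (rule inj_on_subset[OF inj'], rule cfun.span_superset)
  finally show ?thesis using B(4) by simp
qed

lemma mat_apply_linear:
  "mat_apply d M (u + v) = mat_apply d M u + mat_apply d M v"
  "mat_apply d M (cscale c u) = cscale c (mat_apply d M u)"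
  "mat_apply d M 0 = 0"
  by (simp_all add: mat_apply_def fun_simps distrib_left sum.distrib sum_distrib_left mult_ac)

lemma clinear_mat_apply: "clinear (mat_apply d M)"
  by (rule clinearI) (simp_all add: mat_apply_linear)

lemma mat_apply_cspace: "M \<in> mat_space d r \<Longrightarrow> mat_apply d M u \<in> cspace r"
  by (simp add: mat_space_def cspace_def mat_apply_def)

lemma mat_apply_unit_vec: "k < d \<Longrightarrow> mat_apply d M (unit_vec k) i = M i k"
proof -
  assume k: "k < d"
  have "mat_apply d M (unit_vec k) i = (\<Sum>l<d. if l = k then M i l else 0)"
    unfolding mat_apply_def by (rule sum.cong) (auto simp: unit_vec_def)
  then show ?thesis using k by simp
qed

lemma mat_mult_apply:
  "mat_apply e (mat_mult d M N) u = mat_apply d M (mat_apply e N u)"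
proof
  fix i
  have "mat_apply e (mat_mult d M N) u i = (\<Sum>l<e. \<Sum>m<d. M i m * N m l * u l)"
    by (simp add: mat_apply_def mat_mult_def sum_distrib_right)
  also have "\<dots> = (\<Sum>m<d. \<Sum>l<e. M i m * N m l * u l)"
    by (rule sum.swap)
  also have "\<dots> = mat_apply d M (mat_apply e N u) i"
    by (simp add: mat_apply_def sum_distrib_left mult.assoc)
  finally show "mat_apply e (mat_mult d M N) u i = mat_apply d M (mat_apply e N u) i" .
qed

text \<open>Identities between products of matrices are checked below on the vectors they act on.\<close>

lemma mat_eqI:
  assumes "M \<in> mat_space d r" "N \<in> mat_space d r"
    and "\<And>u. u \<in> cspace d \<Longrightarrow> mat_apply d M u = mat_apply d N u"
  shows "M = N"
proof (intro ext)
  fix i k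
  show "M i k = N i k"
  proof (cases "k < d")
    case True
    then show ?thesis
      using assms(3)[of "unit_vec k"] mat_apply_unit_vec[OF True] by (metis unit_vec_cspace)
  next
    case False
    then show ?thesis using assms(1,2) by (simp add: mat_space_def)
  qed
qed

lemma mat_mult_in_mat_space:
  "M \<in> mat_space d r \<Longrightarrow> N \<in> mat_space e d \<Longrightarrow> mat_mult d M N \<in> mat_space e r"
  by (auto simp: mat_space_def mat_mult_def)

lemma mat_id_in_mat_space: "mat_id d \<in> mat_space d d"
  by (auto simp: mat_space_def mat_id_def)

lemma mat_id_apply: "u \<in> cspace d \<Longrightarrow> mat_apply d (mat_id d) u = u"
proof
  fix i assume u: "u \<in> cspace d"
  have "mat_apply d (mat_id d) u i = (\<Sum>l<d. if l = i then u l else 0)"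
    unfolding mat_apply_def mat_id_def by (rule sum.cong) auto
  then show "mat_apply d (mat_id d) u i = u i"
    using u by (simp add: cspace_def not_less)
qed

definition matrix_of :: "nat \<Rightarrow> nat \<Rightarrow> (cvec \<Rightarrow> cvec) \<Rightarrow> cmat" where
  "matrix_of d r f = (\<lambda>i k. if i < r \<and> k < d then f (unit_vec k) i else 0)"

lemma matrix_of_in_mat_space: "matrix_of d r f \<in> mat_space d r"
  by (auto simp: mat_space_def matrix_of_def)

lemma mat_apply_matrix_of:
  assumes add: "\<And>u v. u \<in> cspace d \<Longrightarrow> v \<in> cspace d \<Longrightarrow> f (u + v) = f u + f v"
    and scale: "\<And>c u. u \<in> cspace d \<Longrightarrow> f (cscale c u) = cscale c (f u)"
    and into: "\<And>u. u \<in> cspace d \<Longrightarrow> f u \<in> cspace r" and u: "u \<in> cspace d"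
  shows "mat_apply d (matrix_of d r f) u = f u"
proof -
  have sum: "f (\<Sum>k\<in>A. cscale (u k) (unit_vec k)) = (\<Sum>k\<in>A. cscale (u k) (f (unit_vec k)))"
    if "finite A" "A \<subseteq> {..<d}" for A
    using that
  proof (induction A rule: finite_induct)
    case empty
    have "f (cscale 0 0) = cscale 0 (f 0)"
      by (rule scale) (simp add: cspace_def zero_fun_apply)
    then show ?case by simp
  next
    case (insert a A)
    have mem: "cscale (u k) (unit_vec k) \<in> cspace d" if "k < d" for k
      using that by (simp add: cfun.subspace_scale[OF subspace_cspace])
    have "f (\<Sum>k\<in>insert a A. cscale (u k) (unit_vec k)) =
        f (cscale (u a) (unit_vec a)) + f (\<Sum>k\<in>A. cscale (u k) (unit_vec k))"
      unfolding sum.insert[OF insert(1,2)]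
      by (rule add) (use insert mem in \<open>auto intro!: cfun.subspace_sum[OF subspace_cspace]\<close>)
    then show ?case
      using insert scale[of "unit_vec a" "u a"] by simp
  qed
  show ?thesis
  proof
    fix i
    have "f u i = (\<Sum>k<d. cscale (u k) (f (unit_vec k))) i"
      using sum[of "{..<d}"] cspace_expansion[OF u] by simp
    also have "\<dots> = (\<Sum>k<d. u k * f (unit_vec k) i)"
      unfolding sum_fun_apply by (simp add: cscale_def)
    also have "\<dots> = mat_apply d (matrix_of d r f) u i"
    proof (cases "i < r")
      case False
      have "f (unit_vec k) \<in> cspace r" if "k < d" for k
        using that by (intro into) simp
      then have "f (unit_vec k) i = 0" if "k < d" for k
        using that False by (simp add: cspace_def)
      then show ?thesis using False by (simp add: mat_apply_def matrix_of_def)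
    qed (simp add: mat_apply_def matrix_of_def mult.commute)
    finally show "mat_apply d (matrix_of d r f) u i = f u i" by simp
  qed
qed

lemma is_inverse_unique:
  assumes "M \<in> mat_space d d" "is_inverse d M N" "is_inverse d M N'"
  shows "N = N'"
proof (rule mat_eqI)
  show "N \<in> mat_space d d" "N' \<in> mat_space d d" using assms by (auto simp: is_inverse_def)
  fix u assume u: "u \<in> cspace d"
  then have "mat_apply d N u = mat_apply d (mat_mult d N' M) (mat_apply d N u)"
    using assms mat_apply_cspace[of N d d u] by (simp add: is_inverse_def mat_id_apply)
  also have "\<dots> = mat_apply d N' (mat_apply d (mat_mult d M N) u)"
    by (simp add: mat_mult_apply)
  also have "\<dots> = mat_apply d N' u"
    using assms u by (simp add: is_inverse_def mat_id_apply)
  finally show "mat_apply d N u = mat_apply d N' u" .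
qed

lemma GL_inverse:
  assumes "M \<in> GL d"
  shows "is_inverse d M (mat_inv d M)"
proof -
  obtain N where N: "is_inverse d M N" and M: "M \<in> mat_space d d" using assms by (auto simp: GL_def)
  have "is_inverse d M (THE N. is_inverse d M N)"
    by (rule theI[of "is_inverse d M" N]) (use N M is_inverse_unique in blast)+
  then show ?thesis by (simp add: mat_inv_def)
qed

lemma GL_mat_space: "M \<in> GL d \<Longrightarrow> M \<in> mat_space d d" "M \<in> GL d \<Longrightarrow> mat_inv d M \<in> mat_space d d"
  using GL_inverse[of M d] by (auto simp: GL_def is_inverse_def)

lemma GL_apply_inverse:
  assumes "M \<in> GL d" "u \<in> cspace d"
  shows "mat_apply d M (mat_apply d (mat_inv d M) u) = u" "mat_apply d (mat_inv d M) (mat_apply d M u) = u"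
  using GL_inverse[OF assms(1)] assms(2) unfolding is_inverse_def
  by (simp_all add: mat_id_apply flip: mat_mult_apply)

lemma GL_inv: "M \<in> GL d \<Longrightarrow> mat_inv d M \<in> GL d"
  using GL_inverse[of M d] GL_mat_space[of M d] by (auto simp: GL_def is_inverse_def)

lemma GL_I:
  assumes "M \<in> mat_space d d" "N \<in> mat_space d d"
    and "\<And>u. u \<in> cspace d \<Longrightarrow> mat_apply d M (mat_apply d N u) = u"
    and "\<And>u. u \<in> cspace d \<Longrightarrow> mat_apply d N (mat_apply d M u) = u"
  shows "M \<in> GL d" "mat_inv d M = N"
proof -
  have "mat_mult d M N = mat_id d" "mat_mult d N M = mat_id d"
    by (rule mat_eqI[where d = d and r = d];
      simp add: assms mat_mult_in_mat_space mat_id_in_mat_space mat_mult_apply mat_id_apply)+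
  then have inv: "is_inverse d M N" using assms(2) by (simp add: is_inverse_def)
  then show M: "M \<in> GL d" using assms(1) by (auto simp: GL_def)
  show "mat_inv d M = N"
    by (rule is_inverse_unique[OF assms(1) GL_inverse[OF M] inv])
qed

lemma GL_bij_betw: "M \<in> GL d \<Longrightarrow> bij_betw (mat_apply d M) (cspace d) (cspace d)"
  by (rule bij_betw_byWitness[where f' = "mat_apply d (mat_inv d M)"])
    (auto simp: GL_apply_inverse GL_mat_space mat_apply_cspace)

lemma GL_bijI:
  assumes M: "M \<in> mat_space d d" and bij: "bij_betw (mat_apply d M) (cspace d) (cspace d)"
  shows "M \<in> GL d"
proof -
  let ?f = "mat_apply d M"
  define g where "g = inv_into (cspace d) ?f"
  have inj: "inj_on ?f (cspace d)" using bij by (simp add: bij_betw_def)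
  have g: "g u \<in> cspace d" "?f (g u) = u" if "u \<in> cspace d" for u
    using bij that by (auto simp: g_def bij_betw_def inv_into_into f_inv_into_f)
  have gf: "g (?f u) = u" if "u \<in> cspace d" for u
    using inj that by (simp add: g_def)
  note closed = cfun.subspace_add[OF subspace_cspace] cfun.subspace_scale[OF subspace_cspace]
  have "mat_apply d (matrix_of d d g) u = g u" if "u \<in> cspace d" for u
  proof (rule mat_apply_matrix_of)
    fix u v assume uv: "u \<in> cspace d" "v \<in> cspace d"
    have "g (u + v) = g (?f (g u + g v))" using uv g by (simp add: mat_apply_linear)
    then show "g (u + v) = g u + g v" using uv g gf closed by simp
  next
    fix c u assume u: "u \<in> cspace d"
    have "g (cscale c u) = g (?f (cscale c (g u)))" using u g by (simp add: mat_apply_linear)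
    then show "g (cscale c u) = cscale c (g u)" using u g gf closed by simp
  qed (use g that in auto)
  then show ?thesis
    using GL_I(1)[OF M matrix_of_in_mat_space[of d d g]] g gf mat_apply_cspace[OF M] by simp
qed

lemma mat_id_GL: "mat_id d \<in> GL d"
  by (rule GL_I(1)[OF mat_id_in_mat_space mat_id_in_mat_space]) (simp_all add: mat_id_apply)

lemma GL_mult:
  assumes "M \<in> GL d" "N \<in> GL d"
  shows "mat_mult d M N \<in> GL d" "mat_inv d (mat_mult d M N) = mat_mult d (mat_inv d N) (mat_inv d M)"
proof -
  note m = assms[THEN GL_mat_space(1)] assms[THEN GL_mat_space(2)]
  have *: "u \<in> cspace d \<Longrightarrow> mat_apply d (mat_mult d M N) (mat_apply d (mat_mult d (mat_inv d N) (mat_inv d M)) u) = u"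
    "u \<in> cspace d \<Longrightarrow> mat_apply d (mat_mult d (mat_inv d N) (mat_inv d M)) (mat_apply d (mat_mult d M N) u) = u" for u
    using assms m by (simp_all add: mat_mult_apply GL_apply_inverse mat_apply_cspace)
  show "mat_mult d M N \<in> GL d" "mat_inv d (mat_mult d M N) = mat_mult d (mat_inv d N) (mat_inv d M)"
    using GL_I[OF mat_mult_in_mat_space[OF m(1,2)] mat_mult_in_mat_space[OF m(4,3)]] * by simp_all
qed

text \<open>A nilpotent Jordan block has only the members of the standard flag as invariant subspaces. A vector
  whose last nonzero entry is at a maximal position \<open>m - 1\<close> has shifts with last entry at each smaller
  position, and these form a triangular system spanning \<open>cspace m\<close>.\<close>

lemma shift_invariant_subspace:
  assumes sub: "cfun.subspace S" and bound: "S \<subseteq> cspace N"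
    and shift: "\<And>u. u \<in> S \<Longrightarrow> (\<lambda>k. u (Suc k)) \<in> S"
  shows "\<exists>m. S = cspace m"
proof -
  define m where "m = (LEAST m. S \<subseteq> cspace m)"
  have m: "S \<subseteq> cspace m" unfolding m_def by (rule LeastI[of _ N]) (rule bound)
  have "cspace i \<subseteq> S" if "i \<le> m" for i
    using that
  proof (induction i)
    case 0
    then show ?case using cfun.subspace_0[OF sub] by simp
  next
    case (Suc i)
    have "\<not> S \<subseteq> cspace (m - 1)"
      using not_less_Least[of "m - 1" "\<lambda>m. S \<subseteq> cspace m"] Suc.prems by (simp add: m_def[symmetric])
    then obtain u where u: "u \<in> S" "u \<notin> cspace (m - 1)" by blast
    have "u (m - 1) \<noteq> 0"
    proof
      assume "u (m - 1) = 0"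
      then have "u k = 0" if "k \<ge> m - 1" for k
        using that m u(1) by (cases "k = m - 1") (auto simp: cspace_def)
      then show False using u(2) by (simp add: cspace_def)
    qed
    have shifts: "(\<lambda>k. u (k + j)) \<in> S" for j
    proof (induction j)
      case (Suc j)
      from shift[OF this] show ?case by simp
    qed (simp add: u)
    let ?w = "\<lambda>k. u (k + (m - 1 - i))"
    have w: "?w \<in> S" by (rule shifts)
    have wi: "?w i \<noteq> 0" using \<open>u (m - 1) \<noteq> 0\<close> Suc.prems by simp
    have w0: "?w k = 0" if "k > i" for k
      using that m u(1) Suc.prems by (auto simp: cspace_def)
    show ?case
    proof
      fix z assume z: "z \<in> cspace (Suc i)"
      let ?c = "z i / ?w i"
      have "z - cscale ?c ?w \<in> cspace i"
        unfolding cspace_def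
      proof (intro CollectI allI impI)
        fix k assume "i \<le> k"
        then show "(z - cscale ?c ?w) k = 0"
          using z wi w0[of k] by (cases "k = i") (simp_all add: cspace_def cscale_def minus_apply)
      qed
      then have "z - cscale ?c ?w \<in> S" using Suc by auto
      then have "(z - cscale ?c ?w) + cscale ?c ?w \<in> S"
        by (intro cfun.subspace_add[OF sub] cfun.subspace_scale[OF sub] w)
      then show "z \<in> S" by simp
    qed
  qed
  then show ?thesis using m by blast
qed

section \<open>The coordinate module and its submodules\<close>

text \<open>The coordinate module for the end vertex \<open>\<tau>\<close>, into which the stable points are embedded
  below. It has coordinates arranged in rows \<open>\<rho> = 0, 1, \<dots>\<close>. The vertices \<open>1, \<dots>, n - 2\<close> have one
  coordinate in every row; of the two end vertices, \<open>\<tau>\<close> has one in the even rows and the other one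
  in the odd rows. The coordinate with number \<open>k\<close> at the vertex \<open>r\<close> lies in the row
  \<open>row_index n \<tau> r k\<close>, and \<open>spread\<close> indexes a vector by rows, with zeros in the rows where \<open>r\<close> has
  no coordinate. The arrows of the orientation stay in their row, the reversed ones lead from each
  row to the preceding one.\<close>

definition row_index :: "nat \<Rightarrow> nat \<Rightarrow> nat \<Rightarrow> nat \<Rightarrow> nat" where
  "row_index n \<tau> r k = (if r = n - 1 \<or> r = n then if r = \<tau> then 2 * k else 2 * k + 1 else k)"

definition spread :: "nat \<Rightarrow> nat \<Rightarrow> nat \<Rightarrow> cvec \<Rightarrow> cvec" where
  "spread n \<tau> r z \<rho> = (if r = n - 1 \<or> r = n
     then if even \<rho> \<longleftrightarrow> r = \<tau> then z (\<rho> div 2) else 0 else z \<rho>)"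

definition row_shift :: "nat \<Rightarrow> arrow \<Rightarrow> nat" where
  "row_shift n h = (if h \<in> orientation n then 0 else 1)"

definition coord_op :: "nat \<Rightarrow> nat \<Rightarrow> arrow \<Rightarrow> cvec \<Rightarrow> cvec" where
  "coord_op n \<tau> h z = (\<lambda>k. spread n \<tau> (fst h) z (row_index n \<tau> (snd h) k + row_shift n h))"

text \<open>The restriction of the operators \<open>coord_op\<close> to the first \<open>v r\<close> coordinates at each vertex
  \<open>r\<close>; the chosen coordinates span a submodule if \<open>v\<close> is \<open>admissible\<close>.\<close>

definition std_x :: "nat \<Rightarrow> nat \<Rightarrow> dimv \<Rightarrow> edge_maps" where
  "std_x n \<tau> v = (\<lambda>h i k. if h \<in> arrows n \<and> i < v (snd h) \<and> k < v (fst h) \<and>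
     row_index n \<tau> (fst h) k = row_index n \<tau> (snd h) i + row_shift n h then 1 else 0)"

definition std_j :: "nat \<Rightarrow> dimv \<Rightarrow> vertex_maps" where
  "std_j \<tau> v = (\<lambda>r i k. if r = \<tau> \<and> i = 0 \<and> k = 0 \<and> 0 < v \<tau> then 1 else 0)"

text \<open>The dimension vectors \<open>v\<close> for which the spaces \<open>cspace (v r)\<close> are preserved by the operators
  \<open>coord_op\<close>: an arrow maps a unit vector to a unit vector or to zero, and the image must again be
  among the chosen ones. The condition at vertex 1 stands for the relation there, which cuts the
  coordinates at this vertex down to a single one.\<close>

definition admissible :: "nat \<Rightarrow> nat \<Rightarrow> dimv \<Rightarrow> bool" where
  "admissible n \<tau> v \<longleftrightarrow> v \<in> dim_vectors n \<and> v 1 \<le> 1 \<and>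
     (\<forall>h\<in>arrows n. \<forall>k<v (fst h). \<forall>i.
        row_index n \<tau> (fst h) k = row_index n \<tau> (snd h) i + row_shift n h \<longrightarrow> i < v (snd h))"

lemma orientation_iff:
  "(a, b) \<in> orientation n \<longleftrightarrow> (b = a + 1 \<and> 1 \<le> a \<and> a \<le> n - 2) \<or> (a = n - 2 \<and> b = n)"
  by (auto simp: orientation_def)

lemma arrows_iff: "(a, b) \<in> arrows n \<longleftrightarrow> (a, b) \<in> orientation n \<or> (b, a) \<in> orientation n"
  by (auto simp: arrows_def)

lemma spread_row_index [simp]: "spread n \<tau> r z (row_index n \<tau> r k) = z k"
  by (auto simp: spread_def row_index_def)

lemma spread_nonzero:
  assumes "spread n \<tau> r z \<rho> \<noteq> 0"
  obtains k where "\<rho> = row_index n \<tau> r k" "z k \<noteq> 0"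
proof -
  have "\<exists>k. \<rho> = row_index n \<tau> r k \<and> z k \<noteq> 0"
    using assms unfolding spread_def row_index_def
    by (cases "r = n - 1 \<or> r = n"; cases "r = \<tau>"; cases "even \<rho>") (auto elim!: evenE oddE)
  then show ?thesis using that by blast
qed

lemma row_index_inj [simp]: "row_index n \<tau> r k = row_index n \<tau> r l \<longleftrightarrow> k = l"
  by (simp add: row_index_def)

lemma spread_linear:
  "spread n \<tau> r (y + z) = spread n \<tau> r y + spread n \<tau> r z"
  "spread n \<tau> r (cscale c z) = cscale c (spread n \<tau> r z)"
  "spread n \<tau> r 0 = 0"
  by (auto simp: spread_def fun_simps)

lemma coord_op_linear:
  "coord_op n \<tau> h (y + z) = coord_op n \<tau> h y + coord_op n \<tau> h z"
  "coord_op n \<tau> h (cscale c z) = cscale c (coord_op n \<tau> h z)"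
  "coord_op n \<tau> h 0 = 0"
  by (simp_all add: coord_op_def spread_linear) (simp_all add: fun_simps)

locale type_D =
  fixes n \<tau> :: nat
  assumes n4: "4 \<le> n" and tau: "\<tau> = n - 1 \<or> \<tau> = n"
begin

abbreviation row where "row \<equiv> row_index n \<tau>"
abbreviation opr where "opr \<equiv> coord_op n \<tau>"

lemma arrow_cases [consumes 1, case_names up down end_up end_down]:
  assumes "h \<in> arrows n"
  obtains r where "h = (r, Suc r)" "1 \<le> r" "Suc r \<le> n - 2" "row_shift n h = 0"
  | r where "h = (Suc r, r)" "1 \<le> r" "Suc r \<le> n - 2" "row_shift n h = 1"
  | r where "h = (n - 2, r)" "r = n - 1 \<or> r = n" "row_shift n h = 0"
  | r where "h = (r, n - 2)" "r = n - 1 \<or> r = n" "row_shift n h = 1"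
proof (cases h)
  case (Pair a b)
  have n12: "Suc (n - 2) = n - 1" using n4 by simp
  show ?thesis
  proof (cases "(a, b) \<in> orientation n")
    case True
    then have "row_shift n h = 0" by (simp add: Pair row_shift_def)
    moreover have "(b = Suc a \<and> 1 \<le> a \<and> Suc a \<le> n - 2) \<or> (a = n - 2 \<and> (b = n - 1 \<or> b = n))"
      using True n12 unfolding orientation_iff by (cases "a = n - 2") auto
    ultimately show ?thesis using that(1)[of a] that(3)[of b] Pair by blast
  next
    case False
    then have "row_shift n h = 1" by (simp add: Pair row_shift_def)
    moreover have "(b, a) \<in> orientation n" using False assms Pair by (simp add: arrows_iff)
    then have "(a = Suc b \<and> 1 \<le> b \<and> Suc b \<le> n - 2) \<or> (b = n - 2 \<and> (a = n - 1 \<or> a = n))"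
      using n12 unfolding orientation_iff by (cases "b = n - 2") auto
    ultimately show ?thesis using that(2)[of b] that(4)[of a] Pair by blast
  qed
qed

lemma orientation_mem:
  "1 \<le> r \<Longrightarrow> Suc r \<le> n - 2 \<Longrightarrow> (r, Suc r) \<in> orientation n"
  "1 \<le> r \<Longrightarrow> Suc r \<le> n - 2 \<Longrightarrow> (Suc r, r) \<notin> orientation n"
  "r = n - 1 \<or> r = n \<Longrightarrow> (n - 2, r) \<in> orientation n"
  "r = n - 1 \<or> r = n \<Longrightarrow> (r, n - 2) \<notin> orientation n"
  unfolding orientation_iff using n4 by presburger+

lemma arrows_mem:
  "1 \<le> r \<Longrightarrow> Suc r \<le> n - 2 \<Longrightarrow> (r, Suc r) \<in> arrows n"
  "1 \<le> r \<Longrightarrow> Suc r \<le> n - 2 \<Longrightarrow> (Suc r, r) \<in> arrows n"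
  "r = n - 1 \<or> r = n \<Longrightarrow> (n - 2, r) \<in> arrows n"
  "r = n - 1 \<or> r = n \<Longrightarrow> (r, n - 2) \<in> arrows n"
  unfolding arrows_iff using orientation_mem by blast+

lemma row_shift_simps:
  "1 \<le> r \<Longrightarrow> Suc r \<le> n - 2 \<Longrightarrow> row_shift n (r, Suc r) = 0"
  "1 \<le> r \<Longrightarrow> Suc r \<le> n - 2 \<Longrightarrow> row_shift n (Suc r, r) = 1"
  "r = n - 1 \<or> r = n \<Longrightarrow> row_shift n (n - 2, r) = 0"
  "r = n - 1 \<or> r = n \<Longrightarrow> row_shift n (r, n - 2) = 1"
  unfolding row_shift_def using orientation_mem by simp_all

lemma row_plain: "r \<le> n - 2 \<Longrightarrow> row r k = k"
  using n4 by (auto simp: row_index_def)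

lemma row_end: "r = n - 1 \<or> r = n \<Longrightarrow> row r k = (if r = \<tau> then 2 * k else 2 * k + 1)"
  by (auto simp: row_index_def)

lemma spread_plain: "r \<le> n - 2 \<Longrightarrow> spread n \<tau> r z = z"
  using n4 by (auto simp: spread_def fun_eq_iff)

lemma opr_plain:
  "1 \<le> r \<Longrightarrow> Suc r \<le> n - 2 \<Longrightarrow> opr (r, Suc r) z = z"
  "1 \<le> r \<Longrightarrow> Suc r \<le> n - 2 \<Longrightarrow> opr (Suc r, r) z = (\<lambda>k. z (Suc k))"
  "r = n - 1 \<or> r = n \<Longrightarrow> opr (n - 2, r) z = (\<lambda>k. z (row r k))"
  "r = n - 1 \<or> r = n \<Longrightarrow> opr (r, n - 2) z = (\<lambda>k. spread n \<tau> r z (Suc k))"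
  by (simp_all add: coord_op_def row_shift_simps row_plain spread_plain)

text \<open>Going towards vertex 1 and back loses one row.\<close>

lemma opr_round_trip:
  assumes "1 \<le> r" "Suc r \<le> n - 2"
  shows "opr (r, Suc r) (opr (Suc r, r) z) = (\<lambda>k. z (Suc k))"
  by (simp add: opr_plain(1,2)[OF assms])

text \<open>An end vertex has coordinates in every second row, so a round trip that loses two rows is a
  Jordan block again.\<close>

lemma opr_end_round_trip:
  assumes r: "r = n - 1 \<or> r = n"
  shows "opr (n - 2, r) (opr (n - 3, n - 2) (opr (n - 2, n - 3) (opr (r, n - 2) z))) = (\<lambda>k. z (Suc k))"
proof -
  have "n - 2 = Suc (n - 3)" "1 \<le> n - 3" using n4 by simp_all
  then have mid: "opr (n - 3, n - 2) (opr (n - 2, n - 3) y) = (\<lambda>k. y (Suc k))" for y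
    using opr_round_trip[of "n - 3"] by simp
  have "Suc (Suc (row r k)) = row r (Suc k)" for k
    by (simp add: row_end[OF r])
  then have "spread n \<tau> r z (Suc (Suc (row r k))) = z (Suc k)" for k
    by (simp only: spread_row_index)
  then show ?thesis
    by (simp only: mid opr_plain(3,4)[OF r])
qed

text \<open>Each component is invariant under a round trip, hence a member of the standard flag. At
  vertex 1 there is no round trip, but there the dimension is at most 1.\<close>

lemma stable_family_standard:
  assumes sub: "\<And>r. cfun.subspace (S r)" and bound: "\<And>r. S r \<subseteq> cspace N"
    and first: "S 1 \<subseteq> cspace 1" and outside: "\<And>r. r \<notin> {1..n} \<Longrightarrow> S r = {0}"
    and stable: "\<And>h z. h \<in> arrows n \<Longrightarrow> z \<in> S (fst h) \<Longrightarrow> opr h z \<in> S (snd h)"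
  shows "\<exists>d. (\<forall>r. S r = cspace (d r)) \<and> admissible n \<tau> d"
proof -
  have "\<exists>m. S r = cspace m" for r
  proof (rule shift_invariant_subspace[OF sub bound])
    fix z assume z: "z \<in> S r"
    consider "r \<notin> {1..n}" | "r = 1" | "2 \<le> r" "r \<le> n - 2" | "r = n - 1 \<or> r = n"
      unfolding atLeastAtMost_iff by linarith
    then show "(\<lambda>k. z (Suc k)) \<in> S r"
    proof cases
      case 1
      then have "(\<lambda>k. z (Suc k)) = 0" using outside z by (auto simp: fun_simps)
      then show ?thesis using cfun.subspace_0[OF sub] by simp
    next
      case 2
      then have "(\<lambda>k. z (Suc k)) = 0" using first z by (auto simp: fun_simps cspace_def)
      then show ?thesis using cfun.subspace_0[OF sub] by simp
    next
      case 3
      define q where "q = r - 1"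
      have q: "r = Suc q" "1 \<le> q" "Suc q \<le> n - 2" using 3 by (simp_all add: q_def)
      have "opr (q, Suc q) (opr (Suc q, q) z) \<in> S (Suc q)"
        using stable[OF arrows_mem(1)[OF q(2,3)]] stable[OF arrows_mem(2)[OF q(2,3)]] z q(1) by simp
      then show ?thesis using opr_round_trip[OF q(2,3)] q(1) by simp
    next
      case 4
      have a: "(n - 3, n - 2) \<in> arrows n" "(n - 2, n - 3) \<in> arrows n"
        using arrows_mem(1,2)[of "n - 3"] n4 by (simp_all add: Suc_diff_Suc numeral_3_eq_3 numeral_2_eq_2)
      have "opr (n - 2, r) (opr (n - 3, n - 2) (opr (n - 2, n - 3) (opr (r, n - 2) z))) \<in> S r"
        using stable[OF arrows_mem(3)[OF 4]] stable[OF a(1)] stable[OF a(2)] stable[OF arrows_mem(4)[OF 4]] z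
        by simp
      then show ?thesis unfolding opr_end_round_trip[OF 4] .
    qed
  qed
  then obtain d where d: "\<And>r. S r = cspace (d r)" by metis
  have "admissible n \<tau> d"
    unfolding admissible_def
  proof (intro conjI ballI allI impI)
    have "d r = 0" if "r \<notin> {1..n}" for r
    proof -
      have "cspace (d r) = cspace 0" using outside[OF that] d by simp
      then show ?thesis by (simp only: cspace_eq_iff)
    qed
    then show "d \<in> dim_vectors n" by (simp add: dim_vectors_def)
    show "d 1 \<le> 1" using first unfolding d cspace_le_iff .
    fix h k i assume h: "h \<in> arrows n" and k: "k < d (fst h)"
      and eq: "row (fst h) k = row (snd h) i + row_shift n h"
    have "opr h (unit_vec k) \<in> cspace (d (snd h))"
      using stable[OF h, of "unit_vec k"] k unfolding d by simp
    moreover have "opr h (unit_vec k) i = 1"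
      unfolding coord_op_def eq[symmetric] by (simp add: unit_vec_def)
    ultimately show "i < d (snd h)"
      by (auto simp: cspace_def not_le[symmetric])
  qed
  then show ?thesis using d by blast
qed

lemma std_x_apply:
  assumes "admissible n \<tau> v" "h \<in> arrows n" "u \<in> cspace (v (fst h))"
  shows "mat_apply (v (fst h)) (std_x n \<tau> v h) u = opr h u"
proof
  fix i
  let ?\<rho> = "row (snd h) i + row_shift n h"
  show "mat_apply (v (fst h)) (std_x n \<tau> v h) u i = opr h u i"
  proof (cases "\<exists>k<v (fst h). row (fst h) k = ?\<rho>")
    case True
    then obtain k where k: "k < v (fst h)" "row (fst h) k = ?\<rho>" by blast
    then have i: "i < v (snd h)" using assms(1,2) unfolding admissible_def by blast
    have "mat_apply (v (fst h)) (std_x n \<tau> v h) u i = (\<Sum>l<v (fst h). if l = k then u l else 0)"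
      unfolding mat_apply_def std_x_def using assms(2) i
      by (intro sum.cong) (auto simp: k(2)[symmetric])
    then show ?thesis
      using k by (simp add: coord_op_def flip: k(2))
  next
    case False
    have "opr h u i = 0"
    proof (rule ccontr)
      assume "opr h u i \<noteq> 0"
      then obtain k where "?\<rho> = row (fst h) k" "u k \<noteq> 0"
        unfolding coord_op_def by (rule spread_nonzero)
      then show False
        using False assms(3) by (metis (mono_tags, lifting) cspace_def mem_Collect_eq not_less)
    qed
    moreover have "mat_apply (v (fst h)) (std_x n \<tau> v h) u i = 0"
      unfolding mat_apply_def std_x_def using False by (intro sum.neutral) auto
    ultimately show ?thesis by simp
  qed
qed

lemma std_x_E_space: "std_x n \<tau> v \<in> E_space n v"
  by (auto simp: E_space_def std_x_def mat_space_def fun_eq_iff)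

lemma std_j_J_space: "std_j \<tau> v \<in> J_space v (unit_dim \<tau>)"
  by (auto simp: J_space_def std_j_def mat_space_def unit_dim_def)

lemma std_stable_subspace:
  assumes v: "admissible n \<tau> v" and S: "graded_subspace v S" "stable_under n v (std_x n \<tau> v) S"
  shows "\<exists>d. (\<forall>r. S r = cspace (d r)) \<and> admissible n \<tau> d \<and> (\<forall>r. d r \<le> v r)"
proof -
  have sub: "cfun.subspace (S r)" and le: "S r \<subseteq> cspace (v r)" for r
    using S(1) by (auto simp: graded_subspace_def)
  have v0: "v r = 0" if "r \<notin> {1..n}" for r
    using v that by (auto simp: admissible_def dim_vectors_def)
  define N where "N = Max (v ` {0..n})"
  have "v r \<le> N" for r
  proof (cases "r \<in> {0..n}")
    case True
    then show ?thesis unfolding N_def by (intro Max_ge) auto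
  qed (simp add: v0)
  then have bound: "S r \<subseteq> cspace N" for r
    using le cspace_mono by blast
  have "\<exists>d. (\<forall>r. S r = cspace (d r)) \<and> admissible n \<tau> d"
  proof (rule stable_family_standard[OF sub bound])
    show "S 1 \<subseteq> cspace 1"
      using le[of 1] v cspace_mono[of "v 1" 1] by (auto simp: admissible_def)
    show "S r = {0}" if "r \<notin> {1..n}" for r
      using le[of r] v0[OF that] cfun.subspace_0[OF sub, of r] by auto
    fix h z assume h: "h \<in> arrows n" and z: "z \<in> S (fst h)"
    then have "mat_apply (v (fst h)) (std_x n \<tau> v h) z \<in> S (snd h)"
      using S(2) by (auto simp: stable_under_def)
    then show "opr h z \<in> S (snd h)"
      using std_x_apply[OF v h, of z] le[of "fst h"] z by auto
  qed
  then show ?thesis using le by (metis cspace_le_iff)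
qed

text \<open>The simple module at \<open>\<tau>\<close>, spanned by the first coordinate there, lies in every nonzero
  submodule: from the first coordinate at any vertex an arrow leads to the first coordinate at a
  vertex nearer to \<open>\<tau>\<close>.\<close>

lemma admissible_zero:
  assumes v: "admissible n \<tau> v" and 0: "v \<tau> = 0"
  shows "v r = 0"
proof -
  have adm: "i < v (snd h)" if "h \<in> arrows n" "k < v (fst h)"
    "row (fst h) k = row (snd h) i + row_shift n h" for h k i
    using v that unfolding admissible_def by blast
  have mid: "v (n - 2) = 0"
  proof (rule ccontr)
    assume "v (n - 2) \<noteq> 0"
    then have "0 < v \<tau>"
      using adm[OF arrows_mem(3)[OF tau], of 0 0]
      by (simp add: row_shift_simps(3)[OF tau] row_plain row_end[OF tau])
    then show False using 0 by simp
  qed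
  have up: "v r = 0" if "1 \<le> r" "r \<le> n - 2" for r
    using that(2,1)
  proof (induction rule: inc_induct)
    case (step q)
    then have q: "1 \<le> q" "Suc q \<le> n - 2" "v (Suc q) = 0" by simp_all
    show ?case
    proof (rule ccontr)
      assume "v q \<noteq> 0"
      then have "0 < v (Suc q)"
        using adm[OF arrows_mem(1)[OF q(1,2)], of 0 0] q(1,2)
        by (simp add: row_shift_simps(1)[OF q(1,2)] row_plain)
      then show False using q(3) by simp
    qed
  qed (simp add: mid)
  have ends: "v r = 0" if r: "r = n - 1 \<or> r = n" for r
  proof (cases "r = \<tau>")
    case False
    show ?thesis
    proof (rule ccontr)
      assume "v r \<noteq> 0"
      then have "0 < v (n - 2)"
        using adm[OF arrows_mem(4)[OF r], of 0 0] False r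
        by (simp add: row_shift_simps(4)[OF r] row_plain row_end[OF r])
      then show False using mid by simp
    qed
  qed (simp add: 0)
  consider "r \<notin> {1..n}" | "1 \<le> r" "r \<le> n - 2" | "r = n - 1 \<or> r = n"
    unfolding atLeastAtMost_iff by linarith
  then show "v r = 0"
  proof cases
    case 1
    then show ?thesis using v by (auto simp: admissible_def dim_vectors_def)
  next
    case 2
    then show ?thesis by (rule up)
  qed (rule ends)
qed

end

section \<open>Stable representations embed into the coordinate module\<close>

text \<open>A position is given by a row \<open>\<rho>\<close> and the distance \<open>d\<close> from the end vertices; \<open>vertex\<close> is the
  vertex there. The functional \<open>coord\<close> is \<open>J\<close> after the path from this position that follows the
  row to its end vertex, steps down to the vertex \<open>n - 2\<close> in the preceding row, and so on until
  the vertex \<open>\<tau>\<close> in row 0.\<close>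

definition vertex :: "nat \<Rightarrow> nat \<Rightarrow> nat \<Rightarrow> nat \<Rightarrow> nat" where
  "vertex n \<tau> \<rho> d = (if d = 0 then if even \<rho> then \<tau> else 2 * n - 1 - \<tau> else n - 1 - d)"

definition depth :: "nat \<Rightarrow> nat \<Rightarrow> nat" where
  "depth n r = (if r = n - 1 \<or> r = n then 0 else n - 1 - r)"

fun coord :: "nat \<Rightarrow> nat \<Rightarrow> (arrow \<Rightarrow> cvec \<Rightarrow> cvec) \<Rightarrow> (cvec \<Rightarrow> complex) \<Rightarrow> nat \<Rightarrow> nat \<Rightarrow> cvec \<Rightarrow> complex" where
  "coord n \<tau> X J 0 0 u = J u"
| "coord n \<tau> X J (Suc \<rho>) 0 u = coord n \<tau> X J \<rho> 1 (X (vertex n \<tau> (Suc \<rho>) 0, n - 2) u)"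
| "coord n \<tau> X J \<rho> (Suc d) u = coord n \<tau> X J \<rho> d (X (vertex n \<tau> \<rho> (Suc d), vertex n \<tau> \<rho> d) u)"

context type_D
begin

lemma arrows_into:
  "{h. h \<in> arrows n \<and> snd h = 1} = {(2, 1)}"
  "1 \<le> q \<Longrightarrow> Suc (Suc q) \<le> n - 2 \<Longrightarrow>
    {h. h \<in> arrows n \<and> snd h = Suc q} = {(q, Suc q), (Suc (Suc q), Suc q)}"
  "{h. h \<in> arrows n \<and> snd h = n - 2} = {(n - 3, n - 2), (n - 1, n - 2), (n, n - 2)}"
  "r = n - 1 \<or> r = n \<Longrightarrow> {h. h \<in> arrows n \<and> snd h = r} = {(n - 2, r)}"
proof -
  show "{h. h \<in> arrows n \<and> snd h = 1} = {(2, 1)}"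
  proof (intro equalityI subsetI)
    fix h assume "h \<in> {h. h \<in> arrows n \<and> snd h = 1}"
    then have h: "h \<in> arrows n" "snd h = 1" by simp_all
    show "h \<in> {(2, 1)}" using h(1) by (cases rule: arrow_cases) (use h(2) n4 in auto)
  next
    fix h :: arrow assume "h \<in> {(2, 1)}"
    then show "h \<in> {h. h \<in> arrows n \<and> snd h = 1}" using arrows_mem(2)[of 1] n4 by (simp add: numeral_2_eq_2)
  qed
  show "{h. h \<in> arrows n \<and> snd h = Suc q} = {(q, Suc q), (Suc (Suc q), Suc q)}"
    if q: "1 \<le> q" "Suc (Suc q) \<le> n - 2"
  proof (intro equalityI subsetI)
    fix h assume "h \<in> {h. h \<in> arrows n \<and> snd h = Suc q}"
    then have h: "h \<in> arrows n" "snd h = Suc q" by simp_all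
    show "h \<in> {(q, Suc q), (Suc (Suc q), Suc q)}"
      using h(1) by (cases rule: arrow_cases) (use h(2) q n4 in auto)
  next
    fix h :: arrow assume "h \<in> {(q, Suc q), (Suc (Suc q), Suc q)}"
    then show "h \<in> {h. h \<in> arrows n \<and> snd h = Suc q}"
      using arrows_mem(2)[of "Suc q"] arrows_mem(1)[of q] q by auto
  qed
  show "{h. h \<in> arrows n \<and> snd h = n - 2} = {(n - 3, n - 2), (n - 1, n - 2), (n, n - 2)}"
  proof (intro equalityI subsetI)
    fix h assume "h \<in> {h. h \<in> arrows n \<and> snd h = n - 2}"
    then have h: "h \<in> arrows n" "snd h = n - 2" by simp_all
    show "h \<in> {(n - 3, n - 2), (n - 1, n - 2), (n, n - 2)}"
      using h(1) by (cases rule: arrow_cases) (use h(2) n4 in auto)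
  next
    have "Suc (n - 3) = n - 2" "1 \<le> n - 3" using n4 by simp_all
    then have "(n - 3, n - 2) \<in> arrows n" using arrows_mem(1)[of "n - 3"] by simp
    moreover fix h :: arrow assume "h \<in> {(n - 3, n - 2), (n - 1, n - 2), (n, n - 2)}"
    ultimately show "h \<in> {h. h \<in> arrows n \<and> snd h = n - 2}"
      using arrows_mem(4) by auto
  qed
  show "{h. h \<in> arrows n \<and> snd h = r} = {(n - 2, r)}" if r: "r = n - 1 \<or> r = n"
  proof (intro equalityI subsetI)
    fix h assume "h \<in> {h. h \<in> arrows n \<and> snd h = r}"
    then have h: "h \<in> arrows n" "snd h = r" by simp_all
    show "h \<in> {(n - 2, r)}" using h(1) by (cases rule: arrow_cases) (use h(2) r n4 in auto)
  next
    fix h :: arrow assume "h \<in> {(n - 2, r)}"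
    then show "h \<in> {h. h \<in> arrows n \<and> snd h = r}" using arrows_mem(3)[OF r] by simp
  qed
qed

lemma eps_simps:
  "1 \<le> r \<Longrightarrow> Suc r \<le> n - 2 \<Longrightarrow> eps n (r, Suc r) = 1"
  "1 \<le> r \<Longrightarrow> Suc r \<le> n - 2 \<Longrightarrow> eps n (Suc r, r) = - 1"
  "r = n - 1 \<or> r = n \<Longrightarrow> eps n (n - 2, r) = 1"
  "r = n - 1 \<or> r = n \<Longrightarrow> eps n (r, n - 2) = - 1"
  unfolding eps_def using orientation_mem by simp_all

text \<open>The sums that occur in the preprojective relations, written out with their signs at the four
  kinds of vertices.\<close>

lemma relation_sums:
  fixes F :: "arrow \<Rightarrow> complex"
  shows "(\<Sum>h | h \<in> arrows n \<and> snd h = 1. eps n h * F h) = - F (2, 1)"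
    and "1 \<le> q \<Longrightarrow> Suc (Suc q) \<le> n - 2 \<Longrightarrow>
      (\<Sum>h | h \<in> arrows n \<and> snd h = Suc q. eps n h * F h) = F (q, Suc q) - F (Suc (Suc q), Suc q)"
    and "(\<Sum>h | h \<in> arrows n \<and> snd h = n - 2. eps n h * F h) =
      F (n - 3, n - 2) - F (n - 1, n - 2) - F (n, n - 2)"
    and "r = n - 1 \<or> r = n \<Longrightarrow> (\<Sum>h | h \<in> arrows n \<and> snd h = r. eps n h * F h) = F (n - 2, r)"
proof -
  show "(\<Sum>h | h \<in> arrows n \<and> snd h = 1. eps n h * F h) = - F (2, 1)"
    unfolding arrows_into using eps_simps(2)[of 1] n4 by (simp add: numeral_2_eq_2)
  show "1 \<le> q \<Longrightarrow> Suc (Suc q) \<le> n - 2 \<Longrightarrow>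
      (\<Sum>h | h \<in> arrows n \<and> snd h = Suc q. eps n h * F h) = F (q, Suc q) - F (Suc (Suc q), Suc q)"
    using arrows_into(2)[of q] eps_simps(1)[of q] eps_simps(2)[of "Suc q"] by simp
  have "Suc (n - 3) = n - 2" "1 \<le> n - 3" using n4 by simp_all
  then have "eps n (n - 3, n - 2) = 1" using eps_simps(1)[of "n - 3"] by simp
  moreover have "eps n (n - 1, n - 2) = - 1" "eps n (n, n - 2) = - 1" by (simp_all add: eps_simps)
  moreover have "n - 1 \<noteq> n - 3" "n \<noteq> n - 3" "n - 1 \<noteq> n" using n4 by simp_all
  ultimately show "(\<Sum>h | h \<in> arrows n \<and> snd h = n - 2. eps n h * F h) =
      F (n - 3, n - 2) - F (n - 1, n - 2) - F (n, n - 2)"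
    unfolding arrows_into(3) by simp
  show "r = n - 1 \<or> r = n \<Longrightarrow> (\<Sum>h | h \<in> arrows n \<and> snd h = r. eps n h * F h) = F (n - 2, r)"
    using arrows_into(4)[of r] eps_simps(3)[of r] by simp
qed

lemma vertex_0: "vertex n \<tau> \<rho> 0 = n - 1 \<or> vertex n \<tau> \<rho> 0 = n"
  using tau n4 by (auto simp: vertex_def)

lemma vertex_0_Suc: "{vertex n \<tau> \<rho> 0, vertex n \<tau> (Suc \<rho>) 0} = {n - 1, n}"
  using tau n4 by (auto simp: vertex_def)

lemma vertex_Suc: "vertex n \<tau> \<rho> (Suc d) = n - 2 - d"
  by (simp add: vertex_def)

lemma vertex_row: "r \<in> {1..n} \<Longrightarrow> vertex n \<tau> (row r k) (depth n r) = r"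
proof -
  assume "r \<in> {1..n}"
  then consider "r = n - 1 \<or> r = n" | "1 \<le> r" "r \<le> n - 2" unfolding atLeastAtMost_iff by linarith
  then show ?thesis
  proof cases
    case 1
    then show ?thesis using tau n4 by (auto simp: vertex_def depth_def row_end)
  next
    case 2
    then show ?thesis using n4 by (auto simp: vertex_def depth_def)
  qed
qed

end

text \<open>The preprojective relations in the form of identities of operators, without reference to
  matrices.\<close>

locale preprojective = type_D +
  fixes X :: "arrow \<Rightarrow> cvec \<Rightarrow> cvec" and J :: "cvec \<Rightarrow> complex"
  assumes X_add: "X h (u + w) = X h u + X h w" and X_scale: "X h (cscale c u) = cscale c (X h u)"
    and J_add: "J (u + w) = J u + J w" and J_scale: "J (cscale c u) = c * J u"
    and rel_first: "X (2, 1) (X (1, 2) u) = 0"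
    and rel_mid: "1 \<le> q \<Longrightarrow> Suc (Suc q) \<le> n - 2 \<Longrightarrow>
      X (q, Suc q) (X (Suc q, q) u) = X (Suc (Suc q), Suc q) (X (Suc q, Suc (Suc q)) u)"
    and rel_branch: "X (n - 3, n - 2) (X (n - 2, n - 3) u) =
      X (n - 1, n - 2) (X (n - 2, n - 1) u) + X (n, n - 2) (X (n - 2, n) u)"
    and rel_end: "r = n - 1 \<or> r = n \<Longrightarrow> X (n - 2, r) (X (r, n - 2) u) = 0"
begin

abbreviation crd where "crd \<equiv> coord n \<tau> X J"
abbreviation vtx where "vtx \<equiv> vertex n \<tau>"

lemma crd_linear:
  "crd \<rho> d (u + w) = crd \<rho> d u + crd \<rho> d w"
  "crd \<rho> d (cscale c u) = c * crd \<rho> d u"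
proof -
  have step: "(crd \<rho> (Suc d) (u + w) = crd \<rho> (Suc d) u + crd \<rho> (Suc d) w) \<and>
      crd \<rho> (Suc d) (cscale c u) = c * crd \<rho> (Suc d) u"
    if "\<And>c u w. (crd \<rho> d (u + w) = crd \<rho> d u + crd \<rho> d w) \<and> crd \<rho> d (cscale c u) = c * crd \<rho> d u"
    for \<rho> d c u w
    using that unfolding coord.simps(3) X_add X_scale by simp
  have "(crd \<rho> d (u + w) = crd \<rho> d u + crd \<rho> d w) \<and> crd \<rho> d (cscale c u) = c * crd \<rho> d u" for \<rho> d c u w
  proof (induction \<rho> arbitrary: d c u w)
    case 0
    show ?case
    proof (induction d arbitrary: c u w)
      case (Suc d)
      then show ?case by (rule step)
    qed (simp add: J_add J_scale)
  next
    case (Suc \<rho>)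
    show ?case
    proof (induction d arbitrary: c u w)
      case 0
      show ?case using Suc.IH unfolding coord.simps(2) X_add X_scale by blast
    next
      case (Suc d)
      then show ?case by (rule step)
    qed
  qed
  then show "crd \<rho> d (u + w) = crd \<rho> d u + crd \<rho> d w" "crd \<rho> d (cscale c u) = c * crd \<rho> d u"
    by blast+
qed

lemma crd_zero [simp]: "crd \<rho> d 0 = 0"
  using crd_linear(2)[of \<rho> d 0 0] by simp

text \<open>Going from an end vertex to \<open>n - 2\<close> and back to the same end vertex is zero by the relation
  there. A row through that end vertex starts with the second of these steps.\<close>

lemma crd_dead_end: "crd \<rho> 1 (X (vtx \<rho> 0, n - 2) u) = 0"
proof -
  have "crd \<rho> 1 (X (vtx \<rho> 0, n - 2) u) = crd \<rho> 0 (X (n - 2, vtx \<rho> 0) (X (vtx \<rho> 0, n - 2) u))"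
    using vertex_Suc[of \<rho> 0] by simp
  then show ?thesis by (simp add: rel_end[OF vertex_0])
qed

text \<open>A path that starts by going away from the end vertices and then follows the row \<open>\<rho>\<close> agrees
  with the path of the row \<open>\<rho> + 1\<close>: the relations at the vertices on the way move the step away
  from the ends past the steps towards them. At the vertex \<open>n - 2\<close> the relation has one term for
  each end vertex, and the one for the end vertex of row \<open>\<rho>\<close> vanishes by \<open>crd_dead_end\<close>.\<close>

lemma crd_down:
  "d \<le> n - 3 \<Longrightarrow> crd \<rho> (Suc d) (X (vtx (Suc \<rho>) d, vtx \<rho> (Suc d)) u) = crd (Suc \<rho>) d u"
proof (induction d arbitrary: u)
  case 0
  show ?case by (simp add: vertex_Suc)
next
  case (Suc d)
  define r where "r = n - 2 - d"
  define q where "q = r - 1"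
  have r: "r = Suc q" "1 \<le> q" "Suc q \<le> n - 2" using Suc.prems n4 by (simp_all add: r_def q_def)
  have v: "vtx (Suc \<rho>) (Suc d) = Suc q" "vtx \<rho> (Suc d) = Suc q" "vtx \<rho> (Suc (Suc d)) = q"
    using r(1) by (simp_all add: vertex_Suc r_def q_def)
  have IH: "crd \<rho> (Suc d) (X (vtx (Suc \<rho>) d, Suc q) w) = crd (Suc \<rho>) d w" for w
    using Suc.IH[of w] Suc.prems by (simp add: v)
  have "crd \<rho> (Suc (Suc d)) (X (Suc q, q) u) = crd \<rho> (Suc d) (X (q, Suc q) (X (Suc q, q) u))"
    unfolding coord.simps(3)[of n \<tau> X J \<rho> "Suc d"] v ..
  also have "\<dots> = crd \<rho> (Suc d) (X (vtx (Suc \<rho>) d, Suc q) (X (Suc q, vtx (Suc \<rho>) d) u))"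
  proof (cases d)
    case 0
    let ?a = "vtx (Suc \<rho>) 0" and ?b = "vtx \<rho> 0"
    have q: "Suc q = n - 2" "q = n - 3" using 0 r by (simp_all add: r_def)
    have split: "X (n - 1, n - 2) (X (n - 2, n - 1) u) + X (n, n - 2) (X (n - 2, n) u) =
        X (?a, n - 2) (X (n - 2, ?a) u) + X (?b, n - 2) (X (n - 2, ?b) u)"
      using vertex_0_Suc[of \<rho>] by (auto simp: doubleton_eq_iff add.commute)
    have "crd \<rho> 1 (X (n - 3, n - 2) (X (n - 2, n - 3) u)) = crd \<rho> 1 (X (?a, n - 2) (X (n - 2, ?a) u))"
      unfolding rel_branch split crd_linear crd_dead_end by simp
    then show ?thesis unfolding 0 q(1) unfolding q(2) by (simp only: One_nat_def)
  next
    case (Suc e)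
    then have "Suc (Suc q) \<le> n - 2" "vtx (Suc \<rho>) d = Suc (Suc q)"
      using r by (simp_all add: r_def vertex_Suc)
    then show ?thesis using rel_mid[OF r(2)] by simp
  qed
  also have "\<dots> = crd (Suc \<rho>) d (X (Suc q, vtx (Suc \<rho>) d) u)"
    by (rule IH)
  also have "\<dots> = crd (Suc \<rho>) (Suc d) u"
    unfolding coord.simps(3)[of n \<tau> X J "Suc \<rho>" d] v ..
  finally show ?case unfolding v .
qed

text \<open>By \<open>crd_down\<close>, a coordinate in row \<open>\<rho>\<close> can be moved \<open>\<rho>\<close> steps away from the end vertices. If
  this passes vertex 1, the path contains the composition that is zero by the relation at that
  vertex.\<close>

lemma crd_vanish:
  "d \<le> n - 2 \<Longrightarrow> n - 1 - d \<le> \<rho> \<Longrightarrow> crd \<rho> d u = 0"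
proof (induction \<rho> arbitrary: d u)
  case (Suc \<rho>)
  show ?case
  proof (cases "d = n - 2")
    case True
    define e where "e = n - 3"
    have e: "n - 2 = Suc e" "1 \<le> e" "e \<le> n - 3" using n4 by (simp_all add: e_def)
    have v: "vtx (Suc \<rho>) (Suc e) = 1" "vtx (Suc \<rho>) e = 2" "vtx \<rho> (Suc e) = 1"
      using n4 by (simp_all add: vertex_def e_def)
    have "crd (Suc \<rho>) (Suc e) u = crd (Suc \<rho>) e (X (1, 2) u)"
      unfolding coord.simps(3)[of n \<tau> X J "Suc \<rho>" e] v ..
    also have "\<dots> = crd \<rho> (Suc e) (X (2, 1) (X (1, 2) u))"
      using crd_down[OF e(3), of \<rho> "X (1, 2) u"] unfolding v by simp
    finally show ?thesis unfolding True e(1) rel_first crd_zero .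
  next
    case False
    then have "d \<le> n - 3" using Suc.prems n4 by simp
    from crd_down[OF this, of \<rho> u] have "crd (Suc \<rho>) d u = crd \<rho> (Suc d) (X (vtx (Suc \<rho>) d, vtx \<rho> (Suc d)) u)"
      by simp
    also have "\<dots> = 0" using Suc.prems \<open>d \<le> n - 3\<close> n4 by (intro Suc.IH) simp_all
    finally show ?thesis .
  qed
qed (use n4 in simp)

text \<open>All coordinates of a vector, an element of the coordinate module.\<close>

definition phi :: "nat \<Rightarrow> cvec \<Rightarrow> cvec" where
  "phi r u = (\<lambda>k. crd (row r k) (depth n r) u)"

lemma phi_linear:
  "phi r (u + w) = phi r u + phi r w" "phi r (cscale c u) = cscale c (phi r u)" "phi r 0 = 0"
proof -
  show "phi r (u + w) = phi r u + phi r w"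
    by (rule ext) (simp add: phi_def plus_fun_apply crd_linear)
  show "phi r (cscale c u) = cscale c (phi r u)"
    unfolding phi_def crd_linear by (simp add: cscale_def)
  show "phi r 0 = 0"
    by (rule ext) (simp add: phi_def zero_fun_apply)
qed

lemma phi_bound:
  assumes "r \<in> {1..n}"
  shows "phi r u \<in> cspace n" "phi 1 u \<in> cspace 1"
proof -
  have "depth n r \<le> n - 2" using assms n4 by (auto simp: depth_def)
  moreover have "k \<le> row r k" for k by (simp add: row_index_def)
  ultimately show "phi r u \<in> cspace n"
    unfolding cspace_def phi_def
  proof (intro CollectI allI impI crd_vanish)
    fix k assume "n \<le> k"
    then show "n - 1 - depth n r \<le> row r k" using \<open>\<And>k. k \<le> row r k\<close>[of k] by linarith
  qed
  have "depth n 1 = n - 2" using n4 by (auto simp: depth_def)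
  then show "phi 1 u \<in> cspace 1"
    unfolding cspace_def phi_def using n4
    by (intro CollectI allI impI crd_vanish) (simp_all add: row_plain)
qed

text \<open>The coordinates form a homomorphism of modules: for an arrow that follows the rows this is
  the definition of the coordinates, for a reversed one it is \<open>crd_down\<close>, and at the end vertices
  \<open>crd_dead_end\<close> accounts for the rows that are missing there.\<close>

lemma phi_X:
  assumes "h \<in> arrows n"
  shows "phi (snd h) (X h u) = opr h (phi (fst h) u)"
  using assms
proof (cases rule: arrow_cases)
  case (up r)
  have d: "depth n (Suc r) = n - 2 - r" "depth n r = Suc (n - 2 - r)" using up by (auto simp: depth_def)
  have "vtx \<rho> (Suc (n - 2 - r)) = r" "vtx \<rho> (n - 2 - r) = Suc r" for \<rho>
    using up by (auto simp: vertex_def)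
  then have "crd \<rho> (Suc (n - 2 - r)) u = crd \<rho> (n - 2 - r) (X (r, Suc r) u)" for \<rho>
    by simp
  then show ?thesis
    using up by (simp add: opr_plain(1) phi_def d row_plain del: coord.simps)
next
  case (down r)
  have d: "depth n (Suc r) = n - 2 - r" "depth n r = Suc (n - 2 - r)" using down by (auto simp: depth_def)
  have "vtx (Suc \<rho>) (n - 2 - r) = Suc r" "vtx \<rho> (Suc (n - 2 - r)) = r" for \<rho>
    using down by (auto simp: vertex_def)
  then have "crd \<rho> (Suc (n - 2 - r)) (X (Suc r, r) u) = crd (Suc \<rho>) (n - 2 - r) u" for \<rho>
    using crd_down[of "n - 2 - r" \<rho> u] down by (simp del: coord.simps)
  then show ?thesis
    using down by (simp add: opr_plain(2) phi_def d row_plain del: coord.simps)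
next
  case (end_up r)
  have d: "depth n r = 0" "depth n (n - 2) = 1" using end_up n4 by (auto simp: depth_def)
  have "vtx (row r k) 0 = r" for k
    using vertex_row[of r k] end_up n4 d by auto
  then have "crd (row r k) 0 (X (n - 2, r) u) = crd (row r k) 1 u" for k
    using vertex_Suc[of "row r k" 0] by simp
  then show ?thesis
    using end_up by (simp add: opr_plain(3) phi_def d row_plain del: coord.simps)
next
  case (end_down r)
  have d: "depth n r = 0" "depth n (n - 2) = 1" using end_down n4 by (auto simp: depth_def)
  have "crd k 1 (X (r, n - 2) u) = spread n \<tau> r (\<lambda>k. crd (row r k) 0 u) (Suc k)" for k
  proof (cases "r = vtx (Suc k) 0")
    case True
    then have "even (Suc k) \<longleftrightarrow> r = \<tau>" using tau n4 by (auto simp: vertex_def)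
    moreover have "crd k 1 (X (r, n - 2) u) = crd (Suc k) 0 u" by (simp add: True)
    moreover have "row r (Suc k div 2) = Suc k" if "even (Suc k) \<longleftrightarrow> r = \<tau>"
      using that end_down(2) by (auto simp: row_end elim!: evenE oddE)
    ultimately show ?thesis using end_down(2) by (simp add: spread_def del: coord.simps)
  next
    case False
    then have "r = vtx k 0" using vertex_0_Suc[of k] end_down(2) by auto
    then have "crd k 1 (X (r, n - 2) u) = 0" using crd_dead_end by simp
    moreover have "\<not> (even (Suc k) \<longleftrightarrow> r = \<tau>)" using False end_down(2) tau n4 by (auto simp: vertex_def split: if_splits)
    ultimately show ?thesis using end_down(2) by (simp add: spread_def del: coord.simps)
  qed
  then show ?thesis
    using end_down by (simp add: opr_plain(4) phi_def d row_plain del: coord.simps)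
qed

lemma phi_tau: "phi \<tau> u 0 = J u"
proof -
  have "depth n \<tau> = 0" using tau by (auto simp: depth_def)
  then show ?thesis by (simp add: phi_def row_end[OF tau])
qed

end

section \<open>Classification of the stable points\<close>

context type_D
begin

lemma preprojective_relation:
  assumes "x \<in> Lambda_V n v" "i \<in> {1..n}"
  shows "(\<Sum>h | h \<in> arrows n \<and> snd h = i. eps n h *
    mat_apply (v (fst h)) (x h) (mat_apply (v (snd h)) (x (prod.swap h)) u) r) = 0"
proof -
  have "(\<Sum>h | h \<in> arrows n \<and> snd h = i. eps n h *
      mat_apply (v (fst h)) (x h) (mat_apply (v (snd h)) (x (prod.swap h)) u) r) =
    (\<Sum>h | h \<in> arrows n \<and> snd h = i. \<Sum>c<v i.
      eps n h * mat_mult (v (fst h)) (x h) (x (prod.swap h)) r c * u c)"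
    by (rule sum.cong[OF refl])
      (auto simp: mat_mult_apply[symmetric] mat_apply_def[of _ "mat_mult _ _ _"] sum_distrib_left mult.assoc)
  also have "\<dots> = (\<Sum>c<v i. (\<Sum>h | h \<in> arrows n \<and> snd h = i.
      eps n h * mat_mult (v (fst h)) (x h) (x (prod.swap h)) r c) * u c)"
    by (subst sum.swap) (simp add: sum_distrib_right)
  also have "\<dots> = 0"
    using assms by (simp add: Lambda_V_def)
  finally show ?thesis .
qed

lemma preprojective_Lambda_V:
  assumes x: "x \<in> Lambda_V n v"
  shows "preprojective n \<tau> (\<lambda>h. mat_apply (v (fst h)) (x h)) (\<lambda>u. mat_apply (v \<tau>) (j \<tau>) u 0)"
proof (unfold_locales, goal_cases)
  case (5 u)
  have "1 \<in> {1..n}" using n4 by simp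
  then show ?case
    using preprojective_relation[OF x, of 1] unfolding relation_sums by (simp add: fun_simps)
next
  case (6 q u)
  then have "Suc q \<in> {1..n}" by simp
  then show ?case
    using preprojective_relation[OF x, of "Suc q"] unfolding relation_sums(2)[OF 6] by (simp add: fun_simps)
next
  case (7 u)
  have "n - 2 \<in> {1..n}" using n4 by simp
  then show ?case
    using preprojective_relation[OF x, of "n - 2"] unfolding relation_sums
    by (simp add: fun_simps algebra_simps)
next
  case (8 r u)
  then have "r \<in> {1..n}" using n4 by auto
  then show ?case
    using preprojective_relation[OF x, of r] unfolding relation_sums(4)[OF 8] by (simp add: fun_simps)
qed (simp_all add: mat_apply_linear plus_fun_apply, simp add: cscale_def)

text \<open>The coordinates embed the point into the coordinate module. The image is a family as in
  \<open>stable_family_standard\<close>, and comparing dimensions identifies its components with the given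
  spaces, so that the coordinates themselves are the change of basis to the standard point.\<close>

lemma stable_point_standard:
  assumes v: "v \<in> dim_vectors n" and xj: "(x, j) \<in> Lambda_st n v (unit_dim \<tau>)"
  shows "admissible n \<tau> v \<and> (\<exists>g\<in>G_V v. act_x v g x = std_x n \<tau> v \<and> act_j v g j = std_j \<tau> v)"
proof -
  define X where "X = (\<lambda>h. mat_apply (v (fst h)) (x h))"
  have x: "x \<in> Lambda_V n v" and j: "j \<in> J_space v (unit_dim \<tau>)"
    and stable: "\<And>S. graded_subspace v S \<Longrightarrow> stable_under n v x S \<Longrightarrow>
      (\<And>i u. u \<in> S i \<Longrightarrow> mat_apply (v i) (j i) u = (\<lambda>_. 0)) \<Longrightarrow> \<forall>i. S i = {\<lambda>_. 0}"
    using xj by (auto simp: Lambda_st_def Lambda_def)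
  have xE: "x \<in> E_space n v" using x by (simp add: Lambda_V_def)
  interpret P: preprojective n \<tau> X "\<lambda>u. mat_apply (v \<tau>) (j \<tau>) u 0"
    unfolding X_def by (rule preprojective_Lambda_V[OF x])
  have v0: "v r = 0" if "r \<notin> {1..n}" for r
    using v that by (auto simp: dim_vectors_def)
  have Xv: "X h u \<in> cspace (v (snd h))" if "h \<in> arrows n" for h u
    using xE that unfolding X_def by (intro mat_apply_cspace) (simp add: E_space_def)
  have lin: "clinear (P.phi r)" for r
    by (rule clinearI) (simp_all add: P.phi_linear)
  \<comment> \<open>The common kernel of the coordinates is a subrepresentation annihilated by \<open>j\<close>.\<close>
  define K where "K = (\<lambda>r. {u \<in> cspace (v r). P.phi r u = 0})"
  have "graded_subspace v K"
    unfolding graded_subspace_def K_def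
    by (auto simp: cfun.subspace_def P.phi_linear cfun.subspace_0[OF subspace_cspace]
        cfun.subspace_add[OF subspace_cspace] cfun.subspace_scale[OF subspace_cspace])
  moreover have "stable_under n v x K"
    unfolding stable_under_def
  proof (intro ballI subsetI)
    fix h y assume h: "h \<in> arrows n" and "y \<in> mat_apply (v (fst h)) (x h) ` K (fst h)"
    then obtain u where u: "u \<in> K (fst h)" "y = X h u" by (auto simp: X_def)
    have "P.phi (snd h) (X h u) = opr h (P.phi (fst h) u)" by (rule P.phi_X[OF h])
    also have "\<dots> = 0" using u(1) by (simp add: K_def coord_op_linear)
    finally show "y \<in> K (snd h)" using Xv[OF h] u(2) by (simp add: K_def)
  qed
  moreover have "mat_apply (v i) (j i) u = (\<lambda>_. 0)" if "u \<in> K i" for i u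
  proof
    fix k
    show "mat_apply (v i) (j i) u k = 0"
    proof (cases "i = \<tau> \<and> k = 0")
      case True
      then show ?thesis
        using that P.phi_tau[of u] by (simp add: K_def zero_fun_apply)
    next
      case False
      then have "k \<ge> unit_dim \<tau> i" by (auto simp: unit_dim_def)
      moreover have "mat_apply (v i) (j i) u \<in> cspace (unit_dim \<tau> i)"
        using j by (intro mat_apply_cspace) (simp add: J_space_def)
      ultimately show ?thesis by (simp add: cspace_def)
    qed
  qed
  ultimately have K0: "\<forall>i. K i = {\<lambda>_. 0}" by (rule stable)
  have inj: "inj_on (P.phi r) (cspace (v r))" for r
  proof (rule inj_onI)
    fix u w assume uw: "u \<in> cspace (v r)" "w \<in> cspace (v r)" "P.phi r u = P.phi r w"
    have "P.phi r (u - w) = 0"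
      using P.phi_linear(1)[of r "u - w" w] uw(3) by simp
    then have "u - w \<in> K r"
      using uw by (simp add: K_def cfun.subspace_diff[OF subspace_cspace])
    then show "u = w" using K0 by (simp add: zero_eq_lambda)
  qed
  have "\<exists>d. (\<forall>r. P.phi r ` cspace (v r) = cspace (d r)) \<and> admissible n \<tau> d"
  proof (rule stable_family_standard)
    show "cfun.subspace (P.phi r ` cspace (v r))" for r
      by (rule cmap.linear_subspace_image[OF lin subspace_cspace])
    show "P.phi r ` cspace (v r) = {0}" if "r \<notin> {1..n}" for r
      using v0[OF that] by (simp add: P.phi_linear)
    then show "P.phi r ` cspace (v r) \<subseteq> cspace n" for r
      using P.phi_bound(1)[of r] cfun.subspace_0[OF subspace_cspace] by (cases "r \<in> {1..n}") auto
    show "P.phi 1 ` cspace (v 1) \<subseteq> cspace 1"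
      using P.phi_bound(2)[of 1] n4 by auto
    fix h z assume h: "h \<in> arrows n" and "z \<in> P.phi (fst h) ` cspace (v (fst h))"
    then obtain u where "z = P.phi (fst h) u" by blast
    then have "opr h z = P.phi (snd h) (X h u)" using P.phi_X[OF h] by simp
    then show "opr h z \<in> P.phi (snd h) ` cspace (v (snd h))" using Xv[OF h] by blast
  qed
  then obtain d where d: "\<And>r. P.phi r ` cspace (v r) = cspace (d r)" and adm: "admissible n \<tau> d" by blast
  have "v r = d r" for r
    using dim_image_subspace[OF lin inj subspace_cspace order_refl, of r] unfolding d by simp
  then have dv: "d = v" by auto
  then have onto: "P.phi r ` cspace (v r) = cspace (v r)" for r using d by simp
  have adm: "admissible n \<tau> v" using adm dv by simp
  define g where "g = (\<lambda>r. matrix_of (v r) (v r) (P.phi r))"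
  have g_mat: "g r \<in> mat_space (v r) (v r)" for r
    unfolding g_def by (rule matrix_of_in_mat_space)
  have g_apply: "mat_apply (v r) (g r) u = P.phi r u" if "u \<in> cspace (v r)" for r u
    unfolding g_def by (rule mat_apply_matrix_of) (use onto that P.phi_linear in auto)
  have "bij_betw (mat_apply (v r) (g r)) (cspace (v r)) (cspace (v r))" for r
    using inj onto by (subst bij_betw_cong[OF g_apply]) (simp_all add: bij_betw_def)
  then have GL: "g r \<in> GL (v r)" for r
    by (rule GL_bijI[OF g_mat])
  then have "g \<in> G_V v" by (simp add: G_V_def)
  moreover have "act_x v g x = std_x n \<tau> v"
  proof
    fix h
    show "act_x v g x h = std_x n \<tau> v h"
    proof (cases "h \<in> arrows n")
      case True
      have xh: "x h \<in> mat_space (v (fst h)) (v (snd h))" using xE True by (simp add: E_space_def)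
      show ?thesis
        unfolding act_x_def
      proof (rule mat_eqI)
        show "mat_mult (v (snd h)) (g (snd h)) (mat_mult (v (fst h)) (x h) (mat_inv (v (fst h)) (g (fst h))))
            \<in> mat_space (v (fst h)) (v (snd h))"
          by (intro mat_mult_in_mat_space g_mat xh GL_mat_space GL)
        show "std_x n \<tau> v h \<in> mat_space (v (fst h)) (v (snd h))"
          using std_x_E_space True by (simp add: E_space_def)
        fix u assume u: "u \<in> cspace (v (fst h))"
        let ?w = "mat_apply (v (fst h)) (mat_inv (v (fst h)) (g (fst h))) u"
        have w: "?w \<in> cspace (v (fst h))" by (rule mat_apply_cspace[OF GL_mat_space(2)[OF GL]])
        have "P.phi (fst h) ?w = u"
          using GL_apply_inverse(1)[OF GL u] g_apply[OF w] by simp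
        then show "mat_apply (v (fst h)) (mat_mult (v (snd h)) (g (snd h))
            (mat_mult (v (fst h)) (x h) (mat_inv (v (fst h)) (g (fst h))))) u =
          mat_apply (v (fst h)) (std_x n \<tau> v h) u"
          using g_apply[OF Xv[OF True]] P.phi_X[OF True]
          by (simp add: mat_mult_apply std_x_apply[OF adm True u]) (simp add: X_def)
      qed
    next
      case False
      then have "x h = (\<lambda>i k. 0)" using xE by (cases h) (simp add: E_space_def)
      then show ?thesis
        using False by (simp add: act_x_def std_x_def mat_mult_def)
    qed
  qed
  moreover have "act_j v g j = std_j \<tau> v"
  proof
    fix r
    show "act_j v g j r = std_j \<tau> v r"
      unfolding act_j_def
    proof (rule mat_eqI)
      show jr: "mat_mult (v r) (j r) (mat_inv (v r) (g r)) \<in> mat_space (v r) (unit_dim \<tau> r)"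
        using j GL by (intro mat_mult_in_mat_space[of _ "v r"] GL_mat_space) (simp_all add: J_space_def)
      show sr: "std_j \<tau> v r \<in> mat_space (v r) (unit_dim \<tau> r)"
        using std_j_J_space by (simp add: J_space_def)
      fix u assume u: "u \<in> cspace (v r)"
      let ?w = "mat_apply (v r) (mat_inv (v r) (g r)) u"
      have w: "?w \<in> cspace (v r)" by (rule mat_apply_cspace[OF GL_mat_space(2)[OF GL]])
      have phi: "P.phi r ?w = u"
        using GL_apply_inverse(1)[OF GL u] g_apply[OF w] by simp
      show "mat_apply (v r) (mat_mult (v r) (j r) (mat_inv (v r) (g r))) u = mat_apply (v r) (std_j \<tau> v r) u"
      proof
        fix k
        show "mat_apply (v r) (mat_mult (v r) (j r) (mat_inv (v r) (g r))) u k = mat_apply (v r) (std_j \<tau> v r) u k"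
        proof (cases "r = \<tau> \<and> k = 0")
          case True
          have "mat_apply (v r) (std_j \<tau> v r) u k = (\<Sum>l<v r. if l = 0 then u l else 0)"
            unfolding mat_apply_def by (rule sum.cong) (use True in \<open>auto simp: std_j_def\<close>)
          also have "\<dots> = u 0"
            using u by (cases "v r = 0") (simp_all add: cspace_def)
          finally show ?thesis
            using P.phi_tau[of ?w] phi True by (simp add: mat_mult_apply)
        next
          case False
          then have "k \<ge> unit_dim \<tau> r" by (auto simp: unit_dim_def)
          then show ?thesis
            using mat_apply_cspace[OF jr, of u] mat_apply_cspace[OF sr, of u] by (simp add: cspace_def)
        qed
      qed
    qed
  qed
  ultimately show ?thesis using adm by blast
qed

text \<open>Both round trips from a vertex in the middle lose one row. The two from \<open>n - 2\<close> through the
  end vertices see the odd and the even rows, and the round trip from an end vertex arrives in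
  rows where this vertex has no coordinate. Only at vertex 1 does the relation restrict the
  vector.\<close>

lemma opr_preprojective:
  assumes i: "i \<in> {1..n}" and z: "i = 1 \<Longrightarrow> z \<in> cspace 1"
  shows "(\<Sum>h | h \<in> arrows n \<and> snd h = i. eps n h * opr h (opr (prod.swap h) z) r) = 0"
proof -
  have s3: "Suc (n - 3) = n - 2" "1 \<le> n - 3" using n4 by simp_all
  consider "i = 1" | q where "i = Suc q" "1 \<le> q" "Suc (Suc q) \<le> n - 2" | "i = n - 2" | "i = n - 1 \<or> i = n"
  proof (cases "i = 1 \<or> i \<ge> n - 2")
    case True
    then have "i = 1 \<or> i = n - 2 \<or> i = n - 1 \<or> i = n" using i unfolding atLeastAtMost_iff by linarith
    then show ?thesis using that(1,3,4) by blast
  next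
    case False
    then have "i = Suc (i - 1)" "1 \<le> i - 1" "Suc (Suc (i - 1)) \<le> n - 2" using i by auto
    then show ?thesis by (rule that(2))
  qed
  then show ?thesis
  proof cases
    case 1
    have "opr (1, 2) z = z" "opr (2, 1) z = (\<lambda>k. z (Suc k))"
      using opr_plain(1,2)[of 1] n4 by (simp_all add: numeral_2_eq_2)
    then show ?thesis
      unfolding 1 relation_sums using z[OF 1] by (simp add: cspace_def)
  next
    case (2 q)
    then show ?thesis
      unfolding 2(1) relation_sums(2)[OF 2(2,3)] by (simp add: opr_plain)
  next
    case 3
    have "opr (n - 3, n - 2) (opr (n - 2, n - 3) z) r = z (Suc r)"
      using opr_plain(1,2)[of "n - 3"] s3 by simp
    moreover have "opr (n - 1, n - 2) (opr (n - 2, n - 1) z) r + opr (n, n - 2) (opr (n - 2, n) z) r = z (Suc r)"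
      using tau n4 by (auto simp: opr_plain row_end spread_def elim!: evenE oddE)
    ultimately show ?thesis
      unfolding 3 relation_sums by (simp add: algebra_simps)
  next
    case 4
    have "spread n \<tau> i z (Suc (row i r)) = 0"
      using 4 by (auto simp: spread_def row_end)
    then show ?thesis
      unfolding relation_sums(4)[OF 4] using 4 by (simp add: opr_plain)
  qed
qed

text \<open>Every arrow lowers the weight of a coordinate by one: it leads to the next vertex in the same row
  or goes back by one vertex and loses a row, which counts twice. The two end vertices have the same
  distance from vertex 1, whence the minimum.\<close>

definition weight :: "nat \<Rightarrow> nat \<Rightarrow> nat" where
  "weight r k = 2 * row r k + (n - min r (n - 1))"

lemma opr_weight:
  assumes h: "h \<in> arrows n" and u: "\<And>k. u k \<noteq> 0 \<Longrightarrow> weight (fst h) k < Suc B"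
    and "opr h u i \<noteq> 0"
  shows "weight (snd h) i < B"
proof -
  obtain k where k: "row (snd h) i + row_shift n h = row (fst h) k" "u k \<noteq> 0"
    using assms(3) unfolding coord_op_def by (rule spread_nonzero)
  from h have "Suc (weight (snd h) i) = weight (fst h) k"
    by (cases rule: arrow_cases) (use k(1) n4 in \<open>auto simp: weight_def min_def\<close>)
  then show ?thesis using u[OF k(2)] by simp
qed

lemma path_apply_weight:
  assumes v: "admissible n \<tau> v"
  shows "set hs \<subseteq> arrows n \<Longrightarrow> successively (\<lambda>h h'. snd h = fst h') hs \<Longrightarrow> (hs \<noteq> [] \<Longrightarrow> fst (hd hs) = r) \<Longrightarrow>
    u \<in> cspace (v r) \<Longrightarrow> (\<And>k. u k \<noteq> 0 \<Longrightarrow> weight r k < B + length hs) \<Longrightarrow>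
    \<exists>r'. \<forall>k. path_apply v (std_x n \<tau> v) hs u k \<noteq> 0 \<longrightarrow> weight r' k < B"
proof (induction hs arbitrary: r u)
  case (Cons h hs)
  have h: "h \<in> arrows n" and r: "fst h = r" using Cons.prems by simp_all
  have u': "mat_apply (v (fst h)) (std_x n \<tau> v h) u = opr h u"
    using std_x_apply[OF v h] Cons.prems(4) r by simp
  have "opr h u \<in> cspace (v (snd h))"
    unfolding u'[symmetric] using std_x_E_space h by (intro mat_apply_cspace) (simp add: E_space_def)
  moreover have "weight (snd h) k < B + length hs" if "opr h u k \<noteq> 0" for k
    using h _ that by (rule opr_weight) (use Cons.prems(5) r in simp)
  moreover have "fst (hd hs) = snd h" if "hs \<noteq> []"
    using Cons.prems(2) that by (cases hs) simp_all
  moreover have "successively (\<lambda>h h'. snd h = fst h') hs"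
    using Cons.prems(2) by (cases hs) simp_all
  ultimately show ?case
    using Cons.IH[of "snd h" "opr h u"] Cons.prems(1) by (simp add: u')
qed auto

lemma std_nilpotent:
  assumes v: "admissible n \<tau> v"
  shows "nilpotent_rep n v (std_x n \<tau> v)"
proof -
  define M where "M = Max (v ` {0..n})"
  have vM: "v r \<le> M" for r
  proof (cases "r \<in> {0..n}")
    case True
    then show ?thesis unfolding M_def by (intro Max_ge) auto
  next
    case False
    then show ?thesis using v by (simp add: admissible_def dim_vectors_def)
  qed
  \<comment> \<open>A strict upper bound for all weights, since the rows of the coordinates are less than
    \<open>2 * M\<close>.\<close>
  define N where "N = 4 * M + n + 3"
  have "path_apply v (std_x n \<tau> v) hs u = (\<lambda>_. 0)"
    if hs: "length hs = N" "set hs \<subseteq> arrows n" "successively (\<lambda>h h'. snd h = fst h') hs"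
      and u: "u \<in> cspace (v (fst (hd hs)))" for hs u
  proof -
    have "weight (fst (hd hs)) k < 0 + length hs" if "u k \<noteq> 0" for k
    proof -
      have "k < v (fst (hd hs))" using u that by (auto simp: cspace_def not_le[symmetric])
      then have "k < M" using vM by (meson less_le_trans)
      moreover have "row (fst (hd hs)) k \<le> 2 * k + 1" by (simp add: row_index_def)
      ultimately show ?thesis by (simp add: weight_def hs(1) N_def)
    qed
    from path_apply_weight[OF v hs(2,3) refl u this] show ?thesis by auto
  qed
  then show ?thesis
    unfolding nilpotent_rep_def by (intro exI[of _ N]) (auto simp: N_def)
qed

text \<open>A graded subspace that violates stability would be standard and have no coordinate at \<open>\<tau>\<close>,
  hence be zero by \<open>admissible_zero\<close>.\<close>

lemma std_stable_point:
  assumes v: "admissible n \<tau> v"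
  shows "(std_x n \<tau> v, std_j \<tau> v) \<in> Lambda_st n v (unit_dim \<tau>)"
proof -
  have xE: "std_x n \<tau> v \<in> E_space n v" by (rule std_x_E_space)
  have swap: "prod.swap h \<in> arrows n" if "h \<in> arrows n" for h
    using that by (cases h) (auto simp: arrows_def)
  have "(\<Sum>h | h \<in> arrows n \<and> snd h = i.
      eps n h * mat_mult (v (fst h)) (std_x n \<tau> v h) (std_x n \<tau> v (prod.swap h)) r c) = 0"
    if i: "i \<in> {1..n}" for i r c
  proof (cases "c < v i")
    case True
    have "(\<Sum>h | h \<in> arrows n \<and> snd h = i.
        eps n h * mat_mult (v (fst h)) (std_x n \<tau> v h) (std_x n \<tau> v (prod.swap h)) r c) =
      (\<Sum>h | h \<in> arrows n \<and> snd h = i. eps n h * opr h (opr (prod.swap h) (unit_vec c)) r)"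
    proof (rule sum.cong[OF refl])
      fix h assume "h \<in> {h. h \<in> arrows n \<and> snd h = i}"
      then have h: "h \<in> arrows n" "snd h = i" by simp_all
      have u: "unit_vec c \<in> cspace (v (fst (prod.swap h)))" using True h(2) by simp
      note 1 = std_x_apply[OF v swap[OF h(1)] u]
      have "mat_apply (v (fst (prod.swap h))) (std_x n \<tau> v (prod.swap h)) (unit_vec c) \<in> cspace (v (fst h))"
        using xE swap[OF h(1)] by (intro mat_apply_cspace) (auto simp: E_space_def)
      then have 2: "mat_apply (v (fst h)) (std_x n \<tau> v h) (opr (prod.swap h) (unit_vec c)) =
          opr h (opr (prod.swap h) (unit_vec c))"
        unfolding 1 by (rule std_x_apply[OF v h(1)])
      have "mat_mult (v (fst h)) (std_x n \<tau> v h) (std_x n \<tau> v (prod.swap h)) r c =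
          mat_apply (v i) (mat_mult (v (fst h)) (std_x n \<tau> v h) (std_x n \<tau> v (prod.swap h))) (unit_vec c) r"
        by (rule mat_apply_unit_vec[OF True, symmetric])
      also have "\<dots> = opr h (opr (prod.swap h) (unit_vec c)) r"
        using 1 2 h(2) by (simp add: mat_mult_apply)
      finally show "eps n h * mat_mult (v (fst h)) (std_x n \<tau> v h) (std_x n \<tau> v (prod.swap h)) r c =
          eps n h * opr h (opr (prod.swap h) (unit_vec c)) r"
        by simp
    qed
    also have "\<dots> = 0"
      using i True v by (intro opr_preprojective) (auto simp: admissible_def)
    finally show ?thesis .
  next
    case False
    then show ?thesis
      by (intro sum.neutral) (auto simp: mat_mult_def std_x_def intro!: sum.neutral)
  qed
  then have Lambda: "std_x n \<tau> v \<in> Lambda_V n v"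
    using xE std_nilpotent[OF v] by (simp add: Lambda_V_def)
  have "S i = {\<lambda>_. 0}"
    if S: "graded_subspace v S" "stable_under n v (std_x n \<tau> v) S"
      and ker: "\<forall>i. \<forall>u\<in>S i. mat_apply (v i) (std_j \<tau> v i) u = (\<lambda>_. 0)" for S i
  proof -
    obtain d where d: "\<And>r. S r = cspace (d r)" "admissible n \<tau> d" "\<And>r. d r \<le> v r"
      using std_stable_subspace[OF v S] by blast
    have "d \<tau> = 0"
    proof (rule ccontr)
      assume "d \<tau> \<noteq> 0"
      then have "unit_vec 0 \<in> S \<tau>" "0 < v \<tau>" using d(1) d(3)[of \<tau>] by simp_all
      moreover from this have "mat_apply (v \<tau>) (std_j \<tau> v \<tau>) (unit_vec 0) 0 = 1"
        by (simp add: mat_apply_unit_vec) (simp add: std_j_def)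
      ultimately show False using ker by (metis zero_neq_one)
    qed
    then show ?thesis
      using d(1) admissible_zero[OF d(2)] by (simp add: zero_eq_lambda)
  qed
  then show ?thesis
    using Lambda std_j_J_space by (simp add: Lambda_st_def Lambda_def)
qed

end

section \<open>The Euler characteristic of a point\<close>

lemma abelian_rank_trivial:
  assumes "trivial_group G"
  shows "abelian_rank G = 0"
  unfolding abelian_rank_def
proof (rule Greatest_equality)
  show "\<exists>S. finite S \<and> S \<subseteq> carrier G \<and> card S = 0 \<and> integrally_independent G S"
    by (rule exI[of _ "{}"]) (simp add: integrally_independent_def)
next
  interpret group G using assms by (simp add: trivial_group_def)
  fix r assume "\<exists>S. finite S \<and> S \<subseteq> carrier G \<and> card S = r \<and> integrally_independent G S"
  then obtain S where S: "S \<subseteq> {\<one>\<^bsub>G\<^esub>}" "card S = r" "integrally_independent G S"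
    using assms by (auto simp: trivial_group_def)
  show "r \<le> 0"
  proof (rule ccontr)
    assume "\<not> r \<le> 0"
    then have "S = {\<one>\<^bsub>G\<^esub>}" using S(1,2) by (cases "S = {}") auto
    moreover have "finprod G (\<lambda>b. b [^]\<^bsub>G\<^esub> (1::int)) {\<one>\<^bsub>G\<^esub>} = \<one>\<^bsub>G\<^esub>"
    proof -
      have "comm_monoid G"
        using assms by unfold_locales (auto simp: trivial_group_def)
      then interpret comm_monoid G .
      show ?thesis by simp
    qed
    ultimately show False
      using S(3) unfolding integrally_independent_def by (auto dest!: spec[of _ "\<lambda>_. 1"])
  qed
qed

lemma abelian_rank_integer_group:
  assumes G: "comm_group G" and iso: "G \<cong> integer_group"
  shows "abelian_rank G = 1"
proof -
  interpret comm_group G by fact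
  obtain f where f: "f \<in> hom G integer_group" and bij: "bij_betw f (carrier G) UNIV"
    using iso by (auto simp: is_iso_def iso_def)
  interpret H: group_hom G integer_group f
    by (intro group_hom.intro is_group group_integer_group group_hom_axioms.intro f)
  have f_mult: "f (x \<otimes>\<^bsub>G\<^esub> y) = f x + f y" if "x \<in> carrier G" "y \<in> carrier G" for x y
    using H.hom_mult[OF that] by simp
  have f_pow: "f (x [^]\<^bsub>G\<^esub> (c::int)) = c * f x" if "x \<in> carrier G" for x c
    using H.hom_int_pow[OF that, of c] by simp
  have f_zero: "x = \<one>\<^bsub>G\<^esub>" if "x \<in> carrier G" "f x = 0" for x
    using bij that H.hom_one by (metis bij_betw_def inj_onD one_closed one_integer_group)
  show ?thesis
    unfolding abelian_rank_def
  proof (rule Greatest_equality)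
    obtain g where g: "g \<in> carrier G" "f g = 1"
      using bij by (metis UNIV_I bij_betwE bij_betw_inv_into bij_betw_inv_into_right)
    have "integrally_independent G {g}"
      unfolding integrally_independent_def
    proof (intro allI impI ballI)
      fix c :: "_ \<Rightarrow> int" and b
      assume "finprod G (\<lambda>b. b [^]\<^bsub>G\<^esub> c b) {g} = \<one>\<^bsub>G\<^esub>" and "b \<in> {g}"
      then have "g [^]\<^bsub>G\<^esub> c g = \<one>\<^bsub>G\<^esub>" using g by simp
      then have "c g * f g = 0" using f_pow[OF g(1), of "c g"] H.hom_one by simp
      then show "c b = 0" using g(2) \<open>b \<in> {g}\<close> by simp
    qed
    then show "\<exists>S. finite S \<and> S \<subseteq> carrier G \<and> card S = 1 \<and> integrally_independent G S"
      using g by (intro exI[of _ "{g}"]) simp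
  next
    fix r assume "\<exists>S. finite S \<and> S \<subseteq> carrier G \<and> card S = r \<and> integrally_independent G S"
    then obtain S where S: "finite S" "S \<subseteq> carrier G" "card S = r" "integrally_independent G S" by blast
    show "r \<le> 1"
    proof (rule ccontr)
      assume "\<not> r \<le> 1"
      then obtain a b where ab: "a \<in> S" "b \<in> S" "a \<noteq> b"
        using S(1,3) by (metis One_nat_def card_le_Suc0_iff_eq)
      \<comment> \<open>Two elements satisfy the relation \<open>f(b) a - f(a) b = 0\<close>, which is nontrivial unless
        \<open>f(a) = 0\<close>; but then \<open>a\<close> itself is the unit.\<close>
      define c :: "'a \<Rightarrow> int" where
        "c = (\<lambda>x. if f a = 0 then (if x = a then 1 else 0)
           else if x = a then f b else if x = b then - f a else 0)"
      let ?t = "\<lambda>x. x [^]\<^bsub>G\<^esub> c x"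
      have abG: "a \<in> carrier G" "b \<in> carrier G" using ab S(2) by auto
      have S': "S = insert a (insert b (S - {a, b}))" using ab by blast
      have rest: "finprod G ?t (S - {a, b}) = \<one>\<^bsub>G\<^esub>"
        by (rule finprod_one_eqI) (simp add: c_def)
      have tG: "?t \<in> S - {a, b} \<rightarrow> carrier G" "?t a \<in> carrier G" "?t b \<in> carrier G"
        using S(2) abG by auto
      have "finprod G ?t S = ?t a \<otimes>\<^bsub>G\<^esub> (?t b \<otimes>\<^bsub>G\<^esub> finprod G ?t (S - {a, b}))"
        using S(1) ab(3) tG by (subst S') (simp add: finprod_insert Pi_iff)
      also have "\<dots> = ?t a \<otimes>\<^bsub>G\<^esub> ?t b" using rest tG by simp
      also have "\<dots> = \<one>\<^bsub>G\<^esub>"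
      proof (rule f_zero)
        show "?t a \<otimes>\<^bsub>G\<^esub> ?t b \<in> carrier G" using tG by simp
        have "f (?t a \<otimes>\<^bsub>G\<^esub> ?t b) = c a * f a + c b * f b"
          by (simp only: f_mult[OF tG(2,3)] f_pow[OF abG(1)] f_pow[OF abG(2)])
        also have "\<dots> = 0" using ab(3) by (simp add: c_def)
        finally show "f (?t a \<otimes>\<^bsub>G\<^esub> ?t b) = 0" .
      qed
      finally have "\<forall>x\<in>S. c x = 0"
        using S(4) unfolding integrally_independent_def by blast
      then show False using ab by (auto simp: c_def split: if_splits)
    qed
  qed
qed

lemma betti_singleton:
  assumes "topspace X = {a}"
  shows "betti p X = (if p = 0 then 1 else 0)"
proof (cases "p = 0")
  case True
  have "pathin X (\<lambda>_. a)" using assms by simp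
  then have "path_connected_space X"
    using assms unfolding path_connected_space_def by (auto intro!: exI[of _ "\<lambda>_. a"])
  then have "homology_group 0 X \<cong> integer_group"
    using assms by (intro isomorphic_integer_zeroth_homology_group) auto
  then show ?thesis
    using True abelian_rank_integer_group[OF abelian_homology_group] by (simp add: betti_def)
next
  case False
  then show ?thesis
    using homology_dimension_axiom[OF assms, of "int p"] by (simp add: betti_def abelian_rank_trivial)
qed

lemma euler_char_singleton:
  assumes "topspace X = {a}"
  shows "euler_char X = 1"
proof -
  have "{p. betti p X \<noteq> 0} = {0}"
    using betti_singleton[OF assms] by auto
  then show ?thesis
    by (simp add: euler_char_def betti_singleton[OF assms])
qed

lemma euler_integral_singleton:
  assumes "topspace X = {a}"
  shows "euler_integral X f = f a"
proof -
  have "topspace (subtopology X {p \<in> topspace X. f p = f a}) = {a}"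
    using assms by auto
  then show ?thesis
    by (simp add: euler_integral_def assms euler_char_singleton)
qed

lemma euler_integral_zero:
  assumes "\<And>p. p \<in> topspace X \<Longrightarrow> f p = 0"
  shows "euler_integral X f = 0"
  unfolding euler_integral_def by (intro sum.neutral) (use assms in auto)

section \<open>Points and flags up to isomorphism\<close>

lemma mat_mult_assoc: "mat_mult d M (mat_mult e N P) = mat_mult e (mat_mult d M N) P"
proof (intro ext)
  fix i k
  have "mat_mult d M (mat_mult e N P) i k = (\<Sum>l<d. \<Sum>m<e. M i l * N l m * P m k)"
    by (simp add: mat_mult_def sum_distrib_left mult.assoc)
  also have "\<dots> = (\<Sum>m<e. \<Sum>l<d. M i l * N l m * P m k)"
    by (rule sum.swap)
  also have "\<dots> = mat_mult e (mat_mult d M N) P i k"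
    by (simp add: mat_mult_def sum_distrib_right)
  finally show "mat_mult d M (mat_mult e N P) i k = mat_mult e (mat_mult d M N) P i k" .
qed

lemma GL_cancel:
  assumes "h \<in> GL d" "g \<in> GL d"
  shows "mat_mult d (mat_mult d h (mat_inv d g)) g = h"
proof (rule mat_eqI)
  note m = GL_mat_space[OF assms(1)] GL_mat_space[OF assms(2)]
  show "mat_mult d (mat_mult d h (mat_inv d g)) g \<in> mat_space d d" "h \<in> mat_space d d"
    by (intro mat_mult_in_mat_space m)+
  show "mat_apply d (mat_mult d (mat_mult d h (mat_inv d g)) g) u = mat_apply d h u" if "u \<in> cspace d" for u
    by (simp add: mat_mult_apply GL_apply_inverse(2)[OF assms(2) that])
qed

definition flag_act where
  "flag_act v g = (\<lambda>(x, j, S). (act_x v g x, act_j v g j, act_S v g S))"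

definition vmult :: "dimv \<Rightarrow> vertex_maps \<Rightarrow> vertex_maps \<Rightarrow> vertex_maps" where
  "vmult v g h = (\<lambda>i. mat_mult (v i) (g i) (h i))"

lemma vmult_G_V: "g \<in> G_V v \<Longrightarrow> h \<in> G_V v \<Longrightarrow> vmult v g h \<in> G_V v"
  by (simp add: G_V_def vmult_def GL_mult)

lemma act_x_vmult:
  assumes "g \<in> G_V v" "h \<in> G_V v"
  shows "act_x v (vmult v g h) x = act_x v g (act_x v h x)"
  using assms by (auto simp: act_x_def vmult_def G_V_def GL_mult(2) mat_mult_assoc)

lemma act_j_vmult:
  assumes "g \<in> G_V v" "h \<in> G_V v"
  shows "act_j v (vmult v g h) j = act_j v g (act_j v h j)"
  using assms by (auto simp: act_j_def vmult_def G_V_def GL_mult(2) mat_mult_assoc)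

lemma act_S_vmult: "act_S v (vmult v g h) S = act_S v g (act_S v h S)"
  by (simp add: act_S_def vmult_def mat_mult_apply image_image)

lemma flag_orbit_eq: "flag_orbit v t = (\<lambda>g. flag_act v g t) ` G_V v"
  by (auto simp: flag_orbit_def flag_act_def split: prod.splits)

lemma G_orbit_eq: "G_orbit v t = (\<lambda>g. (act_x v g (fst t), act_j v g (snd t))) ` G_V v"
  by (auto simp: G_orbit_def split: prod.splits)

lemma vmult_cancel:
  assumes "g \<in> G_V v" "h \<in> G_V v"
  obtains k where "k \<in> G_V v" "vmult v k g = h"
proof
  show "vmult v h (\<lambda>i. mat_inv (v i) (g i)) \<in> G_V v"
    using assms by (intro vmult_G_V) (auto simp: G_V_def GL_inv)
  show "vmult v (vmult v h (\<lambda>i. mat_inv (v i) (g i))) g = h"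
    using assms by (auto simp: vmult_def G_V_def GL_cancel)
qed

lemma flag_orbit_act:
  assumes g: "g \<in> G_V v"
  shows "flag_orbit v (flag_act v g t) = flag_orbit v t"
proof -
  have comp: "flag_act v h (flag_act v g t) = flag_act v (vmult v h g) t" if "h \<in> G_V v" for h
    using g that by (simp add: flag_act_def act_x_vmult act_j_vmult act_S_vmult split: prod.splits)
  show ?thesis
    unfolding flag_orbit_eq
  proof (intro equalityI image_subsetI)
    fix h assume "h \<in> G_V v"
    then show "flag_act v h (flag_act v g t) \<in> (\<lambda>g. flag_act v g t) ` G_V v"
      using comp vmult_G_V[OF _ g] by auto
  next
    fix h assume "h \<in> G_V v"
    then obtain k where "k \<in> G_V v" "vmult v k g = h" by (rule vmult_cancel[OF g])
    then show "flag_act v h t \<in> (\<lambda>h. flag_act v h (flag_act v g t)) ` G_V v"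
      using comp by (metis image_eqI)
  qed
qed

lemma pi2_flag_orbit: "pi2 (flag_orbit v (x, j, S)) = G_orbit v (x, j)"
  by (auto simp: pi2_def flag_orbit_eq flag_act_def G_orbit_eq image_image)

lemma G_orbit_act:
  assumes "g \<in> G_V v"
  shows "G_orbit v (act_x v g x, act_j v g j) = G_orbit v (x, j)"
  using flag_orbit_act[OF assms, of "(x, j, \<lambda>_. {})"] unfolding flag_act_def prod.case
  by (metis pi2_flag_orbit)

definition vid :: "dimv \<Rightarrow> vertex_maps" where
  "vid v = (\<lambda>i. mat_id (v i))"

lemma vid_G_V: "vid v \<in> G_V v"
  by (simp add: vid_def G_V_def mat_id_GL)

lemma mat_inv_id: "mat_inv d (mat_id d) = mat_id d"
  by (rule GL_I(2)) (simp_all add: mat_id_in_mat_space mat_id_apply)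

lemma mat_id_mult:
  assumes "M \<in> mat_space d r"
  shows "mat_mult r (mat_id r) M = M" "mat_mult d M (mat_id d) = M"
  by (rule mat_eqI[OF mat_mult_in_mat_space[OF mat_id_in_mat_space assms] assms],
      simp add: mat_mult_apply mat_id_apply mat_apply_cspace[OF assms])
    (rule mat_eqI[OF mat_mult_in_mat_space[OF assms mat_id_in_mat_space] assms],
      simp add: mat_mult_apply mat_id_apply)

lemma act_vid:
  assumes "x \<in> E_space n v" "j \<in> J_space v w"
  shows "act_x v (vid v) x = x" "act_j v (vid v) j = j"
proof -
  show "act_x v (vid v) x = x"
  proof
    fix h
    show "act_x v (vid v) x h = x h"
    proof (cases "h \<in> arrows n")
      case True
      then have "x h \<in> mat_space (v (fst h)) (v (snd h))" using assms(1) by (simp add: E_space_def)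
      then show ?thesis by (simp add: act_x_def vid_def mat_inv_id mat_id_mult)
    next
      case False
      then have "x h = (\<lambda>i k. 0)" using assms(1) by (cases h) (simp add: E_space_def)
      then show ?thesis by (simp add: act_x_def mat_mult_def)
    qed
  qed
  show "act_j v (vid v) j = j"
  proof
    fix i
    have "j i \<in> mat_space (v i) (w i)" using assms(2) by (simp add: J_space_def)
    then show "act_j v (vid v) j i = j i" by (simp add: act_j_def vid_def mat_inv_id mat_id_mult)
  qed
qed

text \<open>The class of the restriction of the coordinate module to the dimension vector \<open>v\<close>, and that
  class together with its submodule of dimension vector \<open>d\<close>.\<close>

definition std_point :: "nat \<Rightarrow> nat \<Rightarrow> dimv \<Rightarrow> point" where
  "std_point n \<tau> v = G_orbit v (std_x n \<tau> v, std_j \<tau> v)"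

definition std_flag :: "nat \<Rightarrow> nat \<Rightarrow> dimv \<Rightarrow> dimv \<Rightarrow> flag_point" where
  "std_flag n \<tau> v d = flag_orbit v (std_x n \<tau> v, std_j \<tau> v, \<lambda>i. cspace (d i))"

lemma pi2_std_flag: "pi2 (std_flag n \<tau> v d) = std_point n \<tau> v"
  by (simp add: std_flag_def std_point_def pi2_flag_orbit)

lemma topspace_F_topology: "topspace (F_topology n v w v'') = frame_orbit v v'' ` framed_triples n v w v''"
proof -
  let ?X = "top_of_set (framed_triples n v w v'')" and ?q = "frame_orbit v v''"
  have E: "{p \<in> topspace ?X. ?q p \<in> ?q ` topspace ?X} = topspace ?X" by blast
  have "openin (quotient_topology ?X ?q) (?q ` topspace ?X)"
    unfolding openin_quotient_topology E by (intro conjI order_refl openin_topspace)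
  then have "?q ` topspace ?X \<subseteq> topspace (quotient_topology ?X ?q)"
    by (rule openin_subset)
  moreover have "topspace (quotient_topology ?X ?q) \<subseteq> ?q ` topspace ?X"
    using openin_topspace[of "quotient_topology ?X ?q"] unfolding openin_quotient_topology by blast
  ultimately show ?thesis by (simp add: F_topology_def)
qed

context type_D
begin

text \<open>All stable points with the same dimension vector are conjugate to the standard one.\<close>

lemma L_var_standard:
  assumes "v \<in> dim_vectors n"
  shows "L_var n v (unit_dim \<tau>) = (if admissible n \<tau> v then {std_point n \<tau> v} else {})"
proof -
  have "G_orbit v t = std_point n \<tau> v \<and> admissible n \<tau> v" if mem: "t \<in> Lambda_st n v (unit_dim \<tau>)" for t
  proof -
    obtain x j where t: "t = (x, j)" by (cases t)
    obtain g where "admissible n \<tau> v" "g \<in> G_V v" "act_x v g x = std_x n \<tau> v" "act_j v g j = std_j \<tau> v"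
      using stable_point_standard[OF assms mem[unfolded t]] by blast
    then show ?thesis
      unfolding t std_point_def using G_orbit_act[of g v x j] by simp
  qed
  note * = this
  show ?thesis
  proof (cases "admissible n \<tau> v")
    case True
    have "G_orbit v ` Lambda_st n v (unit_dim \<tau>) = (\<lambda>_. std_point n \<tau> v) ` Lambda_st n v (unit_dim \<tau>)"
      by (rule image_cong[OF refl]) (rule *[THEN conjunct1])
    then show ?thesis
      using std_stable_point[OF True] True by (simp add: L_var_def image_constant)
  next
    case False
    then have "Lambda_st n v (unit_dim \<tau>) = {}" using * by blast
    then show ?thesis using False by (simp add: L_var_def)
  qed
qed

lemma std_j_apply:
  assumes "u \<in> cspace (v r)"
  shows "mat_apply (v r) (std_j \<tau> v r) u = (\<lambda>k. if r = \<tau> \<and> k = 0 then u 0 else 0)"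
proof
  fix k
  have "mat_apply (v r) (std_j \<tau> v r) u k = (\<Sum>l<v r. if l = 0 then (if r = \<tau> \<and> k = 0 then u 0 else 0) else 0)"
    unfolding mat_apply_def by (rule sum.cong) (auto simp: std_j_def)
  also have "\<dots> = (if r = \<tau> \<and> k = 0 then u 0 else 0)"
    using assms by (cases "v r = 0") (simp_all add: cspace_def)
  finally show "mat_apply (v r) (std_j \<tau> v r) u k = (if r = \<tau> \<and> k = 0 then u 0 else 0)" .
qed

lemma std_flag_triple:
  assumes v: "admissible n \<tau> v" and d: "admissible n \<tau> d" and dv: "\<And>i. d i + v'' i = v i"
  shows "(std_x n \<tau> v, std_j \<tau> v, \<lambda>i. cspace (d i)) \<in> flag_triples n v (unit_dim \<tau>) v''"
proof -
  have le: "d i \<le> v i" for i using dv[of i] by simp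
  have "stable_under n v (std_x n \<tau> v) (\<lambda>i. cspace (d i))"
    unfolding stable_under_def
  proof (intro ballI image_subsetI)
    fix h u assume h: "h \<in> arrows n" and u: "u \<in> cspace (d (fst h))"
    then have "u \<in> cspace (v (fst h))" using cspace_mono[OF le] by blast
    then have "mat_apply (v (fst h)) (std_x n \<tau> v h) u = mat_apply (d (fst h)) (std_x n \<tau> d h) u"
      using std_x_apply[OF v h] std_x_apply[OF d h u] by simp
    also have "\<dots> \<in> cspace (d (snd h))"
      using std_x_E_space[of d] h by (intro mat_apply_cspace) (simp add: E_space_def)
    finally show "mat_apply (v (fst h)) (std_x n \<tau> v h) u \<in> cspace (d (snd h))" .
  qed
  moreover have "graded_subspace v (\<lambda>i. cspace (d i))"
    by (simp add: graded_subspace_def subspace_cspace cspace_le_iff le)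
  ultimately show ?thesis
    by (simp add: flag_triples_def std_stable_point[OF v] dv)
qed

text \<open>After moving the point to the standard one, the submodule becomes a standard one by
  \<open>std_stable_subspace\<close>.\<close>

lemma flag_orbit_standard:
  assumes v: "v \<in> dim_vectors n" and t: "t \<in> flag_triples n v (unit_dim \<tau>) v''"
  shows "admissible n \<tau> v \<and> (\<exists>d. admissible n \<tau> d \<and> (\<forall>i. d i + v'' i = v i) \<and> flag_orbit v t = std_flag n \<tau> v d)"
proof -
  obtain x j S where t': "t = (x, j, S)" by (cases t)
  have xj: "(x, j) \<in> Lambda_st n v (unit_dim \<tau>)" and S: "graded_subspace v S" "stable_under n v x S"
    and dim: "\<And>i. cfun.dim (S i) + v'' i = v i"
    using t unfolding t' flag_triples_def by auto
  obtain g where adm: "admissible n \<tau> v" and g: "g \<in> G_V v"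
    and gx: "act_x v g x = std_x n \<tau> v" and gj: "act_j v g j = std_j \<tau> v"
    using stable_point_standard[OF v xj] by blast
  have GL: "g i \<in> GL (v i)" for i using g by (simp add: G_V_def)
  have sub: "cfun.subspace (S i)" "S i \<subseteq> cspace (v i)" for i
    using S(1) by (auto simp: graded_subspace_def)
  let ?S' = "act_S v g S"
  have "graded_subspace v ?S'"
    unfolding graded_subspace_def act_S_def
    using cmap.linear_subspace_image[OF clinear_mat_apply sub(1)] mat_apply_cspace[OF GL_mat_space(1)[OF GL]]
    by auto
  moreover have "stable_under n v (std_x n \<tau> v) ?S'"
    unfolding stable_under_def act_S_def gx[symmetric] act_x_def
  proof (intro ballI image_subsetI, elim imageE)
    fix h y u assume h: "h \<in> arrows n" and y: "y = mat_apply (v (fst h)) (g (fst h)) u" and u: "u \<in> S (fst h)"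
    have "mat_apply (v (fst h)) (x h) u \<in> S (snd h)"
      using S(2) h u by (auto simp: stable_under_def)
    then show "mat_apply (v (fst h)) (mat_mult (v (snd h)) (g (snd h))
        (mat_mult (v (fst h)) (x h) (mat_inv (v (fst h)) (g (fst h))))) y
        \<in> mat_apply (v (snd h)) (g (snd h)) ` S (snd h)"
      unfolding y mat_mult_apply GL_apply_inverse(2)[OF GL subsetD[OF sub(2) u]] by (rule imageI)
  qed
  ultimately obtain d where d: "\<And>i. ?S' i = cspace (d i)" "admissible n \<tau> d"
    using std_stable_subspace[OF adm] by blast
  have "d i = cfun.dim (S i)" for i
  proof -
    have "cfun.dim (?S' i) = cfun.dim (S i)"
      unfolding act_S_def
      by (rule dim_image_subspace[OF clinear_mat_apply _ sub])
        (use GL_bij_betw[OF GL] in \<open>simp add: bij_betw_def\<close>)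
    then show ?thesis using d(1) by simp
  qed
  moreover have "?S' = (\<lambda>i. cspace (d i))" using d(1) by auto
  then have "flag_orbit v t = std_flag n \<tau> v d"
    using flag_orbit_act[OF g, of t] by (simp add: t' flag_act_def gx gj std_flag_def)
  ultimately show ?thesis using adm d(2) dim by auto
qed

lemma F_var_standard:
  assumes v: "v \<in> dim_vectors n"
  shows "F_var n v (unit_dim \<tau>) v'' =
    {std_flag n \<tau> v d | d. admissible n \<tau> v \<and> admissible n \<tau> d \<and> (\<forall>i. d i + v'' i = v i)}" (is "?F = ?R")
    and "topspace (F_topology n v (unit_dim \<tau>) v'') = F_var n v (unit_dim \<tau>) v''"
proof -
  have 1: "?F \<subseteq> ?R"
    unfolding F_var_def using flag_orbit_standard[OF v] by blast
  have 2: "frame_orbit v v'' ` framed_triples n v (unit_dim \<tau>) v'' \<subseteq> ?F"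
    by (auto simp: frame_orbit_def framed_triples_def F_var_def)
  have 3: "?R \<subseteq> frame_orbit v v'' ` framed_triples n v (unit_dim \<tau>) v''"
  proof
    fix T assume "T \<in> ?R"
    then obtain d where T: "T = std_flag n \<tau> v d" and adm: "admissible n \<tau> v" "admissible n \<tau> d"
      and dv: "\<And>i. d i + v'' i = v i" by blast
    have d: "v i - v'' i = d i" for i using dv[of i] by simp
    \<comment> \<open>The first coordinates frame the standard submodule.\<close>
    let ?s = "\<lambda>i. mat_id (d i)"
    have frame: "frame_image d ?s = (\<lambda>i. cspace (d i))"
    proof
      fix i
      have "mat_apply (d i) (mat_id (d i)) ` cspace (d i) = (\<lambda>u. u) ` cspace (d i)"
        by (rule image_cong[OF refl]) (rule mat_id_apply)
      then show "frame_image d ?s i = cspace (d i)" by (simp add: frame_image_def)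
    qed
    have "mat_id (d i) \<in> mat_space (d i) (v i)" for i
      using dv[of i] by (simp add: mat_space_def mat_id_def)
    then have "(std_x n \<tau> v, std_j \<tau> v, ?s) \<in> framed_triples n v (unit_dim \<tau>) v''"
      using std_flag_triple[OF adm dv] by (simp add: framed_triples_def d frame)
    moreover have "frame_orbit v v'' (std_x n \<tau> v, std_j \<tau> v, ?s) = T"
      by (simp add: frame_orbit_def d frame T std_flag_def)
    ultimately show "T \<in> frame_orbit v v'' ` framed_triples n v (unit_dim \<tau>) v''" by blast
  qed
  show "?F = ?R"
    by (rule subset_antisym[OF 1 order_trans[OF 3 2]])
  show "topspace (F_topology n v (unit_dim \<tau>) v'') = ?F"
    unfolding topspace_F_topology by (rule subset_antisym[OF 2 order_trans[OF 1 3]])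
qed

lemma std_x_restrict:
  assumes v: "admissible n \<tau> v" and d: "admissible n \<tau> d" "\<And>i. d i \<le> v i"
    and h: "h \<in> arrows n" and u: "u \<in> cspace (d (fst h))"
  shows "mat_apply (v (fst h)) (std_x n \<tau> v h) u = mat_apply (d (fst h)) (std_x n \<tau> d h) u"
  unfolding std_x_apply[OF v h subsetD[OF cspace_mono[OF d(2)] u]] std_x_apply[OF d(1) h u] ..

lemma std_j_restrict:
  assumes d: "\<And>i. d i \<le> v i" and u: "u \<in> cspace (d r)"
  shows "mat_apply (v r) (std_j \<tau> v r) u = mat_apply (d r) (std_j \<tau> d r) u"
  using std_j_apply[of u v r, OF subsetD[OF cspace_mono[OF d] u]] std_j_apply[of u d r, OF u] by simp

text \<open>Restricting the coordinate module to \<open>v\<close> and then to \<open>d\<close> is restricting it to \<open>d\<close>. As \<open>\<pi>\<^sub>1\<close>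
  collects the restrictions in all bases of the submodule, its value is a full orbit.\<close>

lemma pi1_std_flag:
  assumes v: "admissible n \<tau> v" and d: "admissible n \<tau> d" and le: "\<And>i. d i \<le> v i"
  shows "pi1 n v (unit_dim \<tau>) (std_flag n \<tau> v d) = std_point n \<tau> d"
proof (intro equalityI subsetI)
  fix y assume "y \<in> std_point n \<tau> d"
  then obtain m where m: "m \<in> G_V d" and y: "y = (act_x d m (std_x n \<tau> d), act_j d m (std_j \<tau> d))"
    unfolding std_point_def G_orbit_eq by auto
  have GL: "m i \<in> GL (d i)" for i using m by (simp add: G_V_def)
  \<comment> \<open>A conjugate by \<open>m\<close> is the restriction in the basis given by the columns of the inverse of
    \<open>m\<close>.\<close>
  define s where "s = (\<lambda>i. mat_inv (d i) (m i))"
  have s_GL: "s i \<in> GL (d i)" for i using GL by (simp add: s_def GL_inv)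
  have s_mat: "s i \<in> mat_space (d i) (v i)" for i
    using GL_mat_space(1)[OF s_GL, of i] le[of i] unfolding mat_space_def by (auto intro: order_trans)
  have s_bij: "bij_betw (mat_apply (d i) (s i)) (cspace (d i)) (cspace (d i))" for i
    by (rule GL_bij_betw[OF s_GL])
  have xd: "std_x n \<tau> d h \<in> mat_space (d (fst h)) (d (snd h))" if "h \<in> arrows n" for h
    using std_x_E_space[of d] that by (simp add: E_space_def)
  have jd: "std_j \<tau> d i \<in> mat_space (d i) (unit_dim \<tau> i)" for i
    using std_j_J_space[of d] by (simp add: J_space_def)
  have x'_mat: "act_x d m (std_x n \<tau> d) h \<in> mat_space (d (fst h)) (d (snd h))" if "h \<in> arrows n" for h
    unfolding act_x_def by (intro mat_mult_in_mat_space GL_mat_space GL xd that)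
  have off: "act_x d m (std_x n \<tau> d) h = (\<lambda>i k. 0)" if "h \<notin> arrows n" for h
    using that by (simp add: act_x_def std_x_def mat_mult_def)
  have E: "act_x d m (std_x n \<tau> d) \<in> E_space n d"
    using x'_mat off by (simp add: E_space_def)
  have J: "act_j d m (std_j \<tau> d) \<in> J_space d (unit_dim \<tau>)"
    unfolding J_space_def act_j_def
    by (intro CollectI allI mat_mult_in_mat_space[of _ "d i" for i] jd GL_mat_space GL)
  have sx: "mat_mult (d (snd h)) (s (snd h)) (act_x d m (std_x n \<tau> d) h) =
      mat_mult (v (fst h)) (std_x n \<tau> v h) (s (fst h))" if h: "h \<in> arrows n" for h
  proof (rule mat_eqI)
    show "mat_mult (d (snd h)) (s (snd h)) (act_x d m (std_x n \<tau> d) h) \<in> mat_space (d (fst h)) (v (snd h))"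
      by (intro mat_mult_in_mat_space s_mat x'_mat h)
    show "mat_mult (v (fst h)) (std_x n \<tau> v h) (s (fst h)) \<in> mat_space (d (fst h)) (v (snd h))"
      using std_x_E_space[of v] h by (intro mat_mult_in_mat_space s_mat) (simp add: E_space_def)
    fix u assume u: "u \<in> cspace (d (fst h))"
    have su: "mat_apply (d (fst h)) (s (fst h)) u \<in> cspace (d (fst h))"
      by (rule mat_apply_cspace[OF GL_mat_space(1)[OF s_GL]])
    show "mat_apply (d (fst h)) (mat_mult (d (snd h)) (s (snd h)) (act_x d m (std_x n \<tau> d) h)) u =
        mat_apply (d (fst h)) (mat_mult (v (fst h)) (std_x n \<tau> v h) (s (fst h))) u"
      unfolding mat_mult_apply act_x_def std_x_restrict[OF v d le h su]
      using GL_apply_inverse(2)[OF GL mat_apply_cspace[OF xd[OF h]]] by (simp add: s_def)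
  qed
  have sj: "act_j d m (std_j \<tau> d) i = mat_mult (v i) (std_j \<tau> v i) (s i)" for i
  proof (rule mat_eqI)
    show "act_j d m (std_j \<tau> d) i \<in> mat_space (d i) (unit_dim \<tau> i)"
      unfolding act_j_def by (intro mat_mult_in_mat_space[of _ "d i"] jd GL_mat_space GL)
    show "mat_mult (v i) (std_j \<tau> v i) (s i) \<in> mat_space (d i) (unit_dim \<tau> i)"
      using std_j_J_space[of v] s_mat by (intro mat_mult_in_mat_space[of _ "v i"]) (simp_all add: J_space_def)
    fix u assume "u \<in> cspace (d i)"
    have su: "mat_apply (d i) (s i) u \<in> cspace (d i)"
      by (rule mat_apply_cspace[OF GL_mat_space(1)[OF s_GL]])
    show "mat_apply (d i) (act_j d m (std_j \<tau> d) i) u = mat_apply (d i) (mat_mult (v i) (std_j \<tau> v i) (s i)) u"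
      unfolding act_j_def mat_mult_apply std_j_restrict[where r = i and d = d and v = v, OF le su] by (simp add: s_def)
  qed
  have T: "(std_x n \<tau> v, std_j \<tau> v, \<lambda>i. cspace (d i)) \<in> std_flag n \<tau> v d"
  proof -
    have "act_S v (vid v) (\<lambda>i. cspace (d i)) = (\<lambda>i. cspace (d i))"
    proof
      fix i
      have "mat_apply (v i) (mat_id (v i)) ` cspace (d i) = (\<lambda>u. u) ` cspace (d i)"
        by (rule image_cong[OF refl]) (use mat_id_apply cspace_mono[OF le] in blast)
      then show "act_S v (vid v) (\<lambda>i. cspace (d i)) i = cspace (d i)" by (simp add: act_S_def vid_def)
    qed
    then show ?thesis
      unfolding std_flag_def flag_orbit_eq using act_vid[OF std_x_E_space std_j_J_space, of v] vid_G_V[of v]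
      by (intro image_eqI[of _ _ "vid v"]) (simp_all add: flag_act_def)
  qed
  have dim: "d i = cfun.dim (cspace (d i))" for i by simp
  show "y \<in> pi1 n v (unit_dim \<tau>) (std_flag n \<tau> v d)"
    unfolding pi1_def y mem_Collect_eq prod.case
    by (intro exI[of _ "std_x n \<tau> v"] exI[of _ "std_j \<tau> v"] exI[of _ "\<lambda>i. cspace (d i)"]
        exI[of _ d] exI[of _ s] conjI allI ballI T dim E J s_mat s_bij sx sj)
next
  fix y assume "y \<in> pi1 n v (unit_dim \<tau>) (std_flag n \<tau> v d)"
  obtain x' j' where y: "y = (x', j')" by (cases y)
  obtain x j S d' s where T: "(x, j, S) \<in> std_flag n \<tau> v d"
    and H: "(\<forall>i. d' i = cfun.dim (S i)) \<and> x' \<in> E_space n d' \<and> j' \<in> J_space d' (unit_dim \<tau>) \<and>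
      (\<forall>i. s i \<in> mat_space (d' i) (v i) \<and> bij_betw (mat_apply (d' i) (s i)) (cspace (d' i)) (S i)) \<and>
      (\<forall>h\<in>arrows n. mat_mult (d' (snd h)) (s (snd h)) (x' h) = mat_mult (v (fst h)) (x h) (s (fst h))) \<and>
      (\<forall>i. j' i = mat_mult (v i) (j i) (s i))"
    using \<open>y \<in> pi1 n v (unit_dim \<tau>) (std_flag n \<tau> v d)\<close>
    unfolding pi1_def y mem_Collect_eq prod.case by (elim exE) (erule conjE, rule that, assumption, assumption)
  have d': "d' i = cfun.dim (S i)" and x': "x' \<in> E_space n d'" and j': "j' \<in> J_space d' (unit_dim \<tau>)"
    and s: "s i \<in> mat_space (d' i) (v i)" "bij_betw (mat_apply (d' i) (s i)) (cspace (d' i)) (S i)"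
    and sj: "j' i = mat_mult (v i) (j i) (s i)" for i
    using H by blast+
  have sx: "mat_mult (d' (snd h)) (s (snd h)) (x' h) = mat_mult (v (fst h)) (x h) (s (fst h))"
    if "h \<in> arrows n" for h
    using H that by blast
  obtain g where g: "g \<in> G_V v" and x: "x = act_x v g (std_x n \<tau> v)" and j: "j = act_j v g (std_j \<tau> v)"
    and S: "S = act_S v g (\<lambda>i. cspace (d i))"
    using T unfolding std_flag_def flag_orbit_eq flag_act_def by auto
  have GL: "g i \<in> GL (v i)" for i using g by (simp add: G_V_def)
  note sub = cspace_mono[OF le, THEN subsetD]
  have g_inj: "inj_on (mat_apply (v i) (g i)) (cspace (v i))" for i
    using GL_bij_betw[OF GL] by (simp add: bij_betw_def)
  have "d' i = d i" for i
    unfolding d' S act_S_def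
    using dim_image_subspace[OF clinear_mat_apply g_inj subspace_cspace cspace_mono[OF le]] by simp
  then have dd: "d' = d" by auto
  \<comment> \<open>Conversely, the basis \<open>s\<close> is moved by the inverse of \<open>g\<close> to a basis \<open>m\<close> of the standard
    submodule.\<close>
  define m where "m = (\<lambda>i. mat_mult (v i) (mat_inv (v i) (g i)) (s i))"
  have m_apply: "mat_apply (d i) (m i) u = mat_apply (v i) (mat_inv (v i) (g i)) (mat_apply (d i) (s i) u)" for i u
    by (simp add: m_def mat_mult_apply)
  have s_apply: "mat_apply (d i) (s i) u = mat_apply (v i) (g i) (mat_apply (d i) (m i) u)" if "u \<in> cspace (d i)" for i u
    unfolding m_apply using GL_apply_inverse(1)[OF GL mat_apply_cspace[OF s(1)[of i, unfolded dd]]] by simp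
  have inv_S: "bij_betw (mat_apply (v i) (mat_inv (v i) (g i))) (S i) (cspace (d i))" for i
  proof (rule bij_betw_byWitness[where f' = "mat_apply (v i) (g i)"])
    show "\<forall>u\<in>S i. mat_apply (v i) (g i) (mat_apply (v i) (mat_inv (v i) (g i)) u) = u"
      "mat_apply (v i) (mat_inv (v i) (g i)) ` S i \<subseteq> cspace (d i)"
      by (auto simp: S act_S_def GL_apply_inverse[OF GL] sub)
    show "\<forall>u\<in>cspace (d i). mat_apply (v i) (mat_inv (v i) (g i)) (mat_apply (v i) (g i) u) = u"
      by (simp add: GL_apply_inverse[OF GL] sub)
    show "mat_apply (v i) (g i) ` cspace (d i) \<subseteq> S i" by (simp add: S act_S_def)
  qed
  have m_bij: "bij_betw (mat_apply (d i) (m i)) (cspace (d i)) (cspace (d i))" for i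
  proof -
    have "mat_apply (d i) (m i) = mat_apply (v i) (mat_inv (v i) (g i)) \<circ> mat_apply (d i) (s i)"
      by (rule ext) (simp add: m_apply)
    then show ?thesis
      using bij_betw_trans[OF s(2)[of i] inv_S[of i]] by (simp add: dd)
  qed
  have m_mat: "m i \<in> mat_space (d i) (d i)" for i
    unfolding mat_space_def
  proof (intro CollectI allI impI)
    fix r c assume rc: "d i \<le> r \<or> d i \<le> c"
    have mv: "m i \<in> mat_space (d i) (v i)"
      unfolding m_def using s(1)[of i] GL_mat_space(2)[OF GL, of i] by (intro mat_mult_in_mat_space) (simp_all add: dd)
    show "m i r c = 0"
    proof (cases "c < d i")
      case True
      then have "mat_apply (d i) (m i) (unit_vec c) \<in> cspace (d i)"
        using m_bij[of i] by (auto simp: bij_betw_def)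
      then show ?thesis using True rc by (simp add: cspace_def mat_apply_unit_vec)
    next
      case False
      then show ?thesis using mv by (simp add: mat_space_def)
    qed
  qed
  have m_GL: "m i \<in> GL (d i)" for i by (rule GL_bijI[OF m_mat m_bij])
  define k where "k = (\<lambda>i. mat_inv (d i) (m i))"
  have k_GL: "k i \<in> GL (d i)" and k_inv: "mat_inv (d i) (k i) = m i" for i
    using GL_I[OF GL_mat_space(2)[OF m_GL[of i]] m_mat[of i]] GL_apply_inverse[OF m_GL[of i]]
    by (simp_all add: k_def)
  then have k: "k \<in> G_V d" by (simp add: G_V_def)
  have mc: "mat_apply (d i) (m i) u \<in> cspace (d i)" for i u by (rule mat_apply_cspace[OF m_mat])
  have xd: "std_x n \<tau> d h \<in> mat_space (d (fst h)) (d (snd h))" if "h \<in> arrows n" for h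
    using std_x_E_space[of d] that by (simp add: E_space_def)
  have "x' = act_x d k (std_x n \<tau> d)"
  proof
    fix h
    show "x' h = act_x d k (std_x n \<tau> d) h"
    proof (cases "h \<in> arrows n")
      case True
      have x'h: "x' h \<in> mat_space (d (fst h)) (d (snd h))" using x' True by (simp add: E_space_def dd)
      show ?thesis
        unfolding act_x_def k_inv
      proof (rule mat_eqI[OF x'h])
        show "mat_mult (d (snd h)) (k (snd h)) (mat_mult (d (fst h)) (std_x n \<tau> d h) (m (fst h)))
            \<in> mat_space (d (fst h)) (d (snd h))"
          by (intro mat_mult_in_mat_space GL_mat_space k_GL xd True m_mat)
        fix u assume u: "u \<in> cspace (d (fst h))"
        let ?y = "mat_apply (d (fst h)) (x' h) u" and ?mu = "mat_apply (d (fst h)) (m (fst h)) u"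
        have y: "?y \<in> cspace (d (snd h))" by (rule mat_apply_cspace[OF x'h])
        have "mat_apply (v (snd h)) (g (snd h)) (mat_apply (d (snd h)) (m (snd h)) ?y) =
            mat_apply (d (fst h)) (mat_mult (d' (snd h)) (s (snd h)) (x' h)) u"
          by (simp add: s_apply[OF y] mat_mult_apply dd)
        also have "\<dots> = mat_apply (v (fst h)) (x h) (mat_apply (d (fst h)) (s (fst h)) u)"
          unfolding sx[OF True] mat_mult_apply ..
        also have "\<dots> = mat_apply (v (snd h)) (g (snd h)) (mat_apply (v (fst h)) (std_x n \<tau> v h) ?mu)"
          unfolding x act_x_def s_apply[OF u] mat_mult_apply
          using GL_apply_inverse(2)[OF GL sub[OF mc]] by simp
        finally have "mat_apply (d (snd h)) (m (snd h)) ?y = mat_apply (v (fst h)) (std_x n \<tau> v h) ?mu"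
          using inj_onD[OF g_inj] sub[OF mc] mat_apply_cspace[of "std_x n \<tau> v h" "v (fst h)" "v (snd h)"]
            std_x_E_space[of v] True by (simp add: E_space_def)
        also have "\<dots> = mat_apply (d (fst h)) (std_x n \<tau> d h) ?mu"
          by (rule std_x_restrict[OF v d le True mc])
        finally show "?y = mat_apply (d (fst h)) (mat_mult (d (snd h)) (k (snd h))
            (mat_mult (d (fst h)) (std_x n \<tau> d h) (m (fst h)))) u"
          using GL_apply_inverse(2)[OF m_GL y] by (simp add: mat_mult_apply k_def)
      qed
    next
      case False
      then have "x' h = (\<lambda>i k. 0)" using x' by (cases h) (simp add: E_space_def)
      then show ?thesis using False by (simp add: act_x_def std_x_def mat_mult_def)
    qed
  qed
  moreover have "j' = act_j d k (std_j \<tau> d)"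
  proof
    fix i
    show "j' i = act_j d k (std_j \<tau> d) i"
      unfolding act_j_def k_inv
    proof (rule mat_eqI)
      show "j' i \<in> mat_space (d i) (unit_dim \<tau> i)" using j' by (simp add: J_space_def dd)
      show "mat_mult (d i) (std_j \<tau> d i) (m i) \<in> mat_space (d i) (unit_dim \<tau> i)"
        using std_j_J_space[of d] by (intro mat_mult_in_mat_space[of _ "d i"] m_mat) (simp add: J_space_def)
      fix u assume u: "u \<in> cspace (d i)"
      have "mat_apply (d i) (j' i) u = mat_apply (v i) (std_j \<tau> v i) (mat_apply (d i) (m i) u)"
        unfolding sj j act_j_def mat_mult_apply s_apply[OF u]
        using GL_apply_inverse(2)[OF GL sub[OF mc]] by simp
      also have "\<dots> = mat_apply (d i) (mat_mult (d i) (std_j \<tau> d i) (m i)) u"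
        by (simp add: std_j_restrict[where r = i and d = d and v = v, OF le mc] mat_mult_apply)
      finally show "mat_apply (d i) (j' i) u = mat_apply (d i) (mat_mult (d i) (std_j \<tau> d i) (m i)) u" .
    qed
  qed
  ultimately show "y \<in> std_point n \<tau> d"
    unfolding y std_point_def G_orbit_eq using k by (intro image_eqI[of _ _ k]) simp_all
qed

end

section \<open>Admissible dimension vectors and Young diagrams\<close>

text \<open>A diagram is encoded by the set \<open>E\<close> of the endpoints of its rows. The row with endpoint \<open>e\<close> has one cell
  at each of the vertices \<open>e, \<dots>, n - 2\<close> and one at an end vertex, alternately \<open>\<tau>\<close> and the other one.\<close>

definition cnt :: "nat set \<Rightarrow> nat \<Rightarrow> nat" where
  "cnt E r = card (E \<inter> {..r})"

definition ends_dim :: "nat \<Rightarrow> nat \<Rightarrow> nat set \<Rightarrow> dimv" where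
  "ends_dim n \<tau> E = (\<lambda>r. if 1 \<le> r \<and> r \<le> n - 2 then cnt E r
     else if r = n - 1 \<or> r = n then if r = \<tau> then (card E + 1) div 2 else card E div 2 else 0)"

lemma cnt_Suc: "finite E \<Longrightarrow> cnt E (Suc r) = cnt E r + (if Suc r \<in> E then 1 else 0)"
proof -
  assume "finite E"
  have "E \<inter> {..Suc r} = (if Suc r \<in> E then insert (Suc r) (E \<inter> {..r}) else E \<inter> {..r})"
    by (auto simp: le_Suc_eq)
  then show ?thesis using \<open>finite E\<close> by (simp add: cnt_def)
qed

lemma cnt_total: "E \<subseteq> {1..m} \<Longrightarrow> cnt E m = card E"
  unfolding cnt_def by (rule arg_cong[of _ _ card]) auto

lemma cnt_0: "E \<subseteq> {1..m} \<Longrightarrow> cnt E 0 = 0"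
  by (auto simp: cnt_def)

lemma half_sum: "(m + 1) div 2 + m div 2 = (m::nat)"
  by presburger

context type_D
begin

abbreviation vE where "vE \<equiv> ends_dim n \<tau>"

definition other :: nat where "other = 2 * n - 1 - \<tau>"

lemma tau_cases:
  obtains "\<tau> = n" "other = n - 1" | "\<tau> = n - 1" "other = n" "\<tau> \<noteq> n"
proof (cases "\<tau> = n")
  case True
  then have "other = n - 1" unfolding other_def by simp
  then show ?thesis using that(1)[OF True] by blast
next
  case False
  then have *: "\<tau> = n - 1" using tau by simp
  then have "other = n" using n4 unfolding other_def by simp
  then show ?thesis using that(2)[OF * _ False] by blast
qed

lemma other: "other = n - 1 \<or> other = n" "other \<noteq> \<tau>"
  "r = n - 1 \<or> r = n \<longleftrightarrow> r = \<tau> \<or> r = other"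
proof -
  have "n - 1 \<noteq> n" using n4 by simp
  then show "other = n - 1 \<or> other = n" "other \<noteq> \<tau>" "r = n - 1 \<or> r = n \<longleftrightarrow> r = \<tau> \<or> r = other"
    using tau_cases by metis+
qed

lemma ends_dim_simps:
  "1 \<le> r \<Longrightarrow> r \<le> n - 2 \<Longrightarrow> vE E r = cnt E r"
  "vE E \<tau> = (card E + 1) div 2"
  "vE E other = card E div 2"
  "r \<notin> {1..n} \<Longrightarrow> vE E r = 0"
proof -
  show "1 \<le> r \<Longrightarrow> r \<le> n - 2 \<Longrightarrow> vE E r = cnt E r" by (simp add: ends_dim_def)
  have "\<not> \<tau> \<le> n - 2" "\<not> other \<le> n - 2" using tau other(1) n4 by linarith+
  then show "vE E \<tau> = (card E + 1) div 2" "vE E other = card E div 2"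
    unfolding ends_dim_def using tau other(1,2) by simp_all
  show "vE E r = 0" if "r \<notin> {1..n}"
  proof -
    have "\<not> (1 \<le> r \<and> r \<le> n - 2)" "\<not> (r = n - 1 \<or> r = n)"
      using that n4 unfolding atLeastAtMost_iff by linarith+
    then show ?thesis unfolding ends_dim_def by (simp only: if_False)
  qed
qed

lemma vertex_cases:
  obtains "r \<notin> {1..n}" | "1 \<le> r" "r \<le> n - 2" | "r = \<tau>" | "r = other"
proof -
  have "r \<notin> {1..n} \<or> (1 \<le> r \<and> r \<le> n - 2) \<or> r = n - 1 \<or> r = n"
    unfolding atLeastAtMost_iff by linarith
  then show ?thesis using that other(3)[of r] by blast
qed

text \<open>Admissibility says that the dimensions weakly increase by at most 1 from each vertex to the
  next one towards the ends, where \<open>card E\<close> rows are distributed to the two end vertices by their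
  parity.\<close>

lemma admissible_ends_dim:
  assumes E: "E \<subseteq> {1..n - 1}"
  shows "admissible n \<tau> (vE E)"
proof -
  have fin: "finite E" using E finite_subset by blast
  have "n - 1 = Suc (n - 2)" using n4 by simp
  then have top: "card E = cnt E (n - 2) + (if n - 1 \<in> E then 1 else 0)"
    using cnt_total[OF E] cnt_Suc[OF fin, of "n - 2"] by simp
  have le: "cnt E r \<le> cnt E (Suc r)" "cnt E (Suc r) \<le> cnt E r + 1" for r
    using cnt_Suc[OF fin, of r] by simp_all
  show ?thesis
    unfolding admissible_def
  proof (intro conjI ballI allI impI)
    show "vE E \<in> dim_vectors n" by (simp add: dim_vectors_def ends_dim_simps(4))
    have "cnt E 1 \<le> 1" using le(2)[of 0] cnt_0[OF E] by simp
    then show "vE E 1 \<le> 1" using n4 by (simp add: ends_dim_simps(1))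
    fix h k i assume h: "h \<in> arrows n" and k: "k < vE E (fst h)"
      and eq: "row (fst h) k = row (snd h) i + row_shift n h"
    from h show "i < vE E (snd h)"
    proof (cases rule: arrow_cases)
      case (up r)
      then show ?thesis using k eq le(1)[of r] by (simp add: ends_dim_simps(1) row_plain)
    next
      case (down r)
      then show ?thesis using k eq le(2)[of r] by (simp add: ends_dim_simps(1) row_plain)
    next
      case (end_up r)
      have "k < cnt E (n - 2)" "k = row r i" using end_up k eq n4 by (simp_all add: ends_dim_simps(1) row_plain)
      then have "row r i < card E" using top by simp
      moreover have "r = \<tau> \<or> r = other" using end_up(2) other(3)[of r] by simp
      ultimately show ?thesis
        using end_up(1) by (elim disjE) (simp_all add: row_end[OF tau] row_end[OF other(1)] other(2) ends_dim_simps(2,3))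
    next
      case (end_down r)
      have i: "row r k = Suc i" using end_down eq by (simp add: row_plain)
      have "r = \<tau> \<or> r = other" using end_down(2) other(3)[of r] by simp
      then have "Suc (row r k) \<le> card E"
        using end_down(1) k by (elim disjE) (simp_all add: row_end[OF tau] row_end[OF other(1)] other(2) ends_dim_simps(2,3))
      then have "i < cnt E (n - 2)" using i top by (auto split: if_splits)
      then show ?thesis using end_down n4 by (simp add: ends_dim_simps(1))
    qed
  qed
qed

text \<open>The conditions for the arrows say that the sequence \<open>v 1, \<dots>, v (n - 2), v \<tau> + v other\<close>
  starts with at most 1 and grows by 0 or 1 in each step, and that \<open>v \<tau>\<close> and \<open>v other\<close> are the two
  halves of their sum. The endpoints are the places where the sequence grows.\<close>

lemma admissible_imp_ends_dim:
  assumes v: "admissible n \<tau> v"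
  shows "\<exists>E\<subseteq>{1..n - 1}. v = vE E"
proof -
  have step: "i < v (snd h)" if "h \<in> arrows n" "k < v (fst h)"
    "row (fst h) k = row (snd h) i + row_shift n h" for h k i
    using v that unfolding admissible_def by blast
  have up: "v r \<le> v (Suc r)" if r: "1 \<le> r" "Suc r \<le> n - 2" for r
  proof (rule ccontr)
    assume "\<not> v r \<le> v (Suc r)"
    then show False
      using step[OF arrows_mem(1)[OF r], of "v (Suc r)" "v (Suc r)"] r
      by (simp add: row_shift_simps(1)[OF r] row_plain)
  qed
  have down: "v (Suc r) \<le> v r + 1" if r: "1 \<le> r" "Suc r \<le> n - 2" for r
  proof (rule ccontr)
    assume "\<not> v (Suc r) \<le> v r + 1"
    then show False
      using step[OF arrows_mem(2)[OF r], of "v r + 1" "v r"] r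
      by (simp add: row_shift_simps(2)[OF r] row_plain)
  qed
  let ?m = "v (n - 2)" and ?a = "v \<tau>" and ?b = "v other"
  have ra: "row \<tau> k = 2 * k" for k by (simp add: row_end[OF tau])
  have rb: "row other k = 2 * k + 1" for k by (simp add: row_end[OF other(1)] other(2))
  have up_a: "?m \<le> 2 * ?a"
  proof (rule ccontr)
    assume "\<not> ?m \<le> 2 * ?a"
    then show False
      using step[OF arrows_mem(3)[OF tau], of "2 * ?a" ?a]
      by (simp add: row_shift_simps(3)[OF tau] row_plain ra)
  qed
  have up_b: "?m \<le> 2 * ?b + 1"
  proof (rule ccontr)
    assume "\<not> ?m \<le> 2 * ?b + 1"
    then show False
      using step[OF arrows_mem(3)[OF other(1)], of "2 * ?b + 1" ?b]
      by (simp add: row_shift_simps(3)[OF other(1)] row_plain rb)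
  qed
  have down_a: "2 * ?a \<le> ?m + 2"
  proof (cases "2 \<le> ?a")
    case True
    then have "2 * (?a - 1) = Suc (2 * ?a - 3)" by simp
    then have "2 * ?a - 3 < ?m"
      using step[OF arrows_mem(4)[OF tau], of "?a - 1" "2 * ?a - 3"] True
      by (simp add: row_shift_simps(4)[OF tau] row_plain ra)
    then show ?thesis by simp
  qed simp
  have down_b: "2 * ?b \<le> ?m + 1"
  proof (cases "1 \<le> ?b")
    case True
    then have "Suc (2 * (?b - 1)) = Suc (2 * ?b - 2)" by simp
    then have "2 * ?b - 2 < ?m"
      using step[OF arrows_mem(4)[OF other(1)], of "?b - 1" "2 * ?b - 2"] True
      by (simp add: row_shift_simps(4)[OF other(1)] row_plain rb)
    then show ?thesis by simp
  qed simp
  define s where "s = ?a + ?b"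
  have a: "?a = (s + 1) div 2" and b: "?b = s div 2" and ms: "?m \<le> s" "s \<le> ?m + 1"
    using up_a up_b down_a down_b unfolding s_def by presburger+
  \<comment> \<open>The sequence, extended by 0 so that an endpoint at vertex 1 is a growth as well.\<close>
  define c where "c = (\<lambda>r. if r = 0 then 0 else if r \<le> n - 2 then v r else s)"
  define E where "E = {r \<in> {1..n - 1}. c r = c (r - 1) + 1}"
  have E: "E \<subseteq> {1..n - 1}" by (auto simp: E_def)
  have fin: "finite E" by (simp add: E_def)
  have n2: "1 \<le> n - 2" using n4 by simp
  have c_step: "c r \<le> c (Suc r) \<and> c (Suc r) \<le> c r + 1" if "r < n - 1" for r
  proof -
    consider "r = 0" | "1 \<le> r" "Suc r \<le> n - 2" | "r = n - 2" using \<open>r < n - 1\<close> by linarith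
    then show ?thesis
    proof cases
      case 1
      then show ?thesis using v n2 by (simp add: c_def admissible_def)
    next
      case 2
      then show ?thesis using up[OF 2] down[OF 2] by (simp add: c_def)
    next
      case 3
      then show ?thesis using ms n4 by (simp add: c_def)
    qed
  qed
  have cnt: "cnt E r = c r" if "r \<le> n - 1" for r
    using that
  proof (induction r)
    case 0
    then show ?case using cnt_0[OF E] by (simp add: c_def)
  next
    case (Suc r)
    have "Suc r \<in> E \<longleftrightarrow> c (Suc r) = c r + 1" using Suc.prems by (simp add: E_def)
    then show ?case using Suc c_step[of r] by (simp add: cnt_Suc[OF fin])
  qed
  have "card E = c (n - 1)" using cnt[of "n - 1"] cnt_total[OF E] by simp
  moreover have "n - 1 \<noteq> 0" "\<not> n - 1 \<le> n - 2" using n4 by simp_all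
  ultimately have card: "card E = s" by (simp add: c_def)
  have "v r = vE E r" for r
  proof (cases r rule: vertex_cases)
    case 1
    then show ?thesis using v by (auto simp: admissible_def dim_vectors_def ends_dim_simps(4))
  next
    case 2
    then show ?thesis using cnt[of r] by (simp add: ends_dim_simps(1) c_def)
  qed (simp_all add: ends_dim_simps(2,3) a b card)
  then show ?thesis using E by blast
qed

lemma admissible_iff: "admissible n \<tau> v \<longleftrightarrow> (\<exists>E\<subseteq>{1..n - 1}. v = vE E)"
  using admissible_ends_dim admissible_imp_ends_dim by blast

lemma ends_dim_total: "vE E \<tau> + vE E other = card E"
  by (simp only: ends_dim_simps(2,3) half_sum)

lemma ends_dim_profile:
  assumes "E \<subseteq> {1..n - 1}" "r \<le> n - 1"
  shows "cnt E r = (if r = 0 then 0 else if r \<le> n - 2 then vE E r else vE E \<tau> + vE E other)"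
proof (cases "r \<le> n - 2")
  case True
  then show ?thesis using cnt_0[OF assms(1)] by (cases "r = 0") (simp_all add: ends_dim_simps(1))
next
  case False
  then have "r = n - 1" using assms(2) by simp
  then show ?thesis using False cnt_total[OF assms(1)] ends_dim_total[of E] n4 by simp
qed

text \<open>The change of the dimension vector when the endpoint \<open>k\<close> is removed from \<open>E\<close>. At the end vertices
  the number of rows decreases by one, which is felt at \<open>\<tau>\<close> or at the other one according to its parity; so
  the change is \<open>y\<^sup>k\<close> or \<open>z\<^sup>k\<close>.\<close>

definition diff_dim :: "nat \<Rightarrow> nat set \<Rightarrow> dimv" where
  "diff_dim k E = (\<lambda>i. if (k \<le> i \<and> i \<le> n - 2) \<or> i = (if odd (card E) then \<tau> else other) then 1 else 0)"

lemma diff_dim_eq: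
  assumes "1 \<le> k" "k \<le> n - 1"
  shows "diff_dim k E = (if \<tau> = n \<longleftrightarrow> odd (card E) then z_dim n k else y_dim n k)"
proof (cases "\<tau> = n \<longleftrightarrow> odd (card E)")
  case True
  then have "(if odd (card E) then \<tau> else other) = n" by (cases rule: tau_cases) simp_all
  then show ?thesis using True by (simp add: diff_dim_def z_dim_def)
next
  case False
  then have "(if odd (card E) then \<tau> else other) = n - 1" by (cases rule: tau_cases) simp_all
  moreover have "(k \<le> i \<and> i \<le> n - 2) \<or> i = n - 1 \<longleftrightarrow> k \<le> i \<and> i \<le> n - 1" for i
    using assms n4 by linarith
  ultimately show ?thesis using False by (simp add: diff_dim_def y_dim_def)
qed

lemma cnt_delete:
  assumes "finite E" "k \<in> E"
  shows "cnt E r = cnt (E - {k}) r + (if k \<le> r then 1 else 0)"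
proof (cases "k \<le> r")
  case True
  then have "E \<inter> {..r} = insert k ((E - {k}) \<inter> {..r})" using assms(2) by auto
  then show ?thesis using True assms(1) by (simp add: cnt_def)
next
  case False
  then have "E \<inter> {..r} = (E - {k}) \<inter> {..r}" by auto
  then show ?thesis using False by (simp add: cnt_def)
qed

lemma ends_beyond: "\<not> \<tau> \<le> n - 2" "\<not> other \<le> n - 2"
  using tau other(1) n4 by linarith+

lemma ends_range: "\<tau> \<in> {1..n}" "other \<in> {1..n}"
  unfolding atLeastAtMost_iff using tau other(1) n4 by linarith+

lemma ends_dim_delete:
  assumes E: "E \<subseteq> {1..n - 1}" and k: "k \<in> E"
  shows "vE E i = vE (E - {k}) i + diff_dim k E i"
proof -
  have fin: "finite E" using E finite_subset by blast
  have k1: "1 \<le> k" "k \<le> n - 1" using E k by auto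
  have card: "card E = Suc (card (E - {k}))" by (rule card.remove[OF fin k])
  note ends = ends_beyond
  show ?thesis
  proof (cases i rule: vertex_cases)
    case 1
    have "i \<noteq> \<tau>" "i \<noteq> other" using 1 ends_range by metis+
    moreover have "\<not> (k \<le> i \<and> i \<le> n - 2)" using 1 k1 n4 unfolding atLeastAtMost_iff by linarith
    ultimately have "diff_dim k E i = 0" by (simp add: diff_dim_def)
    then show ?thesis using 1 by (simp add: ends_dim_simps(4))
  next
    case 2
    have "i \<noteq> \<tau>" "i \<noteq> other" using 2 ends by metis+
    then have "diff_dim k E i = (if k \<le> i then 1 else 0)" using 2 by (simp add: diff_dim_def)
    then show ?thesis
      using cnt_delete[OF fin k, of i] 2 by (simp add: ends_dim_simps(1))
  next
    case 3
    have "diff_dim k E \<tau> = (if odd (card E) then 1 else 0)"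
      using ends(1) other(2)[symmetric] by (simp add: diff_dim_def)
    then show ?thesis
      unfolding 3 ends_dim_simps(2) card by (cases "even (card (E - {k}))") (simp_all add: even_two_times_div_two)
  next
    case 4
    have "diff_dim k E other = (if odd (card E) then 0 else 1)"
      using ends(2) other(2) by (simp add: diff_dim_def)
    then show ?thesis
      unfolding 4 ends_dim_simps(3) card by (cases "even (card (E - {k}))") (simp_all add: even_two_times_div_two)
  qed
qed

text \<open>The numbers of endpoints up to \<open>r\<close> for \<open>E\<close> exceed those for \<open>E'\<close> by one from \<open>r = k\<close> on, and
  they determine the sets. The distribution between the end vertices does not enter, since \<open>y\<^sup>k\<close>
  and \<open>z\<^sup>k\<close> have the same total there.\<close>

lemma ends_dim_eq_imp:
  assumes E: "E \<subseteq> {1..n - 1}" and E': "E' \<subseteq> {1..n - 1}" and k: "1 \<le> k" "k \<le> n - 1"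
    and eq: "\<And>i. vE E i = vE E' i + u i" and u: "u = y_dim n k \<or> u = z_dim n k"
  shows "k \<in> E \<and> E' = E - {k}"
proof -
  have fin: "finite E" "finite E'" using E E' finite_subset by blast+
  have u_mid: "u i = (if k \<le> i then 1 else 0)" if "1 \<le> i" "i \<le> n - 2" for i
    using u that n4 by (auto simp: y_dim_def z_dim_def)
  have u_end: "u \<tau> + u other = 1"
  proof -
    have "u n + u (n - 1) = 1"
      using u k n4 by (auto simp: y_dim_def z_dim_def)
    then show ?thesis by (cases rule: tau_cases) simp_all
  qed
  have cnt: "cnt E r = cnt E' r + (if k \<le> r then 1 else 0)" if "r \<le> n - 1" for r
    unfolding ends_dim_profile[OF E that] ends_dim_profile[OF E' that]
    using k eq[of r] eq[of \<tau>] eq[of other] u_mid[of r] u_end by auto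
  have mem: "r \<in> E \<longleftrightarrow> (r \<in> E' \<and> r \<noteq> k) \<or> (r = k \<and> k \<notin> E')" if "r \<in> {1..n - 1}" for r
  proof -
    obtain q where q: "r = Suc q" using \<open>r \<in> {1..n - 1}\<close> by (cases r) auto
    have "cnt E (Suc q) = cnt E' (Suc q) + (if k \<le> Suc q then 1 else 0)"
      "cnt E q = cnt E' q + (if k \<le> q then 1 else 0)"
      using cnt[of "Suc q"] cnt[of q] \<open>r \<in> {1..n - 1}\<close> unfolding q by simp_all
    then show ?thesis
      using cnt_Suc[OF fin(1), of q] cnt_Suc[OF fin(2), of q] unfolding q
      by (cases "Suc q \<in> E"; cases "Suc q \<in> E'"; cases "k \<le> q"; cases "k = Suc q") simp_all
  qed
  have "k \<notin> E'"
  proof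
    assume "k \<in> E'"
    obtain q where q: "k = Suc q" using k by (cases k) auto
    have "cnt E (Suc q) = cnt E' (Suc q) + 1" "cnt E q = cnt E' q"
      using cnt[of "Suc q"] cnt[of q] k unfolding q by simp_all
    then show False
      using cnt_Suc[OF fin(1), of q] cnt_Suc[OF fin(2), of q] \<open>k \<in> E'\<close> unfolding q
      by (cases "Suc q \<in> E") simp_all
  qed
  then show ?thesis using mem E E' k by auto
qed

lemma ends_dim_inj:
  assumes E: "E \<subseteq> {1..n - 1}" and E': "E' \<subseteq> {1..n - 1}" and eq: "vE E = vE E'"
  shows "E = E'"
proof -
  have fin: "finite E" "finite E'" using E E' finite_subset by blast+
  have "r \<in> E \<longleftrightarrow> r \<in> E'" if "r \<in> {1..n - 1}" for r
  proof -
    obtain q where q: "r = Suc q" using \<open>r \<in> {1..n - 1}\<close> by (cases r) auto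
    have "cnt E (Suc q) = cnt E' (Suc q)" "cnt E q = cnt E' q"
      using that ends_dim_profile[OF E] ends_dim_profile[OF E'] eq by (auto simp: q)
    then show ?thesis
      using cnt_Suc[OF fin(1), of q] cnt_Suc[OF fin(2), of q] unfolding q
      by (cases "Suc q \<in> E"; cases "Suc q \<in> E'") simp_all
  qed
  then show ?thesis using E E' by blast
qed

text \<open>Every nonempty diagram has a removable cell, in its shortest row: its endpoint moves from \<open>k\<close> to
  \<open>k + 1\<close>, or the row disappears if it consists of a single cell at an end vertex.\<close>

lemma ends_dim_predecessor:
  assumes E: "E \<subseteq> {1..n - 1}" and ne: "E \<noteq> {}"
  shows "\<exists>k E'. k \<in> {1..n} \<and> E' \<subseteq> {1..n - 1} \<and> (\<forall>i. vE E i = vE E' i + unit_dim k i)"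
proof -
  have fin: "finite E" using E finite_subset by blast
  define k where "k = Max E"
  have k: "k \<in> E" "\<And>e. e \<in> E \<Longrightarrow> e \<le> k" using fin ne by (simp_all add: k_def)
  then have k1: "1 \<le> k" "k \<le> n - 1" using E by auto
  note ends = ends_beyond
  have card: "card E = Suc (card (E - {k}))" by (rule card.remove[OF fin k(1)])
  show ?thesis
  proof (cases "k = n - 1")
    case True
    let ?t = "if odd (card E) then \<tau> else other"
    have "vE E i = vE (E - {k}) i + unit_dim ?t i" for i
    proof -
      have "\<not> (k \<le> i \<and> i \<le> n - 2)" using True n4 by linarith
      then have "diff_dim k E i = unit_dim ?t i" unfolding diff_dim_def unit_dim_def by auto
      then show ?thesis using ends_dim_delete[OF E k(1), of i] by simp
    qed
    moreover have "?t \<in> {1..n}" using ends_range by simp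
    ultimately show ?thesis using E by (intro exI[of _ ?t] exI[of _ "E - {k}"]) auto
  next
    case False
    then have k2: "k \<le> n - 2" "Suc k \<le> n - 1" using k1 n4 by simp_all
    let ?E' = "insert (Suc k) (E - {k})"
    have Suc_k: "Suc k \<notin> E" using k(2)[of "Suc k"] by auto
    have E': "?E' \<subseteq> {1..n - 1}" using E k2 by auto
    have card': "card ?E' = card E" using card fin Suc_k by simp
    have "?E' - {Suc k} = E - {k}" using Suc_k by auto
    then have cnt': "cnt ?E' r = cnt (E - {k}) r + (if Suc k \<le> r then 1 else 0)" for r
      using cnt_delete[of ?E' "Suc k" r] fin by simp
    have "vE E i = vE ?E' i + unit_dim k i" for i
    proof (cases i rule: vertex_cases)
      case 1
      have "i \<noteq> k" using 1 k1 unfolding atLeastAtMost_iff by linarith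
      then show ?thesis using 1 by (simp add: ends_dim_simps(4) unit_dim_def)
    next
      case 2
      have "cnt E i = cnt ?E' i + unit_dim k i"
        unfolding cnt_delete[OF fin k(1), of i] cnt' unit_dim_def by auto
      then show ?thesis using 2 by (simp add: ends_dim_simps(1))
    next
      case 3
      have "\<tau> \<noteq> k" using ends(1) k2(1) by metis
      then show ?thesis unfolding 3 ends_dim_simps(2) card' by (simp add: unit_dim_def)
    next
      case 4
      have "other \<noteq> k" using ends(2) k2(1) by metis
      then show ?thesis unfolding 4 ends_dim_simps(3) card' by (simp add: unit_dim_def)
    qed
    moreover have "k \<in> {1..n}" using k1 by simp
    ultimately show ?thesis using E' by blast
  qed
qed

lemma ends_dim_empty: "vE {} = (\<lambda>_. 0)"
  by (auto simp: ends_dim_def cnt_def)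

end

text \<open>Decreasing lists of row lengths and sets of endpoints determine each other through \<open>l \<mapsto> n - l\<close>, and
  the numbers of rows that occur in the signs become cardinalities.\<close>

lemma sorted_wrt_greater_distinct: "sorted_wrt (>) (Y :: nat list) \<Longrightarrow> distinct Y"
  by (induction Y) auto

lemma young_ends:
  assumes "Y \<in> young n"
  defines "E \<equiv> (\<lambda>l. n - l) ` set Y"
  shows "E \<subseteq> {1..n - 1}" "length Y = card E" "length (filter (\<lambda>l. P (n - l)) Y) = card {e \<in> E. P e}"
proof -
  have Y: "sorted_wrt (>) Y" "set Y \<subseteq> {1..n - 1}" using assms by (auto simp: young_def)
  have "distinct Y" using Y(1) by (rule sorted_wrt_greater_distinct)
  have inj: "inj_on (\<lambda>l. n - l) (set Y)"
    using Y(2) by (intro inj_onI) (auto dest!: subsetD)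
  show "E \<subseteq> {1..n - 1}" using Y(2) by (auto simp: E_def dest!: subsetD)
  have *: "length (filter (\<lambda>l. P (n - l)) Y) = card {e \<in> E. P e}" for P
  proof -
    have "{e \<in> E. P e} = (\<lambda>l. n - l) ` {l \<in> set Y. P (n - l)}" by (auto simp: E_def)
    then have "card {e \<in> E. P e} = card {l \<in> set Y. P (n - l)}"
      using inj by (simp add: card_image inj_on_subset)
    then show ?thesis
      using \<open>distinct Y\<close> by (simp add: distinct_card[symmetric])
  qed
  show "length Y = card E" using *[of "\<lambda>_. True"] by simp
  show "length (filter (\<lambda>l. P (n - l)) Y) = card {e \<in> E. P e}" by (rule *)
qed

lemma young_unique:
  assumes "Y \<in> young n" "Y' \<in> young n" "(\<lambda>l. n - l) ` set Y = (\<lambda>l. n - l) ` set Y'"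
  shows "Y = Y'"
proof -
  have sub: "set Y \<subseteq> {1..n - 1}" "set Y' \<subseteq> {1..n - 1}"
    and sorted: "sorted_wrt (>) Y" "sorted_wrt (>) Y'"
    using assms by (auto simp: young_def)
  have "set Z = (\<lambda>e. n - e) ` (\<lambda>l. n - l) ` set Z" if "set Z \<subseteq> {1..n - 1}" for Z
    using that by (force simp: image_image)
  then have "set Y = set Y'" using sub assms(3) by metis
  moreover have "sorted (rev Y)" "sorted (rev Y')" "distinct (rev Y)" "distinct (rev Y')"
    using sorted by (auto simp: sorted_wrt_rev sorted_wrt_greater_distinct intro: sorted_wrt_mono_rel[rotated])
  ultimately have "rev Y = rev Y'" by (intro sorted_distinct_set_unique) simp_all
  then show ?thesis by simp
qed

context type_D
begin

lemma young_dim: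
  assumes "Y \<in> young n"
  shows "(if unit_dim \<tau> = unit_dim n then v_plus n Y else v_minus n Y) = vE ((\<lambda>l. n - l) ` set Y)"
proof -
  let ?E = "(\<lambda>l. n - l) ` set Y"
  have n: "n - 1 \<noteq> n" "\<not> n \<le> n - 2" "\<not> n - 1 \<le> n - 2" using n4 by simp_all
  have plus: "v_plus n Y = ends_dim n n ?E"
  proof
    fix r
    have "{e \<in> ?E. e \<le> r} = ?E \<inter> {..r}" by auto
    then have "length (filter (\<lambda>l. n - l \<le> r) Y) = cnt ?E r"
      using young_ends(3)[OF assms, of "\<lambda>e. e \<le> r"] by (simp add: cnt_def)
    then show "v_plus n Y r = ends_dim n n ?E r"
      using young_ends(2)[OF assms] n by (simp add: v_plus_def ends_dim_def)
  qed
  have star: "star n (ends_dim n n E) = ends_dim n (n - 1) E" for E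
  proof
    fix r
    define h l where "h = (card E + 1) div 2" and "l = card E div 2"
    have ends: "ends_dim n t E = (\<lambda>r. if 1 \<le> r \<and> r \<le> n - 2 then cnt E r
        else if r = n - 1 \<or> r = n then if r = t then h else l else 0)" for t
      by (simp only: ends_dim_def h_def l_def)
    consider "r = n" | "r = n - 1" | "r \<noteq> n" "r \<noteq> n - 1" by blast
    then show "star n (ends_dim n n E) r = ends_dim n (n - 1) E r"
      unfolding star_def ends by cases (simp_all only: n n(1)[symmetric] fun_upd_apply simp_thms if_True if_False)
  qed
  show ?thesis
  proof (cases "\<tau> = n")
    case True
    then show ?thesis using plus by simp
  next
    case False
    then have "unit_dim \<tau> n = 0" "unit_dim n n = 1" by (simp_all add: unit_dim_def)
    then have "unit_dim \<tau> \<noteq> unit_dim n" by auto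
    moreover have "\<tau> = n - 1" using False tau by blast
    ultimately show ?thesis using plus star by (simp add: v_minus_def)
  qed
qed

lemma Y_of_ends_dim:
  assumes E: "E \<subseteq> {1..n - 1}"
  shows "length (Y_of n (unit_dim \<tau>) (vE E)) = card E"
    and "rows_before n k (Y_of n (unit_dim \<tau>) (vE E)) = card (E \<inter> {..<k})"
proof -
  have fin: "finite E" using E finite_subset by blast
  define Y where "Y = rev (sorted_list_of_set ((\<lambda>e. n - e) ` E))"
  have setY: "set Y = (\<lambda>e. n - e) ` E" using fin by (simp add: Y_def)
  have ends: "(\<lambda>l. n - l) ` set Y = E"
    unfolding setY image_image using E by (force simp: image_iff)
  have Y: "Y \<in> young n"
    unfolding young_def
  proof (intro CollectI conjI)
    show "sorted_wrt (>) Y" by (simp add: Y_def sorted_wrt_rev)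
    show "set Y \<subseteq> {1..n - 1}" using E unfolding setY by (auto dest!: subsetD)
  qed
  have "Y_of n (unit_dim \<tau>) (vE E) = Y"
    unfolding Y_of_def
  proof (rule the_equality)
    show "Y \<in> young n \<and> vE E = (if unit_dim \<tau> = unit_dim n then v_plus n Y else v_minus n Y)"
      using Y young_dim[OF Y] ends by simp
    fix Z assume "Z \<in> young n \<and> vE E = (if unit_dim \<tau> = unit_dim n then v_plus n Z else v_minus n Z)"
    then have Z: "Z \<in> young n" "vE E = vE ((\<lambda>l. n - l) ` set Z)" using young_dim by auto
    then have "(\<lambda>l. n - l) ` set Z = E"
      using ends_dim_inj[OF E young_ends(1)[OF Z(1)]] by simp
    then show "Z = Y" using young_unique[OF Z(1) Y] ends by simp
  qed
  moreover have "{e \<in> E. e < k} = E \<inter> {..<k}" by auto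
  ultimately show "length (Y_of n (unit_dim \<tau>) (vE E)) = card E"
    "rows_before n k (Y_of n (unit_dim \<tau>) (vE E)) = card (E \<inter> {..<k})"
    using young_ends(2)[OF Y] young_ends(3)[OF Y, of "\<lambda>e. e < k"] ends
    by (simp_all add: rows_before_def)
qed

end

section \<open>The correspondences on indicator functions\<close>

text \<open>The indicator function of the point \<open>\<L>(v, w)\<close>, where \<open>v\<close> is the dimension vector of the
  diagram \<open>E\<close> and \<open>w\<close> is one-dimensional at \<open>\<tau>\<close>.\<close>

definition spin_vec :: "nat \<Rightarrow> nat \<Rightarrow> nat set \<Rightarrow> qfun" where
  "spin_vec n \<tau> E = (\<lambda>(w, v, y). if w = unit_dim \<tau> \<and> v = ends_dim n \<tau> E \<and> y = std_point n \<tau> v then 1 else 0)"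

lemma pushforward_eq_0:
  assumes "\<And>T. T \<in> F_var n v w v'' \<Longrightarrow> f T = 0"
  shows "pushforward n v w v'' \<pi> f y = 0"
proof -
  have "euler_integral (subtopology (F_topology n v w v'') {T \<in> F_var n v w v''. \<pi> T = y}) f = 0"
    by (rule euler_integral_zero) (use assms in simp)
  then show ?thesis by (simp add: pushforward_def)
qed

text \<open>All functions on a point are constructible, and its Euler characteristic is 1.\<close>

lemma pushforward_point:
  assumes F: "F_var n v w v'' = {T}" and top: "topspace (F_topology n v w v'') = {T}" and y: "\<pi> T = y"
  shows "pushforward n v w v'' \<pi> f y = f T"
proof -
  let ?K = frame_coordinates and ?P = "framed_triples n v w v''" and ?q = "frame_orbit v v''"
  have q: "?q ` ?P = {T}" using top by (simp add: topspace_F_topology)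
  have "(\<lambda>_. 0) \<in> polynomials ?K" by (rule polynomials.intros(2))
  from constructible_sets.intros(1)[OF this, of ?P]
  have P: "?P \<in> constructible_sets ?K ?P" by simp
  then have "?P - ?P \<in> constructible_sets ?K ?P" by (rule constructible_sets.intros(2))
  then have empty: "{} \<in> constructible_sets ?K ?P" by simp
  have "{p \<in> ?P. f (?q p) = c} = (if f T = c then ?P else {})" for c
    using q by auto
  then have "F_constructible n v w v'' f"
    using P empty q by (simp add: F_constructible_def constructible_fun_def)
  moreover have "topspace (subtopology (F_topology n v w v'') {T \<in> F_var n v w v''. \<pi> T = y}) = {T}"
    using F top y by auto
  ultimately show ?thesis
    by (simp add: pushforward_def euler_integral_singleton)
qed

context type_D
begin

abbreviation sv where "sv \<equiv> spin_vec n \<tau>"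

lemma F_var_point:
  assumes v: "admissible n \<tau> v" and d: "admissible n \<tau> d" and vd: "\<And>i. v i = d i + v'' i"
  shows "F_var n v (unit_dim \<tau>) v'' = {std_flag n \<tau> v d}"
    and "topspace (F_topology n v (unit_dim \<tau>) v'') = {std_flag n \<tau> v d}"
proof -
  have dv: "v \<in> dim_vectors n" using v by (simp add: admissible_def)
  have "d' = d" if "\<forall>i. d' i + v'' i = v i" for d'
  proof
    fix i show "d' i = d i" using that vd[of i] by (metis add_right_cancel)
  qed
  then show F: "F_var n v (unit_dim \<tau>) v'' = {std_flag n \<tau> v d}"
    unfolding F_var_standard(1)[OF dv] using v d vd by auto
  then show "topspace (F_topology n v (unit_dim \<tau>) v'') = {std_flag n \<tau> v d}"
    unfolding F_var_standard(2)[OF dv] .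
qed

lemma F_var_empty:
  assumes "v \<in> dim_vectors n" "\<not> (admissible n \<tau> v \<and> (\<exists>d. admissible n \<tau> d \<and> (\<forall>i. v i = d i + v'' i)))"
  shows "F_var n v (unit_dim \<tau>) v'' = {}"
proof -
  have "\<not> (admissible n \<tau> v \<and> admissible n \<tau> d \<and> (\<forall>i. d i + v'' i = v i))" for d
    using assms(2) by metis
  then show ?thesis unfolding F_var_standard(1)[OF assms(1)] by blast
qed

text \<open>The fibre over a point is the single flag with dimension vectors \<open>v\<close> and \<open>vE E\<close> if both are
  admissible, so the correspondence is an indicator function. The formula leaves open whether \<open>v\<close>
  belongs to a diagram, which covers the case that the result is zero. The scalar \<open>c\<close> is part of
  the statement because linearity of \<open>\<pi>\<^sub>!\<close> is not immediate from its definition.\<close>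

lemma corr_up_spin_vec:
  assumes E: "E \<subseteq> {1..n - 1}"
  shows "corr_up n v'' (cscale c (sv E)) (w, v, y) =
    (if w = unit_dim \<tau> \<and> admissible n \<tau> v \<and> (\<forall>i. v i = vE E i + v'' i) \<and> y = std_point n \<tau> v then c else 0)"
    (is "?L = (if ?C then c else 0)")
proof -
  let ?f = "\<lambda>T. cscale c (sv E) (w, (\<lambda>i. v i - v'' i), pi1 n v w T)"
  have L: "?L = (if v \<in> dim_vectors n \<and> y \<in> L_var n v w then pushforward n v w v'' pi2 ?f y else 0)"
    by (simp add: corr_up_def)
  show ?thesis
  proof (cases ?C)
    case True
    then have w: "w = unit_dim \<tau>" and v: "admissible n \<tau> v" and vd: "\<And>i. v i = vE E i + v'' i"
      and y: "y = std_point n \<tau> v" by simp_all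
    note d = admissible_ends_dim[OF E]
    have dv: "v \<in> dim_vectors n" using v by (simp add: admissible_def)
    have "y \<in> L_var n v w" using v y unfolding w L_var_standard[OF dv] by simp
    then have "?L = pushforward n v w v'' pi2 ?f y" using L dv by simp
    also have "\<dots> = ?f (std_flag n \<tau> v (vE E))"
      unfolding w using F_var_point[OF v d vd] pi2_std_flag y by (intro pushforward_point) simp_all
    also have "\<dots> = c"
    proof -
      have "(\<lambda>i. v i - v'' i) = vE E" using vd by auto
      moreover have "pi1 n v w (std_flag n \<tau> v (vE E)) = std_point n \<tau> (vE E)"
        unfolding w by (rule pi1_std_flag[OF v d]) (simp add: vd)
      ultimately show ?thesis by (simp add: cscale_def spin_vec_def w)
    qed
    finally show ?thesis using True by simp
  next
    case False
    have "?L = 0"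
    proof (cases "v \<in> dim_vectors n \<and> y \<in> L_var n v w")
      case dv: True
      have "?f T = 0" if T: "T \<in> F_var n v w v''" for T
      proof (rule ccontr)
        assume "?f T \<noteq> 0"
        then have w: "w = unit_dim \<tau>" and eq: "(\<lambda>i. v i - v'' i) = vE E"
          by (auto simp: cscale_def spin_vec_def split: if_splits)
        have "y \<in> L_var n v (unit_dim \<tau>)" using dv w by simp
        then have v: "admissible n \<tau> v" "y = std_point n \<tau> v"
          using dv by (simp_all add: L_var_standard split: if_splits)
        obtain d where d: "\<And>i. v i = d i + v'' i"
          using F_var_empty[of v v''] dv T unfolding w by blast
        have "v i = vE E i + v'' i" for i
          using fun_cong[OF eq, of i] d[of i] by simp
        then show False using False w v by blast
      qed
      then have "pushforward n v w v'' pi2 ?f y = 0" by (rule pushforward_eq_0)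
      then show ?thesis using L by simp
    next
      case dv: False
      show ?thesis unfolding L by (rule if_not_P[OF dv])
    qed
    then show ?thesis unfolding if_not_P[OF False] .
  qed
qed

lemma corr_down_spin_vec:
  assumes E: "E \<subseteq> {1..n - 1}"
  shows "corr_down n v'' (cscale c (sv E)) (w, u, y) =
    (if w = unit_dim \<tau> \<and> admissible n \<tau> u \<and> (\<forall>i. vE E i = u i + v'' i) \<and> y = std_point n \<tau> u then c else 0)"
    (is "?L = (if ?C then c else 0)")
proof -
  let ?v = "\<lambda>i. u i + v'' i"
  let ?f = "\<lambda>T. cscale c (sv E) (w, ?v, pi2 T)"
  have L: "?L = (if u \<in> dim_vectors n \<and> y \<in> L_var n u w then pushforward n ?v w v'' (pi1 n ?v w) ?f y else 0)"
    by (simp add: corr_down_def Let_def)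
  show ?thesis
  proof (cases ?C)
    case True
    then have w: "w = unit_dim \<tau>" and u: "admissible n \<tau> u" and vu: "\<And>i. vE E i = u i + v'' i"
      and y: "y = std_point n \<tau> u" by simp_all
    have v_eq: "?v = vE E" using vu by auto
    have v: "admissible n \<tau> ?v" unfolding v_eq by (rule admissible_ends_dim[OF E])
    have du: "u \<in> dim_vectors n" using u by (simp add: admissible_def)
    have "y \<in> L_var n u w" using u y unfolding w L_var_standard[OF du] by simp
    then have "?L = pushforward n ?v w v'' (pi1 n ?v w) ?f y" using L du by simp
    also have "\<dots> = ?f (std_flag n \<tau> ?v u)"
    proof (rule pushforward_point)
      show "F_var n ?v w v'' = {std_flag n \<tau> ?v u}" "topspace (F_topology n ?v w v'') = {std_flag n \<tau> ?v u}"
        unfolding w by (rule F_var_point[OF v u refl])+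
      show "pi1 n ?v w (std_flag n \<tau> ?v u) = y"
        unfolding w y by (rule pi1_std_flag[OF v u]) simp
    qed
    also have "\<dots> = c"
      unfolding pi2_std_flag v_eq by (simp add: cscale_def spin_vec_def w)
    finally show ?thesis using True by simp
  next
    case False
    have "?L = 0"
    proof (cases "u \<in> dim_vectors n \<and> y \<in> L_var n u w")
      case du: True
      have "?f T = 0" for T
      proof (rule ccontr)
        assume "?f T \<noteq> 0"
        then have w: "w = unit_dim \<tau>" and eq: "?v = vE E"
          by (auto simp: cscale_def spin_vec_def split: if_splits)
        have "y \<in> L_var n u (unit_dim \<tau>)" using du w by simp
        then have u: "admissible n \<tau> u" "y = std_point n \<tau> u"
          using du by (simp_all add: L_var_standard split: if_splits)
        have "vE E i = u i + v'' i" for i using fun_cong[OF eq, of i] by simp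
        then show False using False w u by blast
      qed
      then have "pushforward n ?v w v'' (pi1 n ?v w) ?f y = 0" by (rule pushforward_eq_0)
      then show ?thesis using L by simp
    next
      case du: False
      show ?thesis unfolding L by (rule if_not_P[OF du])
    qed
    then show ?thesis unfolding if_not_P[OF False] .
  qed
qed

lemma corr_up_eqI:
  assumes "E \<subseteq> {1..n - 1}" "\<And>i. vE E' i = vE E i + v'' i" "E' \<subseteq> {1..n - 1}"
  shows "corr_up n v'' (cscale c (sv E)) = cscale c (sv E')"
proof (rule ext, clarify)
  fix w v y
  have "(admissible n \<tau> v \<and> (\<forall>i. v i = vE E i + v'' i)) \<longleftrightarrow> v = vE E'"
  proof -
    have "(\<forall>i. v i = vE E i + v'' i) \<longleftrightarrow> v = vE E'" by (simp add: fun_eq_iff assms(2))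
    then show ?thesis using admissible_ends_dim[OF assms(3)] by blast
  qed
  then show "corr_up n v'' (cscale c (sv E)) (w, v, y) = cscale c (sv E') (w, v, y)"
    unfolding corr_up_spin_vec[OF assms(1)] by (auto simp: cscale_def spin_vec_def)
qed

lemma corr_up_eq_0:
  assumes "E \<subseteq> {1..n - 1}" "\<And>E'. E' \<subseteq> {1..n - 1} \<Longrightarrow> \<not> (\<forall>i. vE E' i = vE E i + v'' i)"
  shows "corr_up n v'' (cscale c (sv E)) = 0"
proof (rule ext, clarify)
  fix w v y
  have "\<not> (admissible n \<tau> v \<and> (\<forall>i. v i = vE E i + v'' i))"
    using assms(2) unfolding admissible_iff by blast
  then show "corr_up n v'' (cscale c (sv E)) (w, v, y) = 0 (w, v, y)"
    unfolding corr_up_spin_vec[OF assms(1)] by (auto simp: zero_fun_apply)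
qed

lemma corr_down_eqI:
  assumes "E \<subseteq> {1..n - 1}" "\<And>i. vE E i = vE E' i + v'' i" "E' \<subseteq> {1..n - 1}"
  shows "corr_down n v'' (cscale c (sv E)) = cscale c (sv E')"
proof (rule ext, clarify)
  fix w u y
  have "(admissible n \<tau> u \<and> (\<forall>i. vE E i = u i + v'' i)) \<longleftrightarrow> u = vE E'"
  proof -
    have "(\<forall>i. vE E i = u i + v'' i) \<longleftrightarrow> u = vE E'" by (auto simp: fun_eq_iff assms(2))
    then show ?thesis using admissible_ends_dim[OF assms(3)] by blast
  qed
  then show "corr_down n v'' (cscale c (sv E)) (w, u, y) = cscale c (sv E') (w, u, y)"
    unfolding corr_down_spin_vec[OF assms(1)] by (auto simp: cscale_def spin_vec_def)
qed

lemma corr_down_eq_0: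
  assumes "E \<subseteq> {1..n - 1}" "\<And>E'. E' \<subseteq> {1..n - 1} \<Longrightarrow> \<not> (\<forall>i. vE E i = vE E' i + v'' i)"
  shows "corr_down n v'' (cscale c (sv E)) = 0"
proof (rule ext, clarify)
  fix w u y
  have "\<not> (admissible n \<tau> u \<and> (\<forall>i. vE E i = u i + v'' i))"
    using assms(2) unfolding admissible_iff by blast
  then show "corr_down n v'' (cscale c (sv E)) (w, u, y) = 0 (w, u, y)"
    unfolding corr_down_spin_vec[OF assms(1)] by (auto simp: zero_fun_apply)
qed

lemma y_dim_neq_z_dim:
  assumes "1 \<le> k" "k \<le> n - 1"
  shows "y_dim n k \<noteq> z_dim n k"
proof
  assume eq: "y_dim n k = z_dim n k"
  have "\<not> n \<le> n - 1" using n4 by linarith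
  then have "y_dim n k n = 0" "z_dim n k n = 1" by (simp_all add: y_dim_def z_dim_def)
  then show False using eq by simp
qed

text \<open>Since exactly one of \<open>y\<^sup>k\<close> and \<open>z\<^sup>k\<close> is the difference of the dimension vectors with and without the
  endpoint \<open>k\<close>, only one summand of the operators on the union of the two correspondences survives.\<close>

lemma ends_dim_difference:
  assumes k: "1 \<le> k" "k \<le> n - 1" and E: "E \<subseteq> {1..n - 1}" "k \<in> E"
  shows "\<exists>u u'. {u, u'} = {y_dim n k, z_dim n k} \<and> u \<noteq> u' \<and> (\<forall>i. vE E i = vE (E - {k}) i + u i) \<and>
    \<not> (\<forall>i. vE E i = vE (E - {k}) i + u' i)"
proof -
  have d: "\<forall>i. vE E i = vE (E - {k}) i + diff_dim k E i"
    using ends_dim_delete[OF E] by blast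
  have uniq: "u = diff_dim k E" if "\<forall>i. vE E i = vE (E - {k}) i + u i" for u
  proof
    fix i show "u i = diff_dim k E i" using d that by (metis add_left_cancel)
  qed
  consider "diff_dim k E = y_dim n k" | "diff_dim k E = z_dim n k"
    using diff_dim_eq[OF k, of E] by presburger
  then show ?thesis
  proof cases
    case 1
    have "\<not> (\<forall>i. vE E i = vE (E - {k}) i + z_dim n k i)"
      using uniq[of "z_dim n k"] 1 y_dim_neq_z_dim[OF k] by force
    then show ?thesis
      using y_dim_neq_z_dim[OF k] d unfolding 1 by blast
  next
    case 2
    have "\<not> (\<forall>i. vE E i = vE (E - {k}) i + y_dim n k i)"
      using uniq[of "y_dim n k"] 2 y_dim_neq_z_dim[OF k] by force
    moreover have "{z_dim n k, y_dim n k} = {y_dim n k, z_dim n k}" by (rule insert_commute)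
    ultimately show ?thesis
      using y_dim_neq_z_dim[OF k, symmetric] d unfolding 2 by blast
  qed
qed

lemma corr_up_sum:
  assumes k: "1 \<le> k" "k \<le> n - 1" and E: "E \<subseteq> {1..n - 1}"
  shows "corr_up n (y_dim n k) (cscale c (sv E)) + corr_up n (z_dim n k) (cscale c (sv E)) =
    (if k \<in> E then 0 else cscale c (sv (insert k E)))"
proof -
  have imp: "k \<in> E' \<and> E = E' - {k}" if "E' \<subseteq> {1..n - 1}" "\<forall>i. vE E' i = vE E i + u i"
    "u \<in> {y_dim n k, z_dim n k}" for E' u
    using ends_dim_eq_imp[OF that(1) E k, of u] that(2,3) by blast
  show ?thesis
  proof (cases "k \<in> E")
    case True
    have "corr_up n u (cscale c (sv E)) = 0" if "u \<in> {y_dim n k, z_dim n k}" for u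
      by (rule corr_up_eq_0[OF E]) (use imp that True in blast)
    then show ?thesis using True by simp
  next
    case False
    define E' where "E' = insert k E"
    have E': "E' \<subseteq> {1..n - 1}" "k \<in> E'" and E'E: "E' - {k} = E" using E k False by (auto simp: E'_def)
    obtain u u' where uu: "{u, u'} = {y_dim n k, z_dim n k}" and "u \<noteq> u'"
      and u: "\<forall>i. vE E' i = vE E i + u i" and u': "\<not> (\<forall>i. vE E' i = vE E i + u' i)"
      using ends_dim_difference[OF k E'] unfolding E'E by blast
    have 1: "corr_up n u (cscale c (sv E)) = cscale c (sv E')"
      by (rule corr_up_eqI[OF E _ E'(1)]) (use u in blast)
    have 2: "corr_up n u' (cscale c (sv E)) = 0"
    proof (rule corr_up_eq_0[OF E])
      fix E'' assume E'': "E'' \<subseteq> {1..n - 1}"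
      show "\<not> (\<forall>i. vE E'' i = vE E i + u' i)"
      proof
        assume *: "\<forall>i. vE E'' i = vE E i + u' i"
        have "u' \<in> {y_dim n k, z_dim n k}" using uu by blast
        then have "k \<in> E'' \<and> E = E'' - {k}" by (rule imp[OF E'' *])
        then have "E'' = E'" by (auto simp: E'_def)
        then show False using * u' by blast
      qed
    qed
    have "corr_up n (y_dim n k) (cscale c (sv E)) + corr_up n (z_dim n k) (cscale c (sv E)) =
        corr_up n u (cscale c (sv E)) + corr_up n u' (cscale c (sv E))"
      using uu unfolding doubleton_eq_iff by (auto simp: add.commute)
    then show ?thesis using 1 2 False by (simp add: E'_def)
  qed
qed

lemma corr_down_sum:
  assumes k: "1 \<le> k" "k \<le> n - 1" and E: "E \<subseteq> {1..n - 1}"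
  shows "corr_down n (y_dim n k) (cscale c (sv E)) + corr_down n (z_dim n k) (cscale c (sv E)) =
    (if k \<in> E then cscale c (sv (E - {k})) else 0)"
proof -
  have imp: "k \<in> E \<and> E' = E - {k}" if "E' \<subseteq> {1..n - 1}" "\<forall>i. vE E i = vE E' i + u i"
    "u \<in> {y_dim n k, z_dim n k}" for E' u
    using ends_dim_eq_imp[OF E that(1) k, of u] that(2,3) by blast
  show ?thesis
  proof (cases "k \<in> E")
    case False
    have "corr_down n u (cscale c (sv E)) = 0" if "u \<in> {y_dim n k, z_dim n k}" for u
      by (rule corr_down_eq_0[OF E]) (use imp that False in blast)
    then show ?thesis using False by simp
  next
    case True
    have E': "E - {k} \<subseteq> {1..n - 1}" using E by blast
    obtain u u' where uu: "{u, u'} = {y_dim n k, z_dim n k}" and "u \<noteq> u'"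
      and u: "\<forall>i. vE E i = vE (E - {k}) i + u i" and u': "\<not> (\<forall>i. vE E i = vE (E - {k}) i + u' i)"
      using ends_dim_difference[OF k E True] by blast
    have 1: "corr_down n u (cscale c (sv E)) = cscale c (sv (E - {k}))"
      by (rule corr_down_eqI[OF E _ E']) (use u in blast)
    have 2: "corr_down n u' (cscale c (sv E)) = 0"
    proof (rule corr_down_eq_0[OF E])
      fix E'' assume E'': "E'' \<subseteq> {1..n - 1}"
      show "\<not> (\<forall>i. vE E i = vE E'' i + u' i)"
      proof
        assume *: "\<forall>i. vE E i = vE E'' i + u' i"
        have "u' \<in> {y_dim n k, z_dim n k}" using uu by blast
        then have "k \<in> E \<and> E'' = E - {k}" by (rule imp[OF E'' *])
        then show False using * u' by blast
      qed
    qed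
    have "corr_down n (y_dim n k) (cscale c (sv E)) + corr_down n (z_dim n k) (cscale c (sv E)) =
        corr_down n u (cscale c (sv E)) + corr_down n u' (cscale c (sv E))"
      using uu unfolding doubleton_eq_iff by (auto simp: add.commute)
    then show ?thesis using 1 2 True by simp
  qed
qed

lemma vacuum_eq: "vacuum n (unit_dim \<tau>) = sv {}"
proof (rule ext, clarify)
  fix w v y
  have adm: "admissible n \<tau> (\<lambda>_. 0)" using admissible_ends_dim[of "{}"] by (simp add: ends_dim_empty)
  then have "(\<lambda>_. 0) \<in> dim_vectors n" by (simp add: admissible_def)
  from L_var_standard[OF this] show "vacuum n (unit_dim \<tau>) (w, v, y) = sv {} (w, v, y)"
    using adm by (auto simp: vacuum_def spin_vec_def ends_dim_empty)
qed

lemma F_monomials_spin_vec: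
  assumes "f \<in> F_monomials n (unit_dim \<tau>)"
  shows "f = 0 \<or> (\<exists>E\<subseteq>{1..n - 1}. f = sv E)"
  using assms
proof (induction rule: F_monomials.induct)
  case 1
  then show ?case using vacuum_eq by blast
next
  case (2 f k)
  from 2(3) show ?case
  proof
    assume "f = 0"
    then have f: "f = cscale 0 (sv {})" by simp
    have "F_op n k f = 0"
      unfolding F_op_def f
    proof (rule ext, clarify)
      fix w v y
      show "corr_up n (unit_dim k) (cscale 0 (sv {})) (w, v, y) = 0 (w, v, y)"
        unfolding corr_up_spin_vec[OF empty_subsetI] by (simp add: zero_fun_apply)
    qed
    then show ?thesis by simp
  next
    assume "\<exists>E\<subseteq>{1..n - 1}. f = sv E"
    then obtain E where E: "E \<subseteq> {1..n - 1}" and f: "f = cscale 1 (sv E)" by auto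
    show ?thesis
    proof (cases "\<exists>E'\<subseteq>{1..n - 1}. \<forall>i. vE E' i = vE E i + unit_dim k i")
      case True
      then obtain E' where E': "E' \<subseteq> {1..n - 1}" "\<And>i. vE E' i = vE E i + unit_dim k i" by blast
      have "F_op n k f = sv E'"
        unfolding F_op_def f corr_up_eqI[OF E E'(2,1)] by simp
      then show ?thesis using E'(1) by blast
    next
      case False
      have "F_op n k f = 0"
        unfolding F_op_def f by (rule corr_up_eq_0[OF E]) (use False in blast)
      then show ?thesis by simp
    qed
  qed
qed

text \<open>Each diagram arises from the empty one by adding cells, that is, by applying operators
  \<open>F\<^sub>k\<close>.\<close>

lemma spin_vec_F_monomials:
  assumes "E \<subseteq> {1..n - 1}"
  shows "sv E \<in> F_monomials n (unit_dim \<tau>)"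
  using assms
proof (induction "\<Sum>i\<in>{1..n}. vE E i" arbitrary: E rule: less_induct)
  case less
  show ?case
  proof (cases "E = {}")
    case True
    then show ?thesis using F_monomials.intros(1)[of n "unit_dim \<tau>"] by (simp add: vacuum_eq)
  next
    case False
    obtain k E' where k: "k \<in> {1..n}" and E': "E' \<subseteq> {1..n - 1}"
      and eq: "\<And>i. vE E i = vE E' i + unit_dim k i"
      using ends_dim_predecessor[OF less.prems False] by blast
    have "(\<Sum>i\<in>{1..n}. unit_dim k i) = 1"
      using k by (simp add: unit_dim_def)
    then have "(\<Sum>i\<in>{1..n}. vE E' i) < (\<Sum>i\<in>{1..n}. vE E i)"
      unfolding eq sum.distrib by simp
    then have "sv E' \<in> F_monomials n (unit_dim \<tau>)" by (rule less.hyps[OF _ E'])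
    then have "F_op n k (sv E') \<in> F_monomials n (unit_dim \<tau>)" by (rule F_monomials.intros(2)[OF _ k])
    moreover have "F_op n k (sv E') = sv E"
      using corr_up_eqI[OF E' eq less.prems, of 1] by (simp add: F_op_def)
    ultimately show ?thesis by simp
  qed
qed

lemma L_module_eq_span: "L_module n (unit_dim \<tau>) = cfun.span (sv ` Pow {1..n - 1})"
  unfolding L_module_def
proof (rule subset_antisym)
  show "cfun.span (F_monomials n (unit_dim \<tau>)) \<subseteq> cfun.span (sv ` Pow {1..n - 1})"
  proof (rule cfun.span_minimal[OF _ cfun.subspace_span], rule subsetI)
    fix f assume "f \<in> F_monomials n (unit_dim \<tau>)"
    then have "f = 0 \<or> (\<exists>E\<subseteq>{1..n - 1}. f = sv E)" by (rule F_monomials_spin_vec)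
    then show "f \<in> cfun.span (sv ` Pow {1..n - 1})"
      by (auto intro: cfun.span_zero cfun.span_base)
  qed
  show "cfun.span (sv ` Pow {1..n - 1}) \<subseteq> cfun.span (F_monomials n (unit_dim \<tau>))"
    by (rule cfun.span_mono) (use spin_vec_F_monomials in blast)
qed

end

section \<open>The involution exchanging the two end vertices\<close>

definition swap_rep :: "nat \<Rightarrow> edge_maps \<times> vertex_maps \<Rightarrow> edge_maps \<times> vertex_maps" where
  "swap_rep n = (\<lambda>(x, j). (x \<circ> map_prod (swap_vertex n) (swap_vertex n), j \<circ> swap_vertex n))"

lemma swap_vertex_twice: "swap_vertex n (swap_vertex n r) = r"
  by (auto simp: swap_vertex_def)

lemma star_eq: "star n v = v \<circ> swap_vertex n"
  by (auto simp: star_def swap_vertex_def fun_eq_iff)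

lemma star_star: "star n (star n v) = v"
  by (simp add: star_eq fun_eq_iff swap_vertex_twice)

lemma swap_rep_twice: "swap_rep n (swap_rep n t) = t"
  by (cases t) (simp add: swap_rep_def fun_eq_iff swap_vertex_twice)

lemma kappa_eq: "kappa n y = swap_rep n ` y"
  by (simp add: kappa_def swap_rep_def)

lemma kappa_kappa: "kappa n (kappa n y) = y"
  by (simp add: kappa_eq image_image swap_rep_twice)

lemma kappa_G_orbit: "kappa n (G_orbit v t) = G_orbit (star n v) (swap_rep n t)"
proof -
  have act: "swap_rep n (act_x v g x, act_j v g j) =
      (act_x (star n v) (g \<circ> swap_vertex n) (fst (swap_rep n (x, j))),
       act_j (star n v) (g \<circ> swap_vertex n) (snd (swap_rep n (x, j))))" for g x j
    by (simp add: swap_rep_def act_x_def act_j_def star_eq fun_eq_iff)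
  have G: "G_V (star n v) = (\<lambda>g. g \<circ> swap_vertex n) ` G_V v"
  proof (rule subset_antisym; rule subsetI)
    fix g assume "g \<in> G_V (star n v)"
    then have "g \<circ> swap_vertex n \<in> G_V v"
      by (auto simp: G_V_def star_eq) (metis swap_vertex_twice)
    moreover have "g = (g \<circ> swap_vertex n) \<circ> swap_vertex n"
      by (simp add: fun_eq_iff swap_vertex_twice)
    ultimately show "g \<in> (\<lambda>g. g \<circ> swap_vertex n) ` G_V v" by blast
  next
    fix g assume "g \<in> (\<lambda>g. g \<circ> swap_vertex n) ` G_V v"
    then show "g \<in> G_V (star n v)" by (auto simp: G_V_def star_eq)
  qed
  obtain x j where t: "t = (x, j)" by (cases t)
  show ?thesis
    unfolding kappa_eq t G_orbit_eq G image_image fst_conv snd_conv act ..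
qed

context type_D
begin

abbreviation sw where "sw \<equiv> swap_vertex n"

lemma sw_tau: "sw \<tau> = other" "sw other = \<tau>"
proof -
  have n: "n - 1 \<noteq> n" using n4 by simp
  have "sw n = n - 1" "sw (n - 1) = n" using n by (simp_all add: swap_vertex_def)
  then show "sw \<tau> = other" "sw other = \<tau>"
    by (cases rule: tau_cases; metis)+
qed

lemma sw_fix: "r \<noteq> \<tau> \<Longrightarrow> r \<noteq> other \<Longrightarrow> sw r = r"
  using other(3)[of r] by (simp add: swap_vertex_def)

lemma sw_mid: "r \<le> n - 2 \<Longrightarrow> sw r = r"
  using ends_beyond by (intro sw_fix) metis+

lemma type_D_other: "type_D n other"
  using n4 other(1) by unfold_locales

lemma row_index_sw: "row_index n other r k = row_index n \<tau> (sw r) k"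
proof -
  consider "r = \<tau>" | "r = other" | "r \<noteq> \<tau>" "r \<noteq> other" by blast
  then show ?thesis
    unfolding row_index_def other(3)
    by cases (simp_all only: sw_tau sw_fix other(2) other(2)[symmetric] simp_thms if_True if_False)
qed

lemma orientation_sw: "(sw a, sw b) \<in> orientation n \<longleftrightarrow> (a, b) \<in> orientation n"
proof -
  have "(sw a, sw b) \<in> orientation n" if "(a, b) \<in> orientation n" for a b
  proof -
    have "(a, b) \<in> arrows n" using that by (simp add: arrows_def)
    then show ?thesis
    proof (cases rule: arrow_cases)
      case (up r)
      then show ?thesis using that by (simp add: sw_mid)
    next
      case (down r)
      then show ?thesis using that by (simp add: sw_mid)
    next
      case (end_up r)
      have "sw r = n - 1 \<or> sw r = n"
        using end_up(2) unfolding other(3) using sw_tau by metis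
      then show ?thesis using end_up(1) orientation_mem(3)[of "sw r"] by (simp add: sw_mid)
    next
      case (end_down r)
      then show ?thesis using that orientation_mem(4)[of r] by simp
    qed
  qed
  from this[of a b] this[of "sw a" "sw b"] show ?thesis by (auto simp: swap_vertex_twice)
qed

lemma arrows_sw: "(sw a, sw b) \<in> arrows n \<longleftrightarrow> (a, b) \<in> arrows n"
  by (simp add: arrows_iff orientation_sw)

lemma swap_rep_std: "swap_rep n (std_x n \<tau> v, std_j \<tau> v) = (std_x n other (star n v), std_j other (star n v))"
proof -
  have "std_x n \<tau> v (sw a, sw b) = std_x n other (star n v) (a, b)" for a b
    by (simp add: std_x_def arrows_sw row_shift_def orientation_sw row_index_sw star_eq)
  then have "std_x n \<tau> v \<circ> map_prod sw sw = std_x n other (star n v)"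
    by (simp add: fun_eq_iff)
  moreover have "sw r = \<tau> \<longleftrightarrow> r = other" for r
    using sw_tau by (metis swap_vertex_twice)
  then have "std_j \<tau> v \<circ> sw = std_j other (star n v)"
    by (simp add: std_j_def fun_eq_iff star_eq sw_tau)
  ultimately show ?thesis by (simp add: swap_rep_def)
qed

text \<open>The construction of the coordinate module for \<open>\<tau>\<close> turns into the one for the other end
  vertex when the two vertices are exchanged.\<close>

lemma kappa_std_point: "kappa n (std_point n \<tau> v) = std_point n other (star n v)"
  by (simp add: std_point_def kappa_G_orbit swap_rep_std)

lemma star_unit_dim: "star n (unit_dim \<tau>) = unit_dim other"
proof -
  have "sw r = \<tau> \<longleftrightarrow> r = other" for r
    using sw_tau by (metis swap_vertex_twice)
  then show ?thesis by (simp add: star_eq unit_dim_def fun_eq_iff)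
qed

lemma star_ends_dim: "star n (vE E) = ends_dim n other E"
proof
  fix r
  interpret o: type_D n other by (rule type_D_other)
  have oo: "o.other = \<tau>" unfolding o.other_def unfolding other_def using tau n4 by linarith
  show "star n (vE E) r = ends_dim n other E r"
  proof (cases r rule: vertex_cases)
    case 1
    then have "r \<noteq> \<tau>" "r \<noteq> other" using ends_range by metis+
    then show ?thesis using 1 by (simp add: star_eq sw_fix ends_dim_simps(4) o.ends_dim_simps(4))
  next
    case 2
    then show ?thesis by (simp add: star_eq sw_mid ends_dim_simps(1) o.ends_dim_simps(1))
  next
    case 3
    then show ?thesis using o.ends_dim_simps(3)[of E] by (simp add: star_eq sw_tau ends_dim_simps(3) oo)
  next
    case 4
    then show ?thesis using o.ends_dim_simps(2)[of E] by (simp add: star_eq sw_tau ends_dim_simps(2))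
  qed
qed

lemma kappa_pullback_spin_vec:
  "kappa_pullback n (cscale c (sv E)) = cscale c (spin_vec n other E)"
proof (rule ext, clarify)
  fix w v y
  have "star n w = unit_dim \<tau> \<longleftrightarrow> w = unit_dim other"
    using star_star star_unit_dim by metis
  moreover have "star n v = vE E \<longleftrightarrow> v = ends_dim n other E"
    using star_star star_ends_dim by metis
  moreover have "kappa n y = std_point n \<tau> (star n v) \<longleftrightarrow> y = std_point n other v"
    using kappa_kappa kappa_std_point star_star by metis
  ultimately show "kappa_pullback n (cscale c (sv E)) (w, v, y) = cscale c (spin_vec n other E) (w, v, y)"
    by (simp add: kappa_pullback_def cscale_def spin_vec_def)
qed

lemma kappa_pullback_0: "kappa_pullback n 0 = 0"
  by (simp add: kappa_pullback_def fun_eq_iff zero_fun_apply)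

section \<open>The operators on indicator functions\<close>

lemma a_hom_spin_vec:
  assumes E: "E \<subseteq> {1..n - 1}" and k: "1 \<le> k" "k \<le> n - 1"
  shows "a_hom n k (unit_dim \<tau>) (vE E) (cscale c (sv E)) =
    (if k \<in> E then cscale (fsign k E * c) (spin_vec n other (E - {k})) else 0)"
proof -
  have "k \<noteq> n" using k n4 by simp
  then have "a_hom n k (unit_dim \<tau>) (vE E) (cscale c (sv E)) = cscale (fsign k E)
      (kappa_pullback n (if k \<in> E then cscale c (sv (E - {k})) else 0))"
    unfolding a_hom_def Let_def Y_of_ends_dim[OF E] corr_down_sum[OF k E] fsign_def by simp
  then show ?thesis by (simp add: kappa_pullback_spin_vec kappa_pullback_0)
qed

lemma b_hom_spin_vec:
  assumes E: "E \<subseteq> {1..n - 1}" and k: "1 \<le> k" "k \<le> n - 1"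
  shows "b_hom n k (unit_dim \<tau>) (vE E) (cscale c (sv E)) =
    (if k \<in> E then 0 else cscale (fsign k E * c) (spin_vec n other (insert k E)))"
proof -
  have "k \<noteq> n" using k n4 by simp
  then have "b_hom n k (unit_dim \<tau>) (vE E) (cscale c (sv E)) = cscale (fsign k E)
      (kappa_pullback n (if k \<in> E then 0 else cscale c (sv (insert k E))))"
    unfolding b_hom_def Let_def Y_of_ends_dim[OF E] corr_up_sum[OF k E] fsign_def by simp
  then show ?thesis by (simp add: kappa_pullback_spin_vec kappa_pullback_0)
qed

lemma unit_dim_tau: "unit_dim \<tau> n = (if \<tau> = n then 1 else 0)"
  by (simp add: unit_dim_def)

lemma a_hom_last:
  assumes E: "E \<subseteq> {1..n - 1}"
  shows "a_hom n n (unit_dim \<tau>) (vE E) (cscale c (sv E)) =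
    (if \<tau> = n \<longleftrightarrow> odd (card E) then cscale ((-1) ^ card E * c) (spin_vec n other E) else 0)"
  unfolding a_hom_def Let_def Y_of_ends_dim[OF E] unit_dim_tau
  by (simp add: kappa_pullback_spin_vec)

lemma b_hom_last:
  assumes E: "E \<subseteq> {1..n - 1}"
  shows "b_hom n n (unit_dim \<tau>) (vE E) (cscale c (sv E)) =
    (if \<tau> = n \<longleftrightarrow> odd (card E) then 0 else cscale ((-1) ^ card E * c) (spin_vec n other E))"
  unfolding b_hom_def Let_def Y_of_ends_dim[OF E] unit_dim_tau
  by (simp add: kappa_pullback_spin_vec)

end

section \<open>The spin module as a Fock space\<close>

text \<open>The basis vector at \<open>F \<subseteq> {1..n}\<close> is the indicator function of the point whose diagram has the
  endpoints \<open>F - {n}\<close>; whether \<open>n \<in> F\<close> is encoded by the choice of \<open>w\<close>, according to the parity of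
  \<open>F\<close>.\<close>

definition spin_vertex :: "nat \<Rightarrow> nat set \<Rightarrow> nat" where
  "spin_vertex n F = (if even (card F) then n else n - 1)"

definition spin_basis :: "nat \<Rightarrow> nat set \<Rightarrow> qfun" where
  "spin_basis n F = spin_vec n (spin_vertex n F) (F - {n})"

definition fock_to_spin :: "nat \<Rightarrow> fock \<Rightarrow> qfun" where
  "fock_to_spin n f = (\<Sum>F\<in>Pow {1..n}. cscale (f F) (spin_basis n F))"

lemma fock_to_spin_linear:
  "fock_to_spin n (f + g) = fock_to_spin n f + fock_to_spin n g"
  "fock_to_spin n (cscale c f) = cscale c (fock_to_spin n f)"
  "fock_to_spin n 0 = 0"
proof -
  show "fock_to_spin n (f + g) = fock_to_spin n f + fock_to_spin n g" "fock_to_spin n 0 = 0"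
    by (simp_all add: fock_to_spin_def plus_fun_apply zero_fun_apply cfun.scale_left_distrib sum.distrib)
  have "cscale (cscale c f F) p = cscale c (cscale (f F) p)" for F and p :: qfun
    by (simp add: cscale_def mult.assoc)
  then show "fock_to_spin n (cscale c f) = cscale c (fock_to_spin n f)"
    unfolding fock_to_spin_def by (simp only: cfun.scale_sum_right)
qed

lemma fock_to_spin_sum: "fock_to_spin n (sum g A) = (\<Sum>i\<in>A. fock_to_spin n (g i))"
  by (induction A rule: infinite_finite_induct) (simp_all add: fock_to_spin_linear)

lemma fock_to_spin_basis:
  assumes "F \<subseteq> {1..n}"
  shows "fock_to_spin n (fock_basis F) = spin_basis n F"
proof -
  have "fock_to_spin n (fock_basis F) = (\<Sum>G\<in>Pow {1..n}. if G = F then spin_basis n F else 0)"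
    unfolding fock_to_spin_def by (rule sum.cong) (auto simp: fock_basis_def)
  then show ?thesis using assms by (simp add: sum.delta)
qed

lemma fock_act_a_basis:
  "fock_act (gen_a k) (fock_basis F) = (if k \<in> F then cscale (fsign k F) (fock_basis (F - {k})) else 0)"
proof
  fix G
  have "k \<in> F \<Longrightarrow> fsign k (F - {k}) = fsign k F" by (simp add: fsign_delete)
  moreover have "k \<notin> G \<and> insert k G = F \<longleftrightarrow> k \<in> F \<and> G = F - {k}" by blast
  ultimately show "fock_act (gen_a k) (fock_basis F) G =
      (if k \<in> F then cscale (fsign k F) (fock_basis (F - {k})) else 0) G"
    by (auto simp: fock_act.simps fock_basis_def cscale_def zero_fun_apply)
qed

locale spin_D =
  fixes n :: nat
  assumes n_ge_4: "4 \<le> n"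
begin

lemma type_D_spin: "type_D n (spin_vertex n F)"
  using n_ge_4 by unfold_locales (simp_all add: spin_vertex_def)

abbreviation key_w where "key_w F \<equiv> unit_dim (spin_vertex n F)"
abbreviation key_v where "key_v F \<equiv> ends_dim n (spin_vertex n F) (F - {n})"

lemma ends_subset: "F \<subseteq> {1..n} \<Longrightarrow> F - {n} \<subseteq> {1..n - 1}"
proof
  fix x assume "F \<subseteq> {1..n}" "x \<in> F - {n}"
  then have "x \<in> {1..n}" "x \<noteq> n" by blast+
  then show "x \<in> {1..n - 1}" unfolding atLeastAtMost_iff by linarith
qed

lemma spin_vertex_delete:
  assumes "finite F" "k \<in> F"
  shows "spin_vertex n (F - {k}) = type_D.other n (spin_vertex n F)"
proof -
  interpret type_D n "spin_vertex n F" by (rule type_D_spin)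
  have "card F = Suc (card (F - {k}))" using assms by (rule card.remove)
  then have "odd (card (F - {k})) \<longleftrightarrow> even (card F)" by simp
  then show ?thesis
    unfolding other_def unfolding spin_vertex_def by (cases "even (card F)") simp_all
qed

lemma spin_vertex_parity:
  assumes "finite F"
  shows "(spin_vertex n F = n \<longleftrightarrow> odd (card (F - {n}))) \<longleftrightarrow> n \<in> F"
proof -
  have n: "n - 1 \<noteq> n" using n_ge_4 by simp
  then have v: "spin_vertex n F = n \<longleftrightarrow> even (card F)" by (simp add: spin_vertex_def)
  show ?thesis
  proof (cases "n \<in> F")
    case True
    then have "card F = Suc (card (F - {n}))" using assms by (intro card.remove)
    then show ?thesis using True v by simp
  next
    case False
    then have "F - {n} = F" by blast
    then show ?thesis using False v by simp
  qed
qed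

text \<open>The degree \<open>(w, v)\<close> determines \<open>\<tau>\<close> and the endpoints; together they determine whether
  \<open>n \<in> F\<close>, by parity.\<close>

lemma key_inj:
  assumes F: "F \<subseteq> {1..n}" and G: "G \<subseteq> {1..n}" and w: "key_w F = key_w G" and v: "key_v F = key_v G"
  shows "F = G"
proof -
  have fin: "finite F" "finite G" using F G finite_subset by blast+
  have "key_w F (spin_vertex n F) = key_w G (spin_vertex n F)" by (simp only: w)
  then have eq: "spin_vertex n F = spin_vertex n G" by (simp add: unit_dim_def split: if_splits)
  interpret type_D n "spin_vertex n G" by (rule type_D_spin)
  have E: "F - {n} = G - {n}"
    using ends_dim_inj[OF ends_subset[OF F] ends_subset[OF G]] v unfolding eq by blast
  have "n \<in> F \<longleftrightarrow> n \<in> G"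
    using spin_vertex_parity[OF fin(1)] spin_vertex_parity[OF fin(2)] unfolding eq E by blast
  then show ?thesis using E by blast
qed

lemma spin_basis_eval:
  assumes F: "F \<subseteq> {1..n}"
  shows "spin_basis n F (key_w F, key_v F, y) = (if y = std_point n (spin_vertex n F) (key_v F) then 1 else 0)"
    and "(w, v) \<noteq> (key_w F, key_v F) \<Longrightarrow> spin_basis n F (w, v, y) = 0"
  by (auto simp: spin_basis_def spin_vec_def)

lemma fock_to_spin_key:
  assumes F: "F \<subseteq> {1..n}"
  shows "fock_to_spin n f (key_w F, key_v F, y) = f F * spin_basis n F (key_w F, key_v F, y)"
proof -
  have "fock_to_spin n f (key_w F, key_v F, y) =
      (\<Sum>G\<in>Pow {1..n}. if G = F then f F * spin_basis n F (key_w F, key_v F, y) else 0)"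
    unfolding fock_to_spin_def sum_fun_apply
  proof (rule sum.cong[OF refl])
    fix G assume "G \<in> Pow {1..n}"
    then have "G \<noteq> F \<Longrightarrow> spin_basis n G (key_w F, key_v F, y) = 0"
      using key_inj[OF F] by (intro spin_basis_eval(2)) auto
    then show "cscale (f G) (spin_basis n G) (key_w F, key_v F, y) =
        (if G = F then f F * spin_basis n F (key_w F, key_v F, y) else 0)"
      by (simp add: cscale_def)
  qed
  then show ?thesis using F by simp
qed

lemma fock_to_spin_other_key:
  assumes "\<And>F. F \<subseteq> {1..n} \<Longrightarrow> (w, v) \<noteq> (key_w F, key_v F)"
  shows "fock_to_spin n f (w, v, y) = 0"
  unfolding fock_to_spin_def sum_fun_apply
proof (rule sum.neutral, rule ballI)
  fix G assume "G \<in> Pow {1..n}"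
  then have "spin_basis n G (w, v, y) = 0" using assms[of G] by (intro spin_basis_eval(2)) auto
  then show "cscale (f G) (spin_basis n G) (w, v, y) = 0" by (simp add: cscale_def)
qed

lemma component_fock_to_spin:
  assumes F: "F \<subseteq> {1..n}"
  shows "component (key_w F) (key_v F) (fock_to_spin n f) = cscale (f F) (spin_basis n F)"
proof (rule ext, clarify)
  fix w v y
  show "component (key_w F) (key_v F) (fock_to_spin n f) (w, v, y) = cscale (f F) (spin_basis n F) (w, v, y)"
  proof (cases "(w, v) = (key_w F, key_v F)")
    case True
    then show ?thesis using fock_to_spin_key[OF F] by (simp add: component_def cscale_def)
  next
    case False
    then show ?thesis using spin_basis_eval(2)[OF F False] by (auto simp: component_def cscale_def)
  qed
qed

lemma degrees_fock_to_spin: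
  "degrees (fock_to_spin n f) = (\<lambda>F. (key_w F, key_v F)) ` {F \<in> Pow {1..n}. f F \<noteq> 0}"
proof (rule subset_antisym; rule subsetI)
  fix p assume "p \<in> degrees (fock_to_spin n f)"
  then obtain w v y where p: "p = (w, v)" and ne: "fock_to_spin n f (w, v, y) \<noteq> 0"
    by (auto simp: degrees_def)
  then obtain F where F: "F \<subseteq> {1..n}" "(w, v) = (key_w F, key_v F)"
    using fock_to_spin_other_key[of w v f y] by blast
  then have "f F \<noteq> 0" using ne fock_to_spin_key[OF F(1), of f y] by auto
  then show "p \<in> (\<lambda>F. (key_w F, key_v F)) ` {F \<in> Pow {1..n}. f F \<noteq> 0}" using F p by auto
next
  fix p assume "p \<in> (\<lambda>F. (key_w F, key_v F)) ` {F \<in> Pow {1..n}. f F \<noteq> 0}"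
  then obtain F where F: "F \<subseteq> {1..n}" "f F \<noteq> 0" and p: "p = (key_w F, key_v F)" by auto
  have "fock_to_spin n f (key_w F, key_v F, std_point n (spin_vertex n F) (key_v F)) \<noteq> 0"
    unfolding fock_to_spin_key[OF F(1)] spin_basis_eval(1)[OF F(1)] using F(2) by simp
  then show "p \<in> degrees (fock_to_spin n f)" unfolding p degrees_def by blast
qed

text \<open>Basis vectors have distinct degrees, so the homogeneous components of the image of \<open>f\<close> are
  the terms of its expansion.\<close>

lemma extend_linearly_fock_to_spin:
  assumes f: "f \<in> carrier (fock_module n)"
    and T: "\<And>F c. F \<subseteq> {1..n} \<Longrightarrow>
      T (key_w F) (key_v F) (cscale c (spin_basis n F)) = cscale c (fock_to_spin n (fock_act t (fock_basis F)))"
  shows "extend_linearly T (fock_to_spin n f) = fock_to_spin n (fock_act t f)"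
proof -
  let ?S = "{F \<in> Pow {1..n}. f F \<noteq> 0}"
  have inj: "inj_on (\<lambda>F. (key_w F, key_v F)) ?S"
    by (rule inj_onI) (use key_inj in auto)
  have "extend_linearly T (fock_to_spin n f) =
      (\<Sum>F\<in>?S. T (key_w F) (key_v F) (component (key_w F) (key_v F) (fock_to_spin n f)))"
    unfolding extend_linearly_def degrees_fock_to_spin sum.reindex[OF inj] by simp
  also have "\<dots> = (\<Sum>F\<in>?S. cscale (f F) (fock_to_spin n (fock_act t (fock_basis F))))"
    by (rule sum.cong[OF refl]) (simp add: component_fock_to_spin T)
  also have "\<dots> = (\<Sum>F\<in>Pow {1..n}. cscale (f F) (fock_to_spin n (fock_act t (fock_basis F))))"
    by (rule sum.mono_neutral_left) auto
  also have "\<dots> = fock_to_spin n (fock_act t (\<Sum>F\<in>Pow {1..n}. cscale (f F) (fock_basis F)))"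
    by (simp only: fock_act_sum fock_act_linear fock_to_spin_sum fock_to_spin_linear)
  also have "(\<Sum>F\<in>Pow {1..n}. cscale (f F) (fock_basis F)) = f"
    using fock_expansion[OF f] by simp
  finally show ?thesis .
qed

lemma fsign_ends: "k \<le> n \<Longrightarrow> fsign k (F - {n}) = fsign k F"
proof -
  assume "k \<le> n"
  then have "(F - {n}) \<inter> {..<k} = F \<inter> {..<k}" by auto
  then show ?thesis by (simp add: fsign_def)
qed

lemma fsign_last: "F \<subseteq> {1..n} \<Longrightarrow> (-1) ^ card (F - {n}) = fsign n F"
proof -
  assume "F \<subseteq> {1..n}"
  then have "x < n" if "x \<in> F" "x \<noteq> n" for x using that by fastforce
  then have "F \<inter> {..<n} = F - {n}" by auto
  then show ?thesis by (simp add: fsign_def)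
qed

text \<open>For \<open>k < n\<close> the operator removes the endpoint \<open>k\<close> and \<open>\<kappa>\<close> restores the parity rule. For
  \<open>k = n\<close> the diagram stays the same; the parity condition in the definition of the operator is
  \<open>n \<in> F\<close>.\<close>

lemma a_hom_spin_basis:
  assumes F: "F \<subseteq> {1..n}" and k: "k \<in> {1..n}"
  shows "a_hom n k (key_w F) (key_v F) (cscale c (spin_basis n F)) =
    cscale c (fock_to_spin n (fock_act (gen_a k) (fock_basis F)))"
proof -
  interpret type_D n "spin_vertex n F" by (rule type_D_spin)
  have fin: "finite F" using F finite_subset by blast
  have Fk: "F - {k} \<subseteq> {1..n}" using F by blast
  have rhs: "cscale c (fock_to_spin n (fock_act (gen_a k) (fock_basis F))) =
      (if k \<in> F then cscale (fsign k F * c) (spin_basis n (F - {k})) else 0)"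
    using fock_to_spin_basis[OF Fk] by (simp add: fock_act_a_basis fock_to_spin_linear mult.commute)
  have del: "spin_basis n (F - {k}) = spin_vec n other (F - {k} - {n})" if "k \<in> F"
    unfolding spin_basis_def spin_vertex_delete[OF fin that] ..
  show ?thesis
  proof (cases "k = n")
    case True
    have E: "F - {n} - {n} = F - {n}" by blast
    show ?thesis
      unfolding rhs unfolding True spin_basis_def[of n F] a_hom_last[OF ends_subset[OF F]]
        spin_vertex_parity[OF fin] fsign_last[OF F]
      using del unfolding True E by auto
  next
    case False
    then have k': "1 \<le> k" "k \<le> n - 1" "k \<le> n" using k by auto
    have mem: "k \<in> F - {n} \<longleftrightarrow> k \<in> F" using False by blast
    have E: "F - {n} - {k} = F - {k} - {n}" by blast
    show ?thesis
      unfolding rhs unfolding spin_basis_def[of n F] a_hom_spin_vec[OF ends_subset[OF F] k'(1,2)]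
        mem E fsign_ends[OF k'(3)]
      using del by auto
  qed
qed

lemma b_hom_spin_basis:
  assumes F: "F \<subseteq> {1..n}" and k: "k \<in> {1..n}"
  shows "b_hom n k (key_w F) (key_v F) (cscale c (spin_basis n F)) =
    cscale c (fock_to_spin n (fock_act (gen_b k) (fock_basis F)))"
proof -
  interpret type_D n "spin_vertex n F" by (rule type_D_spin)
  have fin: "finite F" using F finite_subset by blast
  have Fk: "insert k F \<subseteq> {1..n}" using F k by blast
  have rhs: "cscale c (fock_to_spin n (fock_act (gen_b k) (fock_basis F))) =
      (if k \<in> F then 0 else cscale (fsign k F * c) (spin_basis n (insert k F)))"
    using fock_to_spin_basis[OF Fk] by (simp add: fock_act_b_basis fock_to_spin_linear mult.commute)
  have ins: "spin_basis n (insert k F) = spin_vec n other (insert k F - {n})" if "k \<notin> F"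
  proof -
    interpret G: type_D n "spin_vertex n (insert k F)" by (rule type_D_spin)
    have "spin_vertex n F = G.other"
      using spin_vertex_delete[of "insert k F" k] fin that by simp
    then have "spin_vertex n (insert k F) = other"
      unfolding other_def G.other_def using G.tau n_ge_4 by linarith
    then show ?thesis by (simp add: spin_basis_def)
  qed
  show ?thesis
  proof (cases "k = n")
    case True
    have E: "insert n F - {n} = F - {n}" by blast
    show ?thesis
      unfolding rhs unfolding True spin_basis_def[of n F] b_hom_last[OF ends_subset[OF F]]
        spin_vertex_parity[OF fin] fsign_last[OF F]
      using ins unfolding True E by auto
  next
    case False
    then have k': "1 \<le> k" "k \<le> n - 1" "k \<le> n" using k by auto
    have mem: "k \<in> F - {n} \<longleftrightarrow> k \<in> F" using False by blast
    have E: "insert k (F - {n}) = insert k F - {n}" using False by blast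
    show ?thesis
      unfolding rhs unfolding spin_basis_def[of n F] b_hom_spin_vec[OF ends_subset[OF F] k'(1,2)]
        mem E fsign_ends[OF k'(3)]
      using ins by auto
  qed
qed

lemma spin_vec_eq_basis:
  assumes \<tau>: "\<tau> = n - 1 \<or> \<tau> = n" and E: "E \<subseteq> {1..n - 1}"
  shows "\<exists>F\<subseteq>{1..n}. spin_vec n \<tau> E = spin_basis n F"
proof -
  have fin: "finite E" using E finite_subset by blast
  have n: "n - 1 \<noteq> n" "n \<in> {1..n}" using n_ge_4 by simp_all
  have "x \<in> {1..n} \<and> x \<noteq> n" if "x \<in> E" for x
    using subsetD[OF E that] n_ge_4 unfolding atLeastAtMost_iff by linarith
  then have nE: "n \<notin> E" and sub: "E \<subseteq> {1..n}" by blast+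
  \<comment> \<open>The element \<open>n\<close> adjusts the parity of \<open>F\<close> to \<open>\<tau>\<close>.\<close>
  define F where "F = (if \<tau> = n \<longleftrightarrow> even (card E) then E else insert n E)"
  have "spin_vertex n F = \<tau>"
    using \<tau> n(1) fin nE by (auto simp: F_def spin_vertex_def)
  moreover have "F - {n} = E" using nE by (auto simp: F_def)
  moreover have "F \<subseteq> {1..n}" using sub n(2) by (simp add: F_def)
  ultimately show ?thesis unfolding spin_basis_def by blast
qed

lemma carrier_spin_module: "carrier (spin_module n) = fock_to_spin n ` carrier (fock_module n)"
proof (rule subset_antisym; rule subsetI)
  have T: "type_D n (n - 1)" "type_D n n" using n_ge_4 by unfold_locales simp_all
  note L = type_D.L_module_eq_span[OF T(1)] type_D.L_module_eq_span[OF T(2)]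
  let ?R = "fock_to_spin n ` carrier (fock_module n)"
  {
    have sub: "cfun.subspace ?R"
      unfolding cfun.subspace_def
    proof (intro conjI ballI allI)
      show "0 \<in> ?R" using fock_carrier_closed(1)[of n] fock_to_spin_linear(3)[of n] by (metis image_eqI)
      show "p + q \<in> ?R" if "p \<in> ?R" "q \<in> ?R" for p q
        using that fock_carrier_closed(2)[of _ n] fock_to_spin_linear(1)[of n] by (elim imageE) (metis image_eqI)
      show "cscale c p \<in> ?R" if "p \<in> ?R" for c p
        using that fock_carrier_closed(3)[of _ n] fock_to_spin_linear(2)[of n] by (elim imageE) (metis image_eqI)
    qed
    have "spin_basis n F \<in> ?R" if "F \<subseteq> {1..n}" for F
    proof -
      have "fock_basis F \<in> carrier (fock_module n)"
        using that by (simp add: fock_carrier_iff fock_basis_def)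
      then show ?thesis using fock_to_spin_basis[OF that] by (metis image_eqI)
    qed
    then have gens: "spin_vec n \<tau> ` Pow {1..n - 1} \<subseteq> ?R" if "\<tau> = n - 1 \<or> \<tau> = n" for \<tau>
      using spin_vec_eq_basis[OF that] by (metis (no_types, lifting) PowD image_subsetI)
    have "L_module n (unit_dim (n - 1)) \<subseteq> ?R" "L_module n (unit_dim n) \<subseteq> ?R"
      unfolding L by (intro cfun.span_minimal gens sub; simp)+
    moreover fix p assume "p \<in> carrier (spin_module n)"
    then obtain f g where "p = f + g" "f \<in> L_module n (unit_dim (n - 1))" "g \<in> L_module n (unit_dim n)"
      by (auto simp: spin_module_def)
    ultimately show "p \<in> ?R" using cfun.subspace_add[OF sub] by blast
  next
    fix p assume "p \<in> ?R"
    then obtain f where p: "p = fock_to_spin n f" by blast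
    let ?A = "{F \<in> Pow {1..n}. odd (card F)}" and ?B = "{F \<in> Pow {1..n}. even (card F)}"
    let ?t = "\<lambda>F. cscale (f F) (spin_basis n F)"
    have "Pow {1..n} = ?A \<union> ?B" "?A \<inter> ?B = {}" by auto
    then have split: "p = sum ?t ?A + sum ?t ?B"
      unfolding p fock_to_spin_def by (metis (no_types, lifting) sum.union_disjoint finite_Pow_iff finite_Un finite_atLeastAtMost)
    have "spin_basis n F \<in> spin_vec n (n - 1) ` Pow {1..n - 1}" if "F \<in> ?A" for F
      using that ends_subset[of F] by (simp add: spin_basis_def spin_vertex_def)
    then have "sum ?t ?A \<in> L_module n (unit_dim (n - 1))"
      unfolding L by (intro cfun.span_sum cfun.span_scale cfun.span_base)
    moreover have "spin_basis n F \<in> spin_vec n n ` Pow {1..n - 1}" if "F \<in> ?B" for F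
      using that ends_subset[of F] by (simp add: spin_basis_def spin_vertex_def)
    then have "sum ?t ?B \<in> L_module n (unit_dim n)"
      unfolding L by (intro cfun.span_sum cfun.span_scale cfun.span_base)
    ultimately show "p \<in> carrier (spin_module n)"
      unfolding split spin_module_def by auto
  }
qed

lemma linear_iso_fock_spin: "linear_iso (fock_module n) (spin_module n) (fock_to_spin n)"
proof -
  have "inj_on (fock_to_spin n) (carrier (fock_module n))"
  proof (rule inj_onI)
    fix f g assume f: "f \<in> carrier (fock_module n)" and g: "g \<in> carrier (fock_module n)"
      and eq: "fock_to_spin n f = fock_to_spin n g"
    show "f = g"
    proof
      fix F
      show "f F = g F"
      proof (cases "F \<subseteq> {1..n}")
        case True
        let ?y = "std_point n (spin_vertex n F) (key_v F)"
        have "f F = fock_to_spin n f (key_w F, key_v F, ?y)" "g F = fock_to_spin n g (key_w F, key_v F, ?y)"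
          unfolding fock_to_spin_key[OF True] spin_basis_eval(1)[OF True] by simp_all
        then show ?thesis using eq by simp
      next
        case False
        then have "f F = 0" "g F = 0" using f g unfolding fock_carrier_iff by blast+
        then show ?thesis by simp
      qed
    qed
  qed
  moreover have "zero (spin_module n) = 0" "add (spin_module n) = (+)" "smult (spin_module n) = cscale"
    by (simp_all add: spin_module_def)
  ultimately show ?thesis
    unfolding linear_iso_def bij_betw_def carrier_spin_module by (simp add: fock_to_spin_linear)
qed

lemma a_op_fock:
  assumes "f \<in> carrier (fock_module n)" "k \<in> {1..n}"
  shows "a_op n k (fock_to_spin n f) = fock_to_spin n (fock_act (gen_a k) f)"
proof -
  have "fock_to_spin n f \<in> carrier (spin_module n)" unfolding carrier_spin_module using assms(1) by (rule imageI)
  then show ?thesis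
    using extend_linearly_fock_to_spin[OF assms(1) a_hom_spin_basis[OF _ assms(2)]] by (simp add: a_op_def)
qed

lemma b_op_fock:
  assumes "f \<in> carrier (fock_module n)" "k \<in> {1..n}"
  shows "b_op n k (fock_to_spin n f) = fock_to_spin n (fock_act (gen_b k) f)"
proof -
  have "fock_to_spin n f \<in> carrier (spin_module n)" unfolding carrier_spin_module using assms(1) by (rule imageI)
  then show ?thesis
    using extend_linearly_fock_to_spin[OF assms(1) b_hom_spin_basis[OF _ assms(2)]] by (simp add: b_op_def)
qed

lemma spin_rep:
  "algebra_rep (clifford n) (clifford_scalar n) (spin_module n)
    (transport (fock_module n) (spin_module n) (fock_to_spin n) (clifford_fock n))"
  by (rule algebra_rep_transport[OF algebra_rep_clifford_fock linear_iso_fock_spin])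

lemma spin_rep_gen:
  assumes k: "k \<in> {1..n}"
  shows "transport (fock_module n) (spin_module n) (fock_to_spin n) (clifford_fock n) (clifford_gen n (gen_a k)) = a_op n k"
    and "transport (fock_module n) (spin_module n) (fock_to_spin n) (clifford_fock n) (clifford_gen n (gen_b k)) = b_op n k"
proof -
  have gens: "gen_a k \<in> basis_W n" "gen_b k \<in> basis_W n" using k by (simp_all add: basis_W_def)
  show "transport (fock_module n) (spin_module n) (fock_to_spin n) (clifford_fock n) (clifford_gen n (gen_a k)) = a_op n k"
    by (rule transport_eqI[OF linear_iso_fock_spin])
      (simp_all add: clifford_fock_gen[OF gens(1)] a_op_fock[OF _ k], simp_all add: a_op_def)
  show "transport (fock_module n) (spin_module n) (fock_to_spin n) (clifford_fock n) (clifford_gen n (gen_b k)) = b_op n k"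
    by (rule transport_eqI[OF linear_iso_fock_spin])
      (simp_all add: clifford_fock_gen[OF gens(2)] b_op_fock[OF _ k], simp_all add: b_op_def)
qed

end

theorem theorem5p4:
  fixes n :: nat
  assumes "n \<ge> 4"
  shows "\<exists>\<rho> \<sigma>.
    algebra_rep (clifford n) (clifford_scalar n) (spin_module n) \<rho> \<and>
    (\<forall>k\<in>{1..n}. \<rho> (clifford_gen n (gen_a k)) = a_op n k \<and> \<rho> (clifford_gen n (gen_b k)) = b_op n k) \<and>
    algebra_rep (clifford n) (clifford_scalar n) (exterior n) \<sigma> \<and>
    (\<forall>k\<in>{1..n}. \<sigma> (clifford_gen n (gen_a k)) = exterior_A n k \<and>
                 \<sigma> (clifford_gen n (gen_b k)) = exterior_B n k) \<and>
    rep_isomorphic (clifford n) (spin_module n) \<rho> (exterior n) \<sigma>"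
proof -
  interpret spin_D n using assms by unfold_locales
  let ?\<rho> = "transport (fock_module n) (spin_module n) (fock_to_spin n) (clifford_fock n)"
  let ?\<sigma> = "transport (fock_module n) (exterior n) (fock_to_exterior n) (clifford_fock n)"
  have "rep_isomorphic (clifford n) (spin_module n) ?\<rho> (exterior n) ?\<sigma>"
    by (rule rep_isomorphic_transport[OF algebra_rep_clifford_fock linear_iso_fock_spin linear_iso_fock_exterior])
  then show ?thesis
    using spin_rep spin_rep_gen exterior_rep exterior_rep_gen
    by (intro exI[of _ ?\<rho>] exI[of _ ?\<sigma>] conjI ballI) blast+
qed

end
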